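(* Let $p\in\mathbb{N}^*$, $\delta\in(0,1)$, $\beta>0$, $R_0>0$, $\rho\in[0,1]$, $\sigma_+>0$, let $(\boldsymbol\theta,\sigma)\in\mathcal{C}(\beta,R_0,\delta,\rho,\sigma_+)$, let $(\xi_t)_{t\in\mathbb{Z}}$ be an i.i.d. sequence with zero mean and unit variance, and let $(X_{t,T})_{t\in\mathbb{Z},T\ge T_0}$ be the TVAR process with time varying AR coefficients $\theta_1,\dots,\theta_p$, time varying standard deviation $\sigma$ and innovations $(\xi_t)_{t\in\mathbb{Z}}$. Then the following hold. (i) There exist constants $R$ and $T_0$ depending only on $p,\delta,\sigma_+,\beta$ and $R_0$ such that $(X_{t,T})_{t\in\mathbb{Z},T\ge T_0}$ is $(\beta,R)$-weakly locally stationary with local spectral density $$f(u,\lambda)=\frac{\sigma^2(u)}{2\pi}\left|\boldsymbol\theta(e^{-\mathrm{i}\lambda};u)\right|^{-2}.$$ Moreover, for all $T\ge T_0$ and $t\in\mathbb{Z}$, $\boldsymbol\theta(t/T)=\boldsymbol\theta^*_{t,T}=\boldsymbol\theta_{t/T}$, where $\boldsymbol\theta^*_{t,T}$ and $\boldsymbol\theta_{t/T}$ are the optimal and local prediction coefficients of order $d=p$. (ii) If $\rho\in(0,1]$, there exist constants $R$, $T_0$ and $f_->0$ depending only on $p,\delta,\rho,\sigma_+,\beta$ and $R_0$ such that $(X_{t,T})_{t\in\mathbb{Z},T\ge T_0}$ is $(\beta,R)$-weakly locally stationary (with the same $\beta$) with local spectral density $f$ satisfying $f(u,\lambda)\ge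 f_-$ for all $u,\lambda\in\mathbb{R}$. (iii) If $\mathbb{P}(\xi_0=x)=0$ for all $x\in\mathbb{R}$, then $\mathbb{P}(X_{t,T}=0)=0$ for all $t\in\mathbb{Z}$ and $T\ge T_0$. (iv) If $\mathbb{E}[|\xi_0|^q]<\infty$ for all $q>0$, then $(X_{t,T})_{t\in\mathbb{Z},T\ge T_0}$ satisfies Assumption (C) with $C$ depending only on $R_0,\beta,\delta,\sigma_+$ and with $\mu$ the distribution of $\xi_0$.
   Context: Notation: $\mathbb{N}=\{0,1,2,\dots\}$, $\mathbb{N}^*=\{1,2,\dots\}$; $\|\cdot\|$ is the Euclidean norm of vectors. Hölder balls. For $\alpha\in(0,1]$ and $g:\mathbb{R}\to\mathbb{C}^m$, $|g|_{\alpha,0}=\sup_{0<|s-s'|<1}\|g(s)-g(s')\|/|s-s'|^\alpha$. For $\beta=k+\alpha$ with $k\in\mathbb{N}$, $\alpha\in(0,1]$, $|g|_\beta=|g^{(k)}|_{\alpha,0}+\max_{0\le s\le k}\|g^{(s)}\|_\infty$ if $g$ is $k$ times differentiable, and $|g|_\beta=\infty$ otherwise. $\Lambda_m(\beta,R)=\{g:\mathbb{R}\to\mathbb{C}^m: |g|_\beta\le R\}$. TVAR parameters. For $\boldsymbol\theta=[\theta_1,\dots,\theta_p]':\mathbb{R}\to\mathbb{R}^p$, $\boldsymbol\theta(z;u)=1-\sum_{j=1}^p\theta_j(u)z^j$. $s_p(\delta)$ is the set of $\boldsymbol\theta:\mathbb{R}\to\mathbb{R}^p$ with $\boldsymbol\theta(z;u)\ne0$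 for all complex $|z|<\delta^{-1}$ and all $u\in\mathbb{R}$. $\mathcal{C}(\beta,R,\delta,\rho,\sigma_+)$ is the set of $(\boldsymbol\theta,\sigma):\mathbb{R}\to\mathbb{R}^p\times[\rho\sigma_+,\sigma_+]$ with $\boldsymbol\theta\in\Lambda_p(\beta,R)\cap s_p(\delta)$ and $\sigma\in\Lambda_1(\beta,R)$. TVAR process. Given $\delta\in(0,1),\rho\in[0,1],\sigma_+>0,\beta>0,R_0>0$, it is known that there is a large enough $T_0$, depending only on $\delta,\beta,R_0$, such that for all $(\boldsymbol\theta,\sigma)\in\mathcal{C}(\beta,R_0,\delta,\rho,\sigma_+)$ there is a unique process $(X_{t,T})_{t\in\mathbb{Z},T\ge T_0}$ satisfying $$X_{t,T}=\sum_{j=1}^p\theta_j(t/T)X_{t-j,T}+\sigma(t/T)\xi_t$$ for all $t\in\mathbb{Z}$, $T\ge T_0$, and such that for each $T\ge T_0$, $X_{t,T}$ is bounded in probability as $t\to-\infty$. This is called the TVAR process with these parameters and innovations. The constant $T_0$ may change from line to line to guarantee additional properties of the solution, but always so that it depends at most on $\beta,R_0,\delta,\rho,\sigma_+$ (and on $p$ where so stated); the process is then restricted to $T\ge T_0$. Weak local stationarity. A local spectral density is a function $f:\mathbb{R}^2\to\mathbb{R}_+$ that is $2\pi$-periodic and locally integrable in its second variable; its local covariance function is $\gamma(u,\ell)=\int_{-\pi}^{\pi}e^{\mathrm{i}\ell\lambda}f(u,\lambda)\,d\lambda$. An array $(X_{t,T})_{t\in\mathbb{Z},T\ge T_0}$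 with finite variances is $(\beta,R)$-weakly locally stationary with local spectral density $f$ if $f(\cdot,\lambda)\in\Lambda_1(\beta,R)$ for all $\lambda\in\mathbb{R}$ and, with $\gamma^*(t,T,\ell)=\mathrm{cov}(X_{t,T},X_{t-\ell,T})$, $|\gamma^*(t,T,\ell)-\gamma(t/T,\ell)|\le R\,T^{-\min(1,\beta)}$ for all $t,\ell\in\mathbb{Z}$, $T\ge T_0$. Prediction coefficients of order $d$. Optimal: $\boldsymbol\theta^*_{t,T}=\arg\min_{\boldsymbol\vartheta\in\mathbb{R}^d}\mathbb{E}[(X_{t,T}-\sum_{k=1}^d\vartheta_kX_{t-k,T})^2]$. Local: $\boldsymbol\theta_u=\Gamma_u^{-1}\boldsymbol\gamma_u$ with $\boldsymbol\gamma_u=[\gamma(u,1),\dots,\gamma(u,d)]'$, $\Gamma_u=(\gamma(u,i-j))_{1\le i,j\le d}$. Taper assumption (H). $h:[0,1]\to\mathbb{R}$ is piecewise continuously differentiable, that is, for $0=u_0<u_1<\dots<u_N=1$, $h$ is $\mathcal{C}^1$ on $(u_{i-1},u_i]$, $i=1,\dots,N$; moreover $\int_0^1h^2=1$, $\|h\|_\infty=\sup_{[0,1]}|h|<\infty$ and $\|h'\|_\infty=\max_{1\le i\le N}\sup_{u\in(u_{i-1},u_i]}|h'(u)|<\infty$. Local empirical covariance. For $M\in2\mathbb{N}^*$, $$\widehat\gamma_{T,M}(u,\ell)=\frac1{H_M}\sum_{\substack{t_1,t_2=1\\ t_1-t_2=\ell}}^{M}h\left(\tfrac{t_1}M\right)h\left(\tfrac{t_2}M\right)X_{\lfloor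 uT\rfloor+t_1-M/2,T}\,X_{\lfloor uT\rfloor+t_2-M/2,T},\qquad H_M=\sum_{k=1}^Mh^2(k/M),$$ with $\widehat\gamma_{T,M}(u,\ell)=0$ if $H_M=0$. Order notation. $U_M=O_{L^p,\boldsymbol c}(u(M))$ means $(\mathbb{E}|U_M|^p)^{1/p}\le C_{p,\boldsymbol c}|u(M)|$ for all $M$, with $C_{p,\boldsymbol c}$ depending continuously and at most on $(p,\boldsymbol c)$. $U_M=O_{L^\bullet(\mu),\boldsymbol c}(u(M))$ means $U_M=O_{L^p,m_p,\boldsymbol c}(u(M))$ for all $p\in[1,\infty)$, where $m_p$ is a constant depending only on the absolute moments $\int|x|^q\mu(dx)$, $q\ge1$. (Here $p$ is the exponent, not the TVAR order.) Assumption (C) with constant $C>0$ and distribution $\mu$: for all $\ell\in\mathbb{Z}$, all $h$ satisfying (H), all $u\in\mathbb{R}$ and $T\ge T_0$, $\widehat\gamma_{T,M}(u,\ell)-\mathbb{E}[\widehat\gamma_{T,M}(u,\ell)]=O_{L^\bullet(\mu),\ell,\|h\|_\infty,\|h'\|_\infty,C}(M^{-1/2})$.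
   Formalization: For ρ=0, cases with vanishing σ are excluded from uniqueness/invertibility in (i), and X=0 a.s. from (iii); in (iii), (iv) T_0 and C may depend on p; the constant in (C) may depend on the number N of taper pieces; constants are chosen per sample-space type. *)

theory Defs
  imports
    "HOL-Probability.Probability"
    "Jordan_Normal_Form.Gauss_Jordan_Elimination"
begin

text \<open>
  A vector in \<open>m\<close>-dimensional space is a function on \<open>nat\<close> of which only the components
  \<open>1, \<dots>, m\<close> matter. Components are taken in any real normed space, so that real-valued
  functions need not be embedded into the complex numbers.
\<close>

definition vnorm :: "nat \<Rightarrow> (nat \<Rightarrow> 'a::real_normed_vector) \<Rightarrow> real" where
  "vnorm m v = L2_set (\<lambda>i. norm (v i)) {1..m}"

definition iter_vderiv :: "nat \<Rightarrow> (real \<Rightarrow> 'a::real_normed_vector) \<Rightarrow> real \<Rightarrow> 'a" where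
  "iter_vderiv k f = ((\<lambda>g s. vector_derivative g (at s)) ^^ k) f"

definition times_differentiable ::
    "nat \<Rightarrow> nat \<Rightarrow> (real \<Rightarrow> nat \<Rightarrow> 'a::real_normed_vector) \<Rightarrow> bool" where
  "times_differentiable m k g \<longleftrightarrow>
     (\<forall>i\<in>{1..m}. \<forall>j<k. \<forall>s. iter_vderiv j (\<lambda>x. g x i) differentiable (at s))"

definition vderiv ::
    "nat \<Rightarrow> (real \<Rightarrow> nat \<Rightarrow> 'a::real_normed_vector) \<Rightarrow> real \<Rightarrow> nat \<Rightarrow> 'a" where
  "vderiv k g s i = iter_vderiv k (\<lambda>x. g x i) s"

definition holder_seminorm ::
    "nat \<Rightarrow> real \<Rightarrow> (real \<Rightarrow> nat \<Rightarrow> 'a::real_normed_vector) \<Rightarrow> ereal" where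
  "holder_seminorm m \<alpha> g =
     (SUP (s, s') \<in> {(s, s'). 0 < \<bar>s - s'\<bar> \<and> \<bar>s - s'\<bar> < 1}.
        ereal (vnorm m (\<lambda>i. g s i - g s' i) / \<bar>s - s'\<bar> powr \<alpha>))"

text \<open>
  \<open>\<lceil>\<beta>\<rceil> - 1\<close> is the unique natural \<open>k\<close> with \<open>\<beta> - k\<close> in \<open>(0, 1]\<close>; in particular an integer
  \<open>\<beta>\<close> gives \<open>k = \<beta> - 1\<close> and a Lipschitz condition on the last derivative.
\<close>

definition holder_norm ::
    "nat \<Rightarrow> real \<Rightarrow> (real \<Rightarrow> nat \<Rightarrow> 'a::real_normed_vector) \<Rightarrow> ereal" where
  "holder_norm m \<beta> g =
     (let k = nat (\<lceil>\<beta>\<rceil> - 1); \<alpha> = \<beta> - real k in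
      if times_differentiable m k g
      then holder_seminorm m \<alpha> (vderiv k g)
           + Max ((\<lambda>j. SUP s. ereal (vnorm m (vderiv j g s))) ` {0..k})
      else \<infinity>)"

definition holder_ball ::
    "nat \<Rightarrow> real \<Rightarrow> real \<Rightarrow> (real \<Rightarrow> nat \<Rightarrow> 'a::real_normed_vector) set" where
  "holder_ball m \<beta> R = {g. holder_norm m \<beta> g \<le> ereal R}"

definition ar_poly :: "nat \<Rightarrow> (real \<Rightarrow> nat \<Rightarrow> real) \<Rightarrow> complex \<Rightarrow> real \<Rightarrow> complex" where
  "ar_poly p \<theta> z u = 1 - (\<Sum>j=1..p. complex_of_real (\<theta> u j) * z ^ j)"

definition stable_set :: "nat \<Rightarrow> real \<Rightarrow> (real \<Rightarrow> nat \<Rightarrow> real) set" where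
  "stable_set p \<delta> = {\<theta>. \<forall>u z. cmod z < 1 / \<delta> \<longrightarrow> ar_poly p \<theta> z u \<noteq> 0}"

definition tvar_class :: "nat \<Rightarrow> real \<Rightarrow> real \<Rightarrow> real \<Rightarrow> real \<Rightarrow> real \<Rightarrow>
    ((real \<Rightarrow> nat \<Rightarrow> real) \<times> (real \<Rightarrow> real)) set" where
  "tvar_class p \<beta> R \<delta> \<rho> \<sigma>p =
     {(\<theta>, \<sigma>). \<theta> \<in> holder_ball p \<beta> R \<inter> stable_set p \<delta>
            \<and> (\<lambda>u _. \<sigma> u) \<in> holder_ball 1 \<beta> R
            \<and> (\<forall>u. \<sigma> u \<in> {\<rho> * \<sigma>p..\<sigma>p})}"

definition innovations :: "'w measure \<Rightarrow> (int \<Rightarrow> 'w \<Rightarrow> real) \<Rightarrow> bool" where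
  "innovations M \<xi> \<longleftrightarrow>
     prob_space M
     \<and> prob_space.indep_vars M (\<lambda>_. borel) \<xi> UNIV
     \<and> (\<forall>t. distr M borel (\<xi> t) = distr M borel (\<xi> 0))
     \<and> integrable M (\<xi> 0) \<and> prob_space.expectation M (\<xi> 0) = 0
     \<and> integrable M (\<lambda>w. (\<xi> 0 w)\<^sup>2) \<and> prob_space.variance M (\<xi> 0) = 1"

definition bounded_in_prob_at_minus_inf :: "'w measure \<Rightarrow> (int \<Rightarrow> 'w \<Rightarrow> real) \<Rightarrow> bool" where
  "bounded_in_prob_at_minus_inf M Y \<longleftrightarrow>
     (\<forall>\<epsilon>>0. \<exists>K. \<exists>t0. \<forall>t\<le>t0. prob_space.prob M {w \<in> space M. \<bar>Y t w\<bar> > K} \<le> \<epsilon>)"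

definition tvar_process :: "'w measure \<Rightarrow> nat \<Rightarrow> (real \<Rightarrow> nat \<Rightarrow> real) \<Rightarrow> (real \<Rightarrow> real) \<Rightarrow>
    (int \<Rightarrow> 'w \<Rightarrow> real) \<Rightarrow> nat \<Rightarrow> (int \<Rightarrow> nat \<Rightarrow> 'w \<Rightarrow> real) \<Rightarrow> bool" where
  "tvar_process M p \<theta> \<sigma> \<xi> T0 X \<longleftrightarrow>
     (\<forall>T\<ge>T0.
        (\<forall>t. X t T \<in> borel_measurable M)
        \<and> (\<forall>t. AE w in M.
              X t T w = (\<Sum>j=1..p. \<theta> (real_of_int t / real T) j * X (t - int j) T w)
                        + \<sigma> (real_of_int t / real T) * \<xi> t w)
        \<and> bounded_in_prob_at_minus_inf M (\<lambda>t. X t T))"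

definition local_spectral_density :: "(real \<Rightarrow> real \<Rightarrow> real) \<Rightarrow> bool" where
  "local_spectral_density f \<longleftrightarrow>
     (\<forall>u x. 0 \<le> f u x)
     \<and> (\<forall>u x. f u (x + 2 * pi) = f u x)
     \<and> (\<forall>u a b. set_integrable lborel {a..b} (f u))"

definition local_cov :: "(real \<Rightarrow> real \<Rightarrow> real) \<Rightarrow> real \<Rightarrow> int \<Rightarrow> complex" where
  "local_cov f u l =
     set_lebesgue_integral lborel {-pi..pi}
       (\<lambda>x. exp (\<i> * of_int l * complex_of_real x) * complex_of_real (f u x))"

definition cov :: "'w measure \<Rightarrow> ('w \<Rightarrow> real) \<Rightarrow> ('w \<Rightarrow> real) \<Rightarrow> real" where
  "cov M Y Z = prob_space.expectation M
     (\<lambda>w. (Y w - prob_space.expectation M Y) * (Z w - prob_space.expectation M Z))"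

definition weakly_locally_stationary :: "'w measure \<Rightarrow> real \<Rightarrow> real \<Rightarrow> nat \<Rightarrow>
    (int \<Rightarrow> nat \<Rightarrow> 'w \<Rightarrow> real) \<Rightarrow> (real \<Rightarrow> real \<Rightarrow> real) \<Rightarrow> bool" where
  "weakly_locally_stationary M \<beta> R T0 X f \<longleftrightarrow>
     local_spectral_density f
     \<and> (\<forall>t. \<forall>T\<ge>T0. X t T \<in> borel_measurable M \<and> integrable M (\<lambda>w. (X t T w)\<^sup>2))
     \<and> (\<forall>x. (\<lambda>u _. f u x) \<in> holder_ball 1 \<beta> R)
     \<and> (\<forall>t l. \<forall>T\<ge>T0.
          cmod (complex_of_real (cov M (X t T) (X (t - l) T))
                - local_cov f (real_of_int t / real T) l)
          \<le> R * real T powr (- min 1 \<beta>))"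

definition tvar_spectral_density ::
    "nat \<Rightarrow> (real \<Rightarrow> nat \<Rightarrow> real) \<Rightarrow> (real \<Rightarrow> real) \<Rightarrow> real \<Rightarrow> real \<Rightarrow> real" where
  "tvar_spectral_density p \<theta> \<sigma> u x =
     (\<sigma> u)\<^sup>2 / (2 * pi) * cmod (ar_poly p \<theta> (exp (- \<i> * complex_of_real x)) u) powi (-2)"

definition prediction_risk :: "'w measure \<Rightarrow> nat \<Rightarrow> (int \<Rightarrow> nat \<Rightarrow> 'w \<Rightarrow> real) \<Rightarrow>
    int \<Rightarrow> nat \<Rightarrow> (nat \<Rightarrow> real) \<Rightarrow> real" where
  "prediction_risk M d X t T \<phi> =
     prob_space.expectation M (\<lambda>w. (X t T w - (\<Sum>k=1..d. \<phi> k * X (t - int k) T w))\<^sup>2)"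

text \<open>
  Here a coefficient vector has to be an extensional function on \<open>{1..d}\<close>, so that uniqueness of
  a minimiser is not spoilt by irrelevant components.
\<close>

definition optimal_coeffs :: "'w measure \<Rightarrow> nat \<Rightarrow> (int \<Rightarrow> nat \<Rightarrow> 'w \<Rightarrow> real) \<Rightarrow>
    int \<Rightarrow> nat \<Rightarrow> (nat \<Rightarrow> real) set" where
  "optimal_coeffs M d X t T =
     {\<phi>. is_arg_min (prediction_risk M d X t T) (\<lambda>\<phi>. \<phi> \<in> {1..d} \<rightarrow>\<^sub>E UNIV) \<phi>}"

text \<open>Matrices and vectors of \<^theory>\<open>Jordan_Normal_Form.Matrix\<close> are indexed from 0.\<close>

definition local_cov_mat :: "nat \<Rightarrow> (real \<Rightarrow> real \<Rightarrow> real) \<Rightarrow> real \<Rightarrow> complex Matrix.mat" where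
  "local_cov_mat d f u = Matrix.mat d d (\<lambda>(i, j). local_cov f u (int i - int j))"

definition local_cov_vec :: "nat \<Rightarrow> (real \<Rightarrow> real \<Rightarrow> real) \<Rightarrow> real \<Rightarrow> complex Matrix.vec" where
  "local_cov_vec d f u = Matrix.vec d (\<lambda>i. local_cov f u (int (Suc i)))"

text \<open>Only meaningful if \<open>local_cov_mat d f u\<close> is invertible.\<close>

definition local_coeffs :: "nat \<Rightarrow> (real \<Rightarrow> real \<Rightarrow> real) \<Rightarrow> real \<Rightarrow> complex Matrix.vec" where
  "local_coeffs d f u = the (mat_inverse (local_cov_mat d f u)) *\<^sub>v local_cov_vec d f u"

definition coeff_vec :: "nat \<Rightarrow> (nat \<Rightarrow> real) \<Rightarrow> complex Matrix.vec" where
  "coeff_vec d \<phi> = Matrix.vec d (\<lambda>i. complex_of_real (\<phi> (Suc i)))"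

text \<open>
  \<open>h'\<close> is the derivative of \<open>h\<close> on \<open>(0, 1]\<close> (one-sided at the break points) and \<open>N\<close> the number of
  pieces. The maximum over the pieces of the suprema of \<open>\<bar>h'\<bar>\<close> is the supremum over \<open>(0, 1]\<close>.
\<close>

definition taper :: "nat \<Rightarrow> (real \<Rightarrow> real) \<Rightarrow> (real \<Rightarrow> real) \<Rightarrow> bool" where
  "taper N h h' \<longleftrightarrow>
     (\<exists>us :: nat \<Rightarrow> real. us 0 = 0 \<and> us N = 1 \<and>
        (\<forall>i<N. us i < us (Suc i)
           \<and> (\<forall>x\<in>{us i<..us (Suc i)}.
                (h has_real_derivative h' x) (at x within {us i<..us (Suc i)}))
           \<and> continuous_on {us i<..us (Suc i)} h'))
     \<and> ((\<lambda>x. (h x)\<^sup>2) has_integral 1) {0..1}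
     \<and> bdd_above ((\<lambda>x. \<bar>h x\<bar>) ` {0..1})
     \<and> bdd_above ((\<lambda>x. \<bar>h' x\<bar>) ` {0<..1})"

definition sup_norm_on :: "real set \<Rightarrow> (real \<Rightarrow> real) \<Rightarrow> real" where
  "sup_norm_on A g = (SUP x\<in>A. \<bar>g x\<bar>)"

definition taper_weight :: "(real \<Rightarrow> real) \<Rightarrow> nat \<Rightarrow> real" where
  "taper_weight h n = (\<Sum>k=1..n. (h (real k / real n))\<^sup>2)"

definition emp_cov :: "(real \<Rightarrow> real) \<Rightarrow> nat \<Rightarrow> (int \<Rightarrow> nat \<Rightarrow> 'w \<Rightarrow> real) \<Rightarrow> nat \<Rightarrow>
    real \<Rightarrow> int \<Rightarrow> 'w \<Rightarrow> real" where
  "emp_cov h n X T u l w =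
     (if taper_weight h n = 0 then 0
      else 1 / taper_weight h n *
        (\<Sum>(t1, t2) \<in> {(t1, t2). t1 \<in> {1..n} \<and> t2 \<in> {1..n} \<and> int t1 - int t2 = l}.
           h (real t1 / real n) * h (real t2 / real n)
           * X (\<lfloor>u * real T\<rfloor> + int t1 - int (n div 2)) T w
           * X (\<lfloor>u * real T\<rfloor> + int t2 - int (n div 2)) T w))"

definition abs_moments :: "real measure \<Rightarrow> real \<Rightarrow> real" where
  "abs_moments \<mu> = (\<lambda>q\<in>{1..}. \<integral>x. \<bar>x\<bar> powr q \<partial>\<mu>)"

text \<open>
  The constants hidden in the order notation. They have to be chosen before the process, the
  taper, the location and the sample size: \<open>K N l q m a b C\<close> is the constant for the exponent
  \<open>q\<close>, the moment constant \<open>m\<close>, the lag \<open>l\<close>, the norms \<open>a\<close> of the taper and \<open>b\<close> of its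
  derivative, and the constant \<open>C\<close> of the assumption. It may also depend on the number \<open>N\<close> of
  pieces of the taper: piecewise constant tapers with a number of pieces growing with the sample
  size can vanish at all but one of the sampling points, which rules out a bound that is uniform
  in \<open>N\<close>.
\<close>

definition continuous_constant ::
    "(nat \<Rightarrow> int \<Rightarrow> real \<Rightarrow> real \<Rightarrow> real \<Rightarrow> real \<Rightarrow> real \<Rightarrow> real) \<Rightarrow> bool" where
  "continuous_constant K \<longleftrightarrow>
     (\<forall>N l. continuous_on ({1..} \<times> UNIV \<times> {0..} \<times> {0..} \<times> {0<..})
        (\<lambda>(q, m, a, b, C). K N l q m a b C))"

definition Lp_bound :: "'w measure \<Rightarrow> real \<Rightarrow> ('w \<Rightarrow> real) \<Rightarrow> real \<Rightarrow> bool" where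
  "Lp_bound M q U B \<longleftrightarrow>
     U \<in> borel_measurable M
     \<and> integrable M (\<lambda>w. \<bar>U w\<bar> powr q)
     \<and> prob_space.expectation M (\<lambda>w. \<bar>U w\<bar> powr q) powr (1 / q) \<le> B"

text \<open>
  \<open>\<kappa> q\<close> maps the absolute moments of order at least 1 of \<open>\<mu>\<close> to the moment constant belonging
  to the exponent \<open>q\<close>.
\<close>

definition assumption_C ::
    "(nat \<Rightarrow> int \<Rightarrow> real \<Rightarrow> real \<Rightarrow> real \<Rightarrow> real \<Rightarrow> real \<Rightarrow> real) \<Rightarrow>
     (real \<Rightarrow> (real \<Rightarrow> real) \<Rightarrow> real) \<Rightarrow>
     'w measure \<Rightarrow> nat \<Rightarrow> (int \<Rightarrow> nat \<Rightarrow> 'w \<Rightarrow> real) \<Rightarrow> real \<Rightarrow> real measure \<Rightarrow> bool" where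
  "assumption_C K \<kappa> M T0 X C \<mu> \<longleftrightarrow>
     (\<forall>l N h h' u T. taper N h h' \<longrightarrow> T0 \<le> T \<longrightarrow>
        (\<forall>n q. even n \<longrightarrow> 0 < n \<longrightarrow> 1 \<le> q \<longrightarrow>
           integrable M (emp_cov h n X T u l)
           \<and> Lp_bound M q
               (\<lambda>w. emp_cov h n X T u l w - prob_space.expectation M (emp_cov h n X T u l))
               (K N l q (\<kappa> q (abs_moments \<mu>))
                  (sup_norm_on {0..1} h) (sup_norm_on {0<..1} h') C
                * real n powr (- 1 / 2))))"

end

theory Submission
  imports Defs "HOL-Computational_Algebra.Fundamental_Theorem_Algebra" "Jordan_Normal_Form.Determinant"
begin

text \<open>
  A time varying autoregression is a slowly varying perturbation of the stationary
  autoregressions obtained by freezing its coefficients. The whole theorem rests on two estimates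
  of its impulse response, uniform over the parameter class: it decays geometrically, and it is
  within \<open>O(T powr (- min 1 \<beta>))\<close> of the frozen impulse response.

  The frozen impulse response consists of the Taylor coefficients of \<open>1 / \<theta>(z; u)\<close>. Since
  \<open>\<theta>(z; u)\<close> is a product of at most \<open>p\<close> factors \<open>1 - r z\<close> with \<open>\<bar>r\<bar> \<le> \<delta>\<close>, they decay
  geometrically with explicit constants (\<open>green_stable_decay\<close>). A discrete variation of
  constants formula expresses the difference of the two responses by increments of the
  coefficients, which are small for large \<open>T\<close>. Strong induction turns this into decay of the
  time varying response (\<open>green_decay\<close>) and into closeness (\<open>perturbation_bound\<close>).

  Iterating the recursion into the past leaves a boundary term, which the decay and boundedness in
  probability at \<open>- \<infinity>\<close> send to 0. So the process is almost surely the innovations filtered by the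
  impulse response (\<open>recursion_solution_unique\<close>), and each part becomes a statement on linear
  filters of white noise.

  \<^item> Covariances are series in the impulse response. With the frozen response in its place they
    become the Fourier coefficients of the local spectral density (\<open>local_cov_tvar\<close>). The density
    is a rational function of the coefficients with denominator bounded away from 0, and Hoelder
    classes are closed under products and such reciprocals. The recursion of the frozen response
    is the Yule-Walker system, and the value 1 of this response at time 0 makes the local
    covariance matrix definite. The present innovation is orthogonal to the past, so the prediction risk is
    \<open>(\<sigma> u)\<^sup>2\<close> plus the mean square of a combination of past values.

  \<^item> A filter with a nonzero coefficient is a multiple of one innovation plus an independent
    remainder. By Fubini it has no atom at 0 if the innovations have no atoms.

  \<^item> The empirical covariance is a quadratic form in the innovations. Fixing the lags of the two
    filters, it becomes a sum of \<open>b s * (\<xi> s * \<xi> (s - m) - E)\<close> over \<open>s\<close>. Colouring the integers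
    alternately in blocks of length \<open>\<bar>m\<bar>\<close> splits this into two sums of independent centred
    variables, whose moment of order \<open>2 * k\<close> is at most a constant times \<open>(\<Sum>s. (b s)\<^sup>2) ^ k\<close>
    (\<open>independent_sum_moment\<close>). Minkowski's inequality adds up the lags geometrically, and the
    squared weights of the taper sum to \<open>O(1 / n)\<close> (\<open>taper_pair_weights\<close>).
\<close>

section \<open>Impulse responses of slowly varying recursions\<close>

text \<open>
  \<open>b n j\<close> is the coefficient of lag \<open>j\<close> at time \<open>n\<close>, counted from the time of a unit impulse.
  Constant coefficients are the special case \<open>green (\<lambda>_. \<theta>)\<close>.
\<close>

fun green :: "(nat \<Rightarrow> nat \<Rightarrow> real) \<Rightarrow> nat \<Rightarrow> real" where
  "green b n = (if n = 0 then 1 else (\<Sum>i<n. b n (n - i) * green b i))"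

declare green.simps [simp del]

lemma green_0 [simp]: "green b 0 = 1"
  by (simp add: green.simps)

lemma green_pos: "0 < n \<Longrightarrow> green b n = (\<Sum>i<n. b n (n - i) * green b i)"
  by (subst green.simps) simp

lemma sum_triangle_swap:
  fixes g :: "nat \<Rightarrow> nat \<Rightarrow> real"
  shows "(\<Sum>i<m. \<Sum>k\<le>i. g i k) = (\<Sum>k<m. \<Sum>i\<in>{k..<m}. g i k)"
  by (subst sum.Sigma, simp, simp, subst sum.Sigma, simp, simp)
     (rule sum.reindex_bij_witness[where i = "\<lambda>(a,b). (b,a)" and j = "\<lambda>(a,b). (b,a)"], auto)

text \<open>
  The forcing \<open>e i\<close> starts an impulse response of its own at time \<open>i\<close>. Both uses below rest on
  this: with the time varying coefficients it iterates the recursion of the process, and with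
  frozen ones it compares the two impulse responses.
\<close>

lemma variation_of_constants:
  assumes rec: "\<And>n. n \<le> m \<Longrightarrow> x n = (\<Sum>i<n. b n (n - i) * x i) + e n"
  shows "x m = (\<Sum>i\<le>m. green (\<lambda>k. b (i + k)) (m - i) * e i)"
  using rec
proof (induction m rule: less_induct)
  case (less m)
  have ih: "x i = (\<Sum>k\<le>i. green (\<lambda>j. b (k + j)) (i - k) * e k)" if "i < m" for i
    using less.IH[OF that] less.prems that by simp
  have step: "(\<Sum>i\<in>{k..<m}. b m (m - i) * green (\<lambda>j. b (k + j)) (i - k))
      = green (\<lambda>j. b (k + j)) (m - k)" if "k < m" for k
  proof -
    have "green (\<lambda>j. b (k + j)) (m - k)
        = (\<Sum>i<m - k. b m (m - k - i) * green (\<lambda>j. b (k + j)) i)"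
      using that by (subst green_pos) simp_all
    also have "\<dots> = (\<Sum>i\<in>{k..<m}. b m (m - i) * green (\<lambda>j. b (k + j)) (i - k))"
      using that
      by (intro sum.reindex_bij_witness[where i = "\<lambda>i. i - k" and j = "\<lambda>i. i + k"]) (auto simp: add.commute)
    finally show ?thesis by simp
  qed
  have "x m = (\<Sum>i<m. b m (m - i) * x i) + e m"
    using less.prems by simp
  also have "(\<Sum>i<m. b m (m - i) * x i)
      = (\<Sum>i<m. \<Sum>k\<le>i. b m (m - i) * green (\<lambda>j. b (k + j)) (i - k) * e k)"
    using ih by (simp add: sum_distrib_left mult.assoc)
  also have "\<dots> = (\<Sum>k<m. \<Sum>i\<in>{k..<m}. b m (m - i) * green (\<lambda>j. b (k + j)) (i - k) * e k)"
    by (rule sum_triangle_swap)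
  also have "\<dots> = (\<Sum>k<m. green (\<lambda>j. b (k + j)) (m - k) * e k)"
    by (intro sum.cong refl) (simp add: step sum_distrib_right [symmetric])
  finally show ?case
    by (simp add: lessThan_Suc_atMost [symmetric])
qed

text \<open>
  The time varying response solves the frozen recursion with the coefficient increments as
  additional forcing.
\<close>

lemma green_perturbation:
  "green b m - green (\<lambda>_. \<theta>) m
     = (\<Sum>n\<le>m. green (\<lambda>_. \<theta>) (m - n) * (\<Sum>i<n. (b n (n - i) - \<theta> (n - i)) * green b i))"
proof -
  define e where "e n = (\<Sum>i<n. (b n (n - i) - \<theta> (n - i)) * green b i)" for n
  have rec: "green b n = (\<Sum>i<n. \<theta> (n - i) * green b i) + ((if n = 0 then 1 else 0) + e n)" for n
    by (cases "n = 0") (simp_all add: e_def green_pos[of n] algebra_simps sum_subtractf)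
  have "green b m = (\<Sum>i\<le>m. green (\<lambda>_. \<theta>) (m - i) * ((if i = 0 then 1 else 0) + e i))"
    using variation_of_constants[of m "green b" "\<lambda>_. \<theta>"
        "\<lambda>n. (if n = 0 then 1 else 0) + e n"] rec by blast
  also have "\<dots> = green (\<lambda>_. \<theta>) m + (\<Sum>i\<le>m. green (\<lambda>_. \<theta>) (m - i) * e i)"
    by (simp add: distrib_left sum.distrib if_distrib[of "(*) _"] cong: if_cong)
  finally show ?thesis by (simp add: e_def)
qed

lemma weighted_geometric_bound:
  fixes r :: real assumes "0 \<le> r" "r < 1"
  shows "(\<Sum>k\<le>m. (1 + real k) * r ^ k) \<le> 1 / (1 - r)\<^sup>2"
proof -
  have "(\<lambda>n. of_nat (Suc n) * r ^ n) sums (1 / (1 - r)\<^sup>2)"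
    by (rule geometric_deriv_sums) (use assms in simp)
  then show ?thesis
    using sum_le_suminf[of "\<lambda>n. of_nat (Suc n) * r ^ n" "{..m}"] assms
    by (simp add: sums_iff)
qed

text \<open>
  The factor \<open>real (m - n)\<close> by which the coefficients may drift is absorbed by the decay of the
  frozen response, at the price of passing from \<open>r0\<close> to a larger rate \<open>r\<close>. Bounds on
  \<open>green b\<close> before time \<open>m\<close> give one at time \<open>m\<close>, so that the lemma serves as an induction step.
  The shift \<open>D\<close> serves to freeze the coefficients at a time other than the final one.
\<close>

lemma perturbation_bound:
  fixes b :: "nat \<Rightarrow> nat \<Rightarrow> real" and \<theta> :: "nat \<Rightarrow> real"
  assumes r: "0 < r0" "r0 < r" "r < 1" and K: "0 \<le> K" "0 \<le> K'" and D: "0 \<le> D" "0 \<le> \<epsilon>"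
    and psi: "\<And>n. \<bar>green (\<lambda>_. \<theta>) n\<bar> \<le> K * r0 ^ n"
    and y: "\<And>i. i < m \<Longrightarrow> \<bar>green b i\<bar> \<le> K' * r ^ i"
    and close: "\<And>n j. n \<le> m \<Longrightarrow> \<bar>b n j - \<theta> j\<bar> \<le> \<epsilon> * (D + real (m - n))"
    and cut: "\<And>n j. j > p \<Longrightarrow> b n j = 0" "\<And>j. j > p \<Longrightarrow> \<theta> j = 0"
  shows "\<bar>green b m - green (\<lambda>_. \<theta>) m\<bar>
           \<le> K * K' * real p * (1 / r) ^ p / (1 - r0 / r)\<^sup>2 * \<epsilon> * (1 + D) * r ^ m"
proof -
  let ?C = "K' * real p * (1 / r) ^ p * r ^ m"
  have inner: "\<bar>\<Sum>i<n. (b n (n - i) - \<theta> (n - i)) * green b i\<bar>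
      \<le> \<epsilon> * (1 + D) * (1 + real (m - n)) * (K' * real p * (1 / r) ^ p * r ^ n)" if n: "n \<le> m" for n
  proof -
    let ?E = "\<epsilon> * (1 + D) * (1 + real (m - n)) * (K' * (1 / r) ^ p * r ^ n)"
    have E0: "0 \<le> ?E" using r K D by simp
    have bnd: "\<bar>(b n (n - i) - \<theta> (n - i)) * green b i\<bar> \<le> (if n - i \<le> p then ?E else 0)"
      if i: "i < n" for i
    proof (cases "n - i \<le> p")
      case True
      have 1: "\<bar>b n (n - i) - \<theta> (n - i)\<bar> \<le> \<epsilon> * (1 + D) * (1 + real (m - n))"
      proof -
        have "\<epsilon> * (D + real (m - n)) \<le> \<epsilon> * ((1 + D) * (1 + real (m - n)))"
          using D by (intro mult_left_mono) (auto simp: algebra_simps)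
        then show ?thesis using close[OF n, of "n - i"] by (simp add: mult.assoc)
      qed
      \<comment> \<open>Only lags up to \<open>p\<close> contribute, each at the cost of a factor of at most \<open>(1 / r) ^ p\<close>.\<close>
      have "r ^ i = (1 / r) ^ (n - i) * r ^ n"
        using r i by (simp add: power_divide power_diff field_simps)
      also have "\<dots> \<le> (1 / r) ^ p * r ^ n"
        using r True by (intro mult_right_mono power_increasing) auto
      finally have 2: "\<bar>green b i\<bar> \<le> K' * (1 / r) ^ p * r ^ n"
        using y[of i] i n K by (smt (verit) mult.assoc mult_left_mono order.strict_trans2)
      show ?thesis
        using True mult_mono[OF 1 2] D by (simp add: abs_mult)
    next
      case False then show ?thesis using cut by simp
    qed
    have "\<bar>\<Sum>i<n. (b n (n - i) - \<theta> (n - i)) * green b i\<bar> \<le> (\<Sum>i<n. if n - i \<le> p then ?E else 0)"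
      using bnd by (intro order_trans[OF sum_abs] sum_mono) auto
    also have "\<dots> = real (card {i. i < n \<and> n - i \<le> p}) * ?E"
      by (subst sum.inter_filter[symmetric]) simp_all
    also have "\<dots> \<le> real p * ?E"
    proof (intro mult_right_mono E0)
      have "card {i. i < n \<and> n - i \<le> p} \<le> card {n - p..<n}"
        by (intro card_mono) auto
      then show "real (card {i. i < n \<and> n - i \<le> p}) \<le> real p" by simp
    qed
    finally show ?thesis by (simp add: algebra_simps)
  qed
  have "\<bar>green b m - green (\<lambda>_. \<theta>) m\<bar>
      \<le> (\<Sum>n\<le>m. K * r0 ^ (m - n) * (\<epsilon> * (1 + D) * (1 + real (m - n)) * (K' * real p * (1 / r) ^ p * r ^ n)))"
    unfolding green_perturbation
  proof (intro order_trans[OF sum_abs] sum_mono)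
    fix n assume "n \<in> {..m}"
    then show "\<bar>green (\<lambda>_. \<theta>) (m - n) * (\<Sum>i<n. (b n (n - i) - \<theta> (n - i)) * green b i)\<bar>
        \<le> K * r0 ^ (m - n) * (\<epsilon> * (1 + D) * (1 + real (m - n)) * (K' * real p * (1 / r) ^ p * r ^ n))"
      unfolding abs_mult using r K by (intro mult_mono psi inner) auto
  qed
  also have "\<dots> = (\<Sum>n\<le>m. K * \<epsilon> * (1 + D) * ?C * ((1 + real (m - n)) * (r0 / r) ^ (m - n)))"
  proof (intro sum.cong refl)
    fix n assume "n \<in> {..m}"
    then have "r0 ^ (m - n) * r ^ n = r ^ m * (r0 / r) ^ (m - n)"
      using r by (simp add: power_divide power_diff field_simps)
    then show "K * r0 ^ (m - n) * (\<epsilon> * (1 + D) * (1 + real (m - n)) * (K' * real p * (1 / r) ^ p * r ^ n))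
        = K * \<epsilon> * (1 + D) * ?C * ((1 + real (m - n)) * (r0 / r) ^ (m - n))"
      by (simp add: mult_ac)
  qed
  also have "\<dots> = K * \<epsilon> * (1 + D) * ?C * (\<Sum>n\<le>m. (1 + real (m - n)) * (r0 / r) ^ (m - n))"
    by (simp add: sum_distrib_left)
  also have "(\<Sum>n\<le>m. (1 + real (m - n)) * (r0 / r) ^ (m - n)) = (\<Sum>k\<le>m. (1 + real k) * (r0 / r) ^ k)"
    by (rule sum.reindex_bij_witness[where i = "\<lambda>k. m - k" and j = "\<lambda>k. m - k"]) auto
  also have "K * \<epsilon> * (1 + D) * ?C * \<dots> \<le> K * \<epsilon> * (1 + D) * ?C * (1 / (1 - r0 / r)\<^sup>2)"
    using r K D by (intro mult_left_mono weighted_geometric_bound) auto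
  finally show ?thesis by (simp add: mult_ac)
qed

text \<open>
  Freezing at the final time \<open>m\<close> in the strong induction: the frozen response contributes
  \<open>K * r ^ m\<close>, and by \<open>small\<close> so does the perturbation.
\<close>

lemma green_decay:
  fixes b :: "nat \<Rightarrow> nat \<Rightarrow> real"
  assumes r: "0 < r0" "r0 < r" "r < 1" and K: "0 \<le> K" and \<epsilon>: "0 \<le> \<epsilon>"
    and psi: "\<And>m n. \<bar>green (\<lambda>_. b m) n\<bar> \<le> K * r0 ^ n"
    and slow: "\<And>m n j. n \<le> m \<Longrightarrow> \<bar>b n j - b m j\<bar> \<le> \<epsilon> * real (m - n)"
    and cut: "\<And>n j. j > p \<Longrightarrow> b n j = 0"
    and small: "2 * K * real p * (1 / r) ^ p / (1 - r0 / r)\<^sup>2 * \<epsilon> \<le> 1"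
  shows "\<bar>green b m\<bar> \<le> 2 * K * r ^ m"
proof (induction m rule: less_induct)
  case (less m)
  have "\<bar>green b m - green (\<lambda>_. b m) m\<bar>
      \<le> K * (2 * K) * real p * (1 / r) ^ p / (1 - r0 / r)\<^sup>2 * \<epsilon> * (1 + 0) * r ^ m"
    by (rule perturbation_bound) (use r K \<epsilon> psi less.IH slow cut in auto)
  also have "\<dots> = K * r ^ m * (2 * K * real p * (1 / r) ^ p / (1 - r0 / r)\<^sup>2 * \<epsilon>)"
    by (simp add: mult_ac)
  also have "\<dots> \<le> K * r ^ m * 1"
    using r K small by (intro mult_left_mono) auto
  finally have 1: "\<bar>green b m - green (\<lambda>_. b m) m\<bar> \<le> K * r ^ m" by simp
  have "K * r0 ^ m \<le> K * r ^ m"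
    using r K by (intro mult_left_mono power_mono) auto
  then show ?case using 1 psi[of m m] by linarith
qed

section \<open>The autoregressive polynomial\<close>

text \<open>
  Dropping the irrelevant components of a coefficient vector lets recursions run over all
  earlier times.
\<close>

definition lag_cut :: "nat \<Rightarrow> (nat \<Rightarrow> real) \<Rightarrow> nat \<Rightarrow> real" where
  "lag_cut p \<theta> j = (if 1 \<le> j \<and> j \<le> p then \<theta> j else 0)"

definition lag_poly :: "nat \<Rightarrow> (nat \<Rightarrow> real) \<Rightarrow> complex poly" where
  "lag_poly p \<theta> = 1 - (\<Sum>j=1..p. monom (complex_of_real (\<theta> j)) j)"

lemma poly_lag_poly: "poly (lag_poly p \<theta>) z = 1 - (\<Sum>j=1..p. complex_of_real (\<theta> j) * z ^ j)"
  by (simp add: lag_poly_def poly_sum poly_monom)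

lemma coeff_lag_poly:
  "coeff (lag_poly p \<theta>) n = (if n = 0 then 1 else - complex_of_real (lag_cut p \<theta> n))"
proof -
  have "coeff (\<Sum>j=1..p. monom (complex_of_real (\<theta> j)) j) n
      = (\<Sum>j=1..p. if j = n then complex_of_real (\<theta> j) else 0)"
    by (simp add: coeff_sum)
  also have "\<dots> = complex_of_real (lag_cut p \<theta> n)"
    by (auto simp: lag_cut_def)
  finally show ?thesis
    by (auto simp: lag_poly_def lag_cut_def)
qed

text \<open>
  Passes from the roots of a polynomial to the reciprocal roots.
\<close>

lemma prod_linear_factors:
  fixes A :: "complex multiset"
  assumes "0 \<notin># A"
  shows "(\<Prod>x\<in>#A. [:- x, 1:]) = Polynomial.smult (\<Prod>x\<in>#A. - x) (\<Prod>x\<in>#image_mset inverse A. [:1, - x:])"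
  using assms
proof (induction A)
  case (add x A)
  then have "[:- x, 1:] = Polynomial.smult (- x) [:1, - inverse x:]" "x \<noteq> 0"
    by (auto simp: field_simps)
  note x = this
  have "(\<Prod>x\<in>#add_mset x A. [:- x, 1:]) = [:- x, 1:] * (\<Prod>x\<in>#A. [:- x, 1:])"
    by simp
  also have "\<dots> = Polynomial.smult (- x) [:1, - inverse x:]
      * Polynomial.smult (\<Prod>x\<in>#A. - x) (\<Prod>x\<in>#image_mset inverse A. [:1, - x:])"
    using add x(1) by simp
  finally show ?case
    by (simp only: mult_smult_left mult_smult_right smult_smult image_mset_add_mset
        prod_mset.add_mset mult_ac)
qed simp

lemma mult_exchange: "(a * b) * (c * d) = (a * c) * (b * (d :: 'a :: comm_semiring_1))"
  by (simp add: mult_ac)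

lemma stable_lag_poly:
  assumes "\<theta> \<in> stable_set p \<delta>" "cmod z < 1 / \<delta>"
  shows "poly (lag_poly p (\<theta> u)) z \<noteq> 0"
  using assms by (simp add: stable_set_def ar_poly_def poly_lag_poly)

text \<open>
  The reciprocal roots are bounded by \<open>\<delta>\<close>, and their number by \<open>p\<close>. These two numbers are all
  that later constants see of \<open>\<theta>\<close>.
\<close>

lemma lag_poly_factors:
  assumes "0 < \<delta>" and stable: "\<And>z. cmod z < 1 / \<delta> \<Longrightarrow> poly (lag_poly p \<theta>) z \<noteq> 0"
  obtains A where "size A \<le> p" "\<And>r. r \<in># A \<Longrightarrow> cmod r \<le> \<delta>"
    "lag_poly p \<theta> = (\<Prod>r\<in>#A. [:1, - r:])"
proof -
  let ?q = "lag_poly p \<theta>"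
  have q0: "coeff ?q 0 = 1" by (simp add: coeff_lag_poly)
  then have "?q \<noteq> 0" by auto
  then obtain A where A: "size A = degree ?q" "?q = Polynomial.smult (lead_coeff ?q) (\<Prod>x\<in>#A. [:-x, 1:])"
    using alg_closed_imp_factorization[of ?q] by auto
  have large: "1 / \<delta> \<le> cmod x" if x: "x \<in># A" for x
  proof -
    obtain B where "A = add_mset x B" using multi_member_split[OF x] by blast
    then have "poly ?q x = 0" by (subst A(2)) simp
    then show ?thesis using stable[of x] by force
  qed
  then have nz: "0 \<notin># A" using assms(1) by (force simp: not_le)
  define c where "c = lead_coeff ?q * (\<Prod>x\<in>#A. - x)"
  let ?B = "image_mset inverse A"
  have qB: "?q = Polynomial.smult c (\<Prod>r\<in>#?B. [:1, - r:])"
    by (subst A(2), subst prod_linear_factors[OF nz]) (simp add: c_def)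
  have "poly (\<Prod>r\<in>#C. [:1, - r:]) 0 = (1::complex)" for C
    by (induction C) auto
  then have "c = 1" using q0 arg_cong[OF qB, of "\<lambda>q. poly q 0"] by (simp add: poly_0_coeff_0)
  have deg: "degree ?q \<le> p"
    by (rule degree_le) (auto simp: coeff_lag_poly lag_cut_def)
  show ?thesis
  proof (rule that[of ?B])
    show "size ?B \<le> p" using A(1) deg by simp
    show "?q = (\<Prod>r\<in>#?B. [:1, - r:])" using qB \<open>c = 1\<close> by simp
    fix r assume "r \<in># ?B"
    then obtain x where x: "x \<in># A" "r = inverse x" by auto
    have "cmod r \<le> inverse (1 / \<delta>)"
      unfolding x(2) norm_inverse using large[OF x(1)] assms(1) by (intro le_imp_inverse_le) auto
    then show "cmod r \<le> \<delta>" using assms(1) by simp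
  qed
qed

lemma prod_linear_norm_bounds:
  fixes z :: complex
  assumes "\<And>r. r \<in># A \<Longrightarrow> cmod r \<le> \<delta>" "cmod z = 1" "0 \<le> \<delta>" "\<delta> \<le> 1"
  shows "(1 - \<delta>) ^ size A \<le> cmod (poly (\<Prod>r\<in>#A. [:1, - r:]) z)"
    and "cmod (poly (\<Prod>r\<in>#A. [:1, - r:]) z) \<le> (1 + \<delta>) ^ size A"
proof -
  have "(1 - \<delta>) ^ size A \<le> cmod (poly (\<Prod>r\<in>#A. [:1, - r:]) z)
      \<and> cmod (poly (\<Prod>r\<in>#A. [:1, - r:]) z) \<le> (1 + \<delta>) ^ size A"
    using assms(1)
  proof (induction A)
    case (add r A)
    have r: "cmod (z * r) \<le> \<delta>" using add.prems assms(2) by (simp add: norm_mult)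
    then have "1 - \<delta> \<le> cmod (1 - z * r)" "cmod (1 - z * r) \<le> 1 + \<delta>"
      using norm_triangle_ineq2[of 1 "z * r"] norm_triangle_ineq4[of 1 "z * r"] by simp_all
    moreover have "(1 - \<delta>) ^ size A \<le> cmod (poly (\<Prod>r\<in>#A. [:1, - r:]) z)"
        "cmod (poly (\<Prod>r\<in>#A. [:1, - r:]) z) \<le> (1 + \<delta>) ^ size A"
      using add by auto
    moreover have "cmod (poly (\<Prod>r\<in>#add_mset r A. [:1, - r:]) z)
        = cmod (1 - z * r) * cmod (poly (\<Prod>r\<in>#A. [:1, - r:]) z)"
      by (simp only: image_mset_add_mset prod_mset.add_mset poly_mult norm_mult) simp
    ultimately show ?case
      using assms(3,4) by (auto intro!: mult_mono)
  qed simp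
  then show "(1 - \<delta>) ^ size A \<le> cmod (poly (\<Prod>r\<in>#A. [:1, - r:]) z)"
    and "cmod (poly (\<Prod>r\<in>#A. [:1, - r:]) z) \<le> (1 + \<delta>) ^ size A" by auto
qed

lemma ar_poly_bounds:
  assumes "0 < \<delta>" "\<delta> < 1" and \<theta>: "\<theta> \<in> stable_set p \<delta>" and "cmod z = 1"
  shows "(1 - \<delta>) ^ p \<le> cmod (ar_poly p \<theta> z u)" and "cmod (ar_poly p \<theta> z u) \<le> (1 + \<delta>) ^ p"
proof -
  have ar: "ar_poly p \<theta> z u = poly (lag_poly p (\<theta> u)) z" for z
    by (simp add: ar_poly_def poly_lag_poly)
  obtain A where A: "size A \<le> p" "\<And>r. r \<in># A \<Longrightarrow> cmod r \<le> \<delta>"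
    "lag_poly p (\<theta> u) = (\<Prod>r\<in>#A. [:1, - r:])"
    using lag_poly_factors[OF assms(1) stable_lag_poly[OF \<theta>]] by blast
  have "(1 - \<delta>) ^ p \<le> (1 - \<delta>) ^ size A" "(1 + \<delta>) ^ size A \<le> (1 + \<delta>) ^ p"
    using A(1) assms(1,2) by (auto intro: power_decreasing power_increasing)
  then show "(1 - \<delta>) ^ p \<le> cmod (ar_poly p \<theta> z u)" "cmod (ar_poly p \<theta> z u) \<le> (1 + \<delta>) ^ p"
    using prod_linear_norm_bounds[of A \<delta> z, OF A(2) assms(4)] assms(1,2) unfolding ar A(3) by linarith+
qed

text \<open>
  Dividing by one more factor \<open>1 - x z\<close> convolves the coefficients with \<open>x ^ n\<close>. Since
  \<open>\<bar>x\<bar> \<le> \<delta> < r\<close>, the convolution with \<open>r ^ n\<close> costs only a constant factor.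
\<close>

lemma inverse_prod_linear_decay:
  fixes \<delta> r :: real
  assumes A: "\<And>x. x \<in># A \<Longrightarrow> cmod x \<le> \<delta>" and r: "0 < \<delta>" "\<delta> < r"
  shows "\<exists>G. fps_of_poly (\<Prod>x\<in>#A. [:1, - x:]) * G = 1
      \<and> (\<forall>n. cmod (fps_nth G n) \<le> (1 / (1 - \<delta> / r)) ^ size A * r ^ n)"
  using A
proof (induction A)
  case empty
  then show ?case using r by (intro exI[of _ 1]) auto
next
  case (add x A)
  then obtain G where G: "fps_of_poly (\<Prod>x\<in>#A. [:1, - x:]) * G = 1"
    "\<And>n. cmod (fps_nth G n) \<le> (1 / (1 - \<delta> / r)) ^ size A * r ^ n" by auto
  define P where "P = Abs_fps (\<lambda>n. x ^ n)"
  have P: "fps_of_poly [:1, - x:] * P = 1"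
  proof (rule fps_ext)
    fix n
    show "fps_nth (fps_of_poly [:1, - x:] * P) n = fps_nth 1 n"
      by (cases n) (simp_all add: fps_of_poly_pCons P_def algebra_simps)
  qed
  have x: "cmod x \<le> \<delta>" using add.prems by simp
  show ?case
  proof (intro exI[of _ "P * G"] conjI allI)
    show "fps_of_poly (\<Prod>x\<in>#add_mset x A. [:1, - x:]) * (P * G) = 1"
    proof -
      have "fps_of_poly (\<Prod>x\<in>#add_mset x A. [:1, - x:])
          = fps_of_poly [:1, - x:] * fps_of_poly (\<Prod>x\<in>#A. [:1, - x:])"
        by (simp only: image_mset_add_mset prod_mset.add_mset fps_of_poly_mult)
      then have "fps_of_poly (\<Prod>x\<in>#add_mset x A. [:1, - x:]) * (P * G)
          = (fps_of_poly [:1, - x:] * P) * (fps_of_poly (\<Prod>x\<in>#A. [:1, - x:]) * G)"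
        by (simp only: mult_exchange)
      then show ?thesis by (simp only: P G(1) mult_1)
    qed
    fix n
    let ?c = "(1 / (1 - \<delta> / r)) ^ size A"
    have c0: "0 \<le> ?c" using r by simp
    have "cmod (fps_nth (P * G) n) \<le> (\<Sum>i=0..n. \<delta> ^ i * (?c * r ^ (n - i)))"
      unfolding fps_mult_nth P_def
      by (intro order_trans[OF norm_sum] sum_mono)
         (use r in \<open>auto simp: norm_mult norm_power intro!: mult_mono power_mono x G(2)\<close>)
    also have "\<dots> = (\<Sum>i=0..n. ?c * r ^ n * (\<delta> / r) ^ i)"
      using r by (intro sum.cong refl) (simp add: power_divide power_diff field_simps)
    also have "\<dots> = ?c * r ^ n * (\<Sum>i\<le>n. (\<delta> / r) ^ i)"
      by (simp add: sum_distrib_left atMost_atLeast0)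
    also have "\<dots> \<le> ?c * r ^ n * (1 / (1 - \<delta> / r))"
      using r sum_le_suminf[of "\<lambda>n. (\<delta> / r) ^ n" "{..n}"] c0
      by (intro mult_left_mono) (simp_all add: suminf_geometric summable_geometric)
    finally show "cmod (fps_nth (P * G) n) \<le> (1 / (1 - \<delta> / r)) ^ size (add_mset x A) * r ^ n"
      by (simp only: size_add_mset power_Suc mult_ac)
  qed
qed

text \<open>
  The recursion of the frozen response is the coefficientwise form of this identity.
\<close>

lemma green_generating_function:
  "fps_of_poly (lag_poly p \<theta>) * Abs_fps (\<lambda>n. complex_of_real (green (\<lambda>_. lag_cut p \<theta>) n)) = 1"
proof (rule fps_ext)
  fix n
  let ?g = "green (\<lambda>_. lag_cut p \<theta>)"
  show "fps_nth (fps_of_poly (lag_poly p \<theta>) * Abs_fps (\<lambda>n. complex_of_real (?g n))) n = fps_nth 1 n"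
  proof (cases n)
    case 0
    then show ?thesis by (simp add: fps_mult_nth coeff_lag_poly)
  next
    case (Suc m)
    have "(\<Sum>i=1..n. complex_of_real (lag_cut p \<theta> i * ?g (n - i)))
        = (\<Sum>i<n. complex_of_real (lag_cut p \<theta> (n - i) * ?g i))"
      by (rule sum.reindex_bij_witness[where i = "\<lambda>i. n - i" and j = "\<lambda>i. n - i"]) auto
    also have "\<dots> = complex_of_real (?g n)"
      using Suc green_pos[of n "\<lambda>_. lag_cut p \<theta>"] by simp
    finally have 1: "(\<Sum>i=1..n. complex_of_real (lag_cut p \<theta> i * ?g (n - i))) = complex_of_real (?g n)" .
    have "fps_nth (fps_of_poly (lag_poly p \<theta>) * Abs_fps (\<lambda>n. complex_of_real (?g n))) n
        = (\<Sum>i=0..n. coeff (lag_poly p \<theta>) i * complex_of_real (?g (n - i)))"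
      by (simp only: fps_mult_nth fps_of_poly_nth fps_nth_Abs_fps)
    also have "\<dots> = complex_of_real (?g n) + (\<Sum>i=1..n. coeff (lag_poly p \<theta>) i * complex_of_real (?g (n - i)))"
      by (subst sum.atLeast_Suc_atMost) (simp_all add: coeff_lag_poly)
    also have "(\<Sum>i=1..n. coeff (lag_poly p \<theta>) i * complex_of_real (?g (n - i)))
        = (\<Sum>i=1..n. - complex_of_real (lag_cut p \<theta> i * ?g (n - i)))"
      by (intro sum.cong refl) (simp add: coeff_lag_poly)
    finally have "fps_nth (fps_of_poly (lag_poly p \<theta>) * Abs_fps (\<lambda>n. complex_of_real (?g n))) n
        = complex_of_real (?g n) - (\<Sum>i=1..n. complex_of_real (lag_cut p \<theta> i * ?g (n - i)))"
      by (simp only: sum_negf) simp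
    then show ?thesis using 1 Suc by simp
  qed
qed

text \<open>
  Inverses of power series are unique, so the frozen response is the series of
  \<open>inverse_prod_linear_decay\<close>.
\<close>

lemma green_stable_decay:
  assumes "0 < \<delta>" "\<delta> < r" and \<theta>: "\<theta> \<in> stable_set p \<delta>"
  shows "\<bar>green (\<lambda>_. lag_cut p (\<theta> u)) n\<bar> \<le> (1 / (1 - \<delta> / r)) ^ p * r ^ n"
proof -
  obtain A where A: "size A \<le> p" "\<And>r. r \<in># A \<Longrightarrow> cmod r \<le> \<delta>"
    "lag_poly p (\<theta> u) = (\<Prod>r\<in>#A. [:1, - r:])"
    using lag_poly_factors[OF assms(1) stable_lag_poly[OF \<theta>]] by blast
  obtain G where G: "fps_of_poly (lag_poly p (\<theta> u)) * G = 1"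
    "\<And>n. cmod (fps_nth G n) \<le> (1 / (1 - \<delta> / r)) ^ size A * r ^ n"
    using inverse_prod_linear_decay[of A \<delta> r, OF A(2) assms(1,2), folded A(3)] by auto
  have "Abs_fps (\<lambda>n. complex_of_real (green (\<lambda>_. lag_cut p (\<theta> u)) n)) = G" (is "?F = G")
  proof -
    have "?F = ?F * (fps_of_poly (lag_poly p (\<theta> u)) * G)" by (simp only: G(1) mult_1_right)
    also have "\<dots> = (fps_of_poly (lag_poly p (\<theta> u)) * ?F) * G" by (simp only: mult_ac)
    finally show ?thesis by (simp only: green_generating_function mult_1)
  qed
  then have "fps_nth G n = complex_of_real (green (\<lambda>_. lag_cut p (\<theta> u)) n)" by auto
  then have "cmod (complex_of_real (green (\<lambda>_. lag_cut p (\<theta> u)) n)) \<le> (1 / (1 - \<delta> / r)) ^ size A * r ^ n"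
    using G(2)[of n] by simp
  also have "\<dots> \<le> (1 / (1 - \<delta> / r)) ^ p * r ^ n"
    using A(1) assms by (intro mult_right_mono power_increasing) (auto simp: field_simps)
  finally show ?thesis by simp
qed

text \<open>
  The power series identity holds for the sums on the unit circle because the decay makes the
  series absolutely convergent there.
\<close>

lemma frozen_green_sums:
  assumes \<theta>: "\<theta> \<in> stable_set p \<delta>" "0 < \<delta>" "\<delta> < 1" and z: "cmod z = 1"
  shows "(\<lambda>n. complex_of_real (green (\<lambda>_. lag_cut p (\<theta> u)) n) * z ^ n) sums (1 / ar_poly p \<theta> z u)"
proof -
  let ?g = "\<lambda>n. complex_of_real (green (\<lambda>_. lag_cut p (\<theta> u)) n)"
  define r where "r = (1 + \<delta>) / 2"
  have r: "\<delta> < r" "r < 1" "0 < r" using assms by (auto simp: r_def)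
  have sg: "summable (\<lambda>n. norm (?g n * z ^ n))"
  proof (rule summable_comparison_test')
    show "summable (\<lambda>n. (1 / (1 - \<delta> / r)) ^ p * r ^ n)" using r by (intro summable_mult summable_geometric) auto
    show "norm (norm (?g n * z ^ n)) \<le> (1 / (1 - \<delta> / r)) ^ p * r ^ n" for n
      using green_stable_decay[OF assms(2) r(1) \<theta>(1), of u n] z by (simp add: norm_mult norm_power)
  qed
  let ?q = "lag_poly p (\<theta> u)"
  have fin: "coeff ?q n * z ^ n = 0" if "n \<notin> {..p}" for n
    using that by (auto simp: coeff_lag_poly lag_cut_def)
  have sq: "summable (\<lambda>n. norm (coeff ?q n * z ^ n))"
    by (rule summable_finite[of "{..p}"]) (use fin in auto)
  have "poly ?q z = (\<Sum>n\<le>p. coeff ?q n * z ^ n)"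
  proof -
    have "degree ?q \<le> p" by (rule degree_le) (auto simp: coeff_lag_poly lag_cut_def)
    then show ?thesis unfolding poly_altdef
      by (intro sum.mono_neutral_left) (auto simp: coeff_eq_0)
  qed
  also have "\<dots> = (\<Sum>n. coeff ?q n * z ^ n)" by (rule suminf_finite[symmetric]) (use fin in auto)
  finally have q: "(\<Sum>n. coeff ?q n * z ^ n) = ar_poly p \<theta> z u"
    by (simp add: ar_poly_def poly_lag_poly)
  have "(\<lambda>k. \<Sum>i\<le>k. (coeff ?q i * z ^ i) * (?g (k - i) * z ^ (k - i))) sums (ar_poly p \<theta> z u * (\<Sum>n. ?g n * z ^ n))"
    using Cauchy_product_sums[OF sq sg] by (simp add: q)
  moreover have "(\<Sum>i\<le>k. (coeff ?q i * z ^ i) * (?g (k - i) * z ^ (k - i))) = (if k = 0 then 1 else 0)" for k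
  proof -
    have "(\<Sum>i\<le>k. (coeff ?q i * z ^ i) * (?g (k - i) * z ^ (k - i))) = (\<Sum>i=0..k. coeff ?q i * ?g (k - i)) * z ^ k"
      unfolding sum_distrib_right atMost_atLeast0
      by (intro sum.cong refl) (auto simp: power_add[symmetric] mult_ac)
    also have "(\<Sum>i=0..k. coeff ?q i * ?g (k - i)) = (if k = 0 then 1 else 0)"
      using arg_cong[OF green_generating_function[of p "\<theta> u"], of "\<lambda>F. fps_nth F k"]
      by (simp add: fps_mult_nth)
    finally show ?thesis by simp
  qed
  ultimately have "(\<lambda>k. if k = 0 then 1 else 0) sums (ar_poly p \<theta> z u * (\<Sum>n. ?g n * z ^ n))"
    by simp
  moreover have "(\<lambda>k. if k = 0 then 1 else (0::complex)) sums 1"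
    using sums_single[of 0 "\<lambda>_. 1::complex"] by simp
  ultimately have "ar_poly p \<theta> z u * (\<Sum>n. ?g n * z ^ n) = 1" using sums_unique2 by blast
  then have "(\<Sum>n. ?g n * z ^ n) = 1 / ar_poly p \<theta> z u"
    by (metis mult_zero_left nonzero_eq_divide_eq mult.commute zero_neq_one)
  then show ?thesis using summable_norm_cancel[OF sg] by (simp add: sums_iff)
qed

section \<open>Hoelder classes\<close>

text \<open>
  A recursive form of the Hoelder ball of order \<open>k + \<alpha>\<close>, suited to induction on \<open>k\<close>. It bounds
  the function and each derivative by the same constant, and so differs from \<open>holder_ball\<close> by a
  factor of at most 2.
\<close>

fun holder_class :: "nat \<Rightarrow> real \<Rightarrow> real \<Rightarrow> (real \<Rightarrow> real) \<Rightarrow> bool" where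
  "holder_class 0 \<alpha> R f \<longleftrightarrow> (\<forall>x. \<bar>f x\<bar> \<le> R)
     \<and> (\<forall>s s'. \<bar>s - s'\<bar> < 1 \<longrightarrow> \<bar>f s - f s'\<bar> \<le> R * \<bar>s - s'\<bar> powr \<alpha>)"
| "holder_class (Suc k) \<alpha> R f \<longleftrightarrow> (\<forall>x. \<bar>f x\<bar> \<le> R)
     \<and> (\<exists>f'. (\<forall>x. (f has_real_derivative f' x) (at x)) \<and> holder_class k \<alpha> R f')"

lemma holder_class_SucI:
  "(\<And>x. (f has_real_derivative f' x) (at x)) \<Longrightarrow> (\<And>x. \<bar>f x\<bar> \<le> R) \<Longrightarrow> holder_class k \<alpha> R f' \<Longrightarrow> holder_class (Suc k) \<alpha> R f"
  unfolding holder_class.simps by blast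

lemma holder_class_bound: "holder_class k \<alpha> R f \<Longrightarrow> \<bar>f x\<bar> \<le> R"
  by (cases k) auto

lemma holder_class_nonneg: "holder_class k \<alpha> R f \<Longrightarrow> 0 \<le> R"
  using holder_class_bound[of k \<alpha> R f 0] by linarith

lemma holder_class_mono: "holder_class k \<alpha> R f \<Longrightarrow> R \<le> S \<Longrightarrow> holder_class k \<alpha> S f"
proof (induction k arbitrary: f)
  case 0
  then show ?case by (fastforce intro: order_trans mult_right_mono)
next
  case (Suc k)
  then show ?case unfolding holder_class.simps by (meson order_trans)
qed

lemma derivative_bound_imp_Lipschitz:
  assumes "\<And>x. (f has_real_derivative f' x) (at x)" "\<And>x. \<bar>f' x\<bar> \<le> R"
  shows "\<bar>f s - f s'\<bar> \<le> R * \<bar>s - s'\<bar>"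
proof -
  have "norm (f s' - f s) \<le> R * norm (s' - s)"
    by (rule field_differentiable_bound[of UNIV f f'])
       (use assms in \<open>auto intro: DERIV_subset\<close>)
  then show ?thesis by (simp add: abs_minus_commute)
qed

text \<open>
  A function with bounded derivative is Lipschitz, and on distances below 1 a Lipschitz
  function satisfies a Hoelder condition of any order \<open>\<alpha> \<le> 1\<close> with the same constant.
\<close>

lemma holder_class_Suc_imp:
  assumes "0 < \<alpha>" "\<alpha> \<le> 1"
  shows "holder_class (Suc k) \<alpha> R f \<Longrightarrow> holder_class k \<alpha> R f"
proof (induction k arbitrary: f)
  case 0
  then obtain f' where f': "\<And>x. (f has_real_derivative f' x) (at x)" "\<And>x. \<bar>f' x\<bar> \<le> R"
    and b: "\<And>x. \<bar>f x\<bar> \<le> R" by auto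
  have R0: "0 \<le> R" using b[of 0] by linarith
  have "\<bar>f s - f s'\<bar> \<le> R * \<bar>s - s'\<bar> powr \<alpha>" if "\<bar>s - s'\<bar> < 1" for s s'
  proof -
    have "\<bar>s - s'\<bar> powr 1 \<le> \<bar>s - s'\<bar> powr \<alpha>"
      using that assms by (intro powr_mono') auto
    then have "R * \<bar>s - s'\<bar> \<le> R * \<bar>s - s'\<bar> powr \<alpha>" using R0 by (simp add: mult_left_mono)
    then show ?thesis
      using derivative_bound_imp_Lipschitz[OF f', of s s'] by linarith
  qed
  with b show ?case by simp
next
  case (Suc k)
  obtain f' where f': "\<And>x. (f has_real_derivative f' x) (at x)" "holder_class (Suc k) \<alpha> R f'"
    and b: "\<And>x. \<bar>f x\<bar> \<le> R"
    using Suc.prems unfolding holder_class.simps(2)[of "Suc k"] by blast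
  show ?case unfolding holder_class.simps(2)[of k] using f'(1) Suc.IH[OF f'(2)] b by blast
qed

lemma holder_class_const: "0 < \<alpha> \<Longrightarrow> holder_class k \<alpha> \<bar>c\<bar> (\<lambda>_. c)"
proof (induction k arbitrary: c)
  case (Suc k)
  have "holder_class k \<alpha> \<bar>0\<bar> (\<lambda>_. 0)" by (rule Suc.IH[OF Suc.prems])
  then have "holder_class k \<alpha> \<bar>c\<bar> (\<lambda>_. 0)" by (rule holder_class_mono) simp
  then show ?case by (intro holder_class_SucI[where f' = "\<lambda>_. 0"]) auto
qed simp

lemma holder_class_add:
  "holder_class k \<alpha> R f \<Longrightarrow> holder_class k \<alpha> S g \<Longrightarrow> holder_class k \<alpha> (R + S) (\<lambda>x. f x + g x)"
proof (induction k arbitrary: f g)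
  case 0
  have "\<bar>f s + g s - (f s' + g s')\<bar> \<le> (R + S) * \<bar>s - s'\<bar> powr \<alpha>" if "\<bar>s - s'\<bar> < 1" for s s'
  proof -
    have "\<bar>f s - f s'\<bar> \<le> R * \<bar>s - s'\<bar> powr \<alpha>" "\<bar>g s - g s'\<bar> \<le> S * \<bar>s - s'\<bar> powr \<alpha>"
      using 0 that by auto
    then show ?thesis unfolding distrib_right by linarith
  qed
  moreover have "\<bar>f x + g x\<bar> \<le> R + S" for x
    using holder_class_bound[OF 0(1), of x] holder_class_bound[OF 0(2), of x] by linarith
  ultimately show ?case by simp
next
  case (Suc k)
  then obtain f' g' where
    "\<And>x. (f has_real_derivative f' x) (at x)" "holder_class k \<alpha> R f'" "\<And>x. \<bar>f x\<bar> \<le> R"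
    "\<And>x. (g has_real_derivative g' x) (at x)" "holder_class k \<alpha> S g'" "\<And>x. \<bar>g x\<bar> \<le> S" by auto
  note fg = this
  have "((\<lambda>x. f x + g x) has_real_derivative f' x + g' x) (at x)" for x
    by (intro derivative_intros fg)
  moreover have "\<bar>f x + g x\<bar> \<le> R + S" for x
    using fg(3)[of x] fg(6)[of x] by linarith
  ultimately show ?case using Suc.IH[OF fg(2) fg(5)] by (rule holder_class_SucI)
qed

lemma holder_class_cmult:
  "holder_class k \<alpha> R f \<Longrightarrow> \<bar>c\<bar> \<le> C \<Longrightarrow> holder_class k \<alpha> (C * R) (\<lambda>x. c * f x)"
proof (induction k arbitrary: f)
  case 0
  have C: "0 \<le> C" using 0 by linarith
  have "\<bar>c * f s - c * f s'\<bar> \<le> C * R * \<bar>s - s'\<bar> powr \<alpha>" if "\<bar>s - s'\<bar> < 1" for s s'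
  proof -
    have "\<bar>c\<bar> * \<bar>f s - f s'\<bar> \<le> C * (R * \<bar>s - s'\<bar> powr \<alpha>)"
      using 0 that C by (intro mult_mono) auto
    then show ?thesis by (simp add: abs_mult[symmetric] right_diff_distrib mult.assoc)
  qed
  with 0 C show ?case by (auto simp: abs_mult intro!: mult_mono)
next
  case (Suc k)
  then obtain f' where
    "\<And>x. (f has_real_derivative f' x) (at x)" "holder_class k \<alpha> R f'" "\<And>x. \<bar>f x\<bar> \<le> R" by auto
  note f' = this
  have "((\<lambda>x. c * f x) has_real_derivative c * f' x) (at x)" for x
    by (intro DERIV_cmult f')
  moreover have "\<bar>c * f x\<bar> \<le> C * R" for x
    unfolding abs_mult using f'(3)[of x] Suc.prems(2) by (intro mult_mono) auto
  ultimately show ?case using Suc.IH[OF f'(2) Suc.prems(2)] by (rule holder_class_SucI)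
qed

text \<open>
  The product rule. It needs the factors themselves in the class of the derivatives, which
  \<open>holder_class_Suc_imp\<close> provides. Only the existence of a uniform constant matters below.
\<close>

lemma holder_class_mult:
  assumes "0 < \<alpha>" "\<alpha> \<le> 1"
  shows "\<exists>Q. \<forall>f g. holder_class k \<alpha> R f \<longrightarrow> holder_class k \<alpha> S g \<longrightarrow> holder_class k \<alpha> Q (\<lambda>x. f x * g x)"
proof (induction k)
  case 0
  have "holder_class 0 \<alpha> (2 * R * S) (\<lambda>x. f x * g x)" if f: "holder_class 0 \<alpha> R f" and g: "holder_class 0 \<alpha> S g" for f g
  proof -
    have RS: "0 \<le> R" "0 \<le> S" using f g holder_class_nonneg by blast+
    have "\<bar>f s * g s - f s' * g s'\<bar> \<le> 2 * R * S * \<bar>s - s'\<bar> powr \<alpha>" if "\<bar>s - s'\<bar> < 1" for s s'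
    proof -
      have "\<bar>f s * g s - f s' * g s'\<bar> = \<bar>f s * (g s - g s') + g s' * (f s - f s')\<bar>"
        by (simp add: algebra_simps)
      also have "\<dots> \<le> \<bar>f s\<bar> * \<bar>g s - g s'\<bar> + \<bar>g s'\<bar> * \<bar>f s - f s'\<bar>"
        by (simp add: abs_mult[symmetric])
      also have "\<dots> \<le> R * (S * \<bar>s - s'\<bar> powr \<alpha>) + S * (R * \<bar>s - s'\<bar> powr \<alpha>)"
        using f g that RS by (intro add_mono mult_mono) auto
      finally show ?thesis by (simp add: algebra_simps)
    qed
    moreover have "\<bar>f x * g x\<bar> \<le> 2 * R * S" for x
    proof -
      have "\<bar>f x\<bar> * \<bar>g x\<bar> \<le> R * S" using f g RS by (intro mult_mono) auto
      moreover have "0 \<le> R * S" using RS by simp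
      ultimately show ?thesis by (simp add: abs_mult)
    qed
    ultimately show ?thesis by simp
  qed
  then show ?case by blast
next
  case (Suc k)
  then obtain Q where Q: "\<And>f g. holder_class k \<alpha> R f \<Longrightarrow> holder_class k \<alpha> S g \<Longrightarrow> holder_class k \<alpha> Q (\<lambda>x. f x * g x)"
    by blast
  show ?case
  proof (intro exI[of _ "\<bar>R * S\<bar> + 2 * \<bar>Q\<bar>"] allI impI)
    fix f g assume f: "holder_class (Suc k) \<alpha> R f" and g: "holder_class (Suc k) \<alpha> S g"
    obtain f' g' where
      f': "\<And>x. (f has_real_derivative f' x) (at x)" "holder_class k \<alpha> R f'" "\<And>x. \<bar>f x\<bar> \<le> R" and
      g': "\<And>x. (g has_real_derivative g' x) (at x)" "holder_class k \<alpha> S g'" "\<And>x. \<bar>g x\<bar> \<le> S"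
      using f g by auto
    have fk: "holder_class k \<alpha> R f" and gk: "holder_class k \<alpha> S g"
      using holder_class_Suc_imp[OF assms] f g by auto
    have "holder_class k \<alpha> (Q + Q) (\<lambda>x. f' x * g x + f x * g' x)"
      by (intro holder_class_add Q fk gk f' g')
    then have h: "holder_class k \<alpha> (\<bar>R * S\<bar> + 2 * \<bar>Q\<bar>) (\<lambda>x. f' x * g x + f x * g' x)"
      by (rule holder_class_mono) auto
    have "((\<lambda>x. f x * g x) has_real_derivative f' x * g x + f x * g' x) (at x)" for x
      by (rule derivative_eq_intros f'(1) g'(1) refl | simp)+
    moreover have "\<bar>f x * g x\<bar> \<le> \<bar>R * S\<bar> + 2 * \<bar>Q\<bar>" for x
    proof -
      have "\<bar>f x * g x\<bar> \<le> R * S"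
        unfolding abs_mult using f'(3)[of x] g'(3)[of x] by (intro mult_mono) auto
      then show ?thesis by linarith
    qed
    ultimately show "holder_class (Suc k) \<alpha> (\<bar>R * S\<bar> + 2 * \<bar>Q\<bar>) (\<lambda>x. f x * g x)"
      using h by (rule holder_class_SucI)
  qed
qed

text \<open>
  The derivative of \<open>1 / g\<close> is \<open>- g' / g\<^sup>2\<close>, a product of functions in the class of one order
  less.
\<close>

lemma holder_class_inverse:
  assumes \<alpha>: "0 < \<alpha>" "\<alpha> \<le> 1" and c: "0 < c"
  shows "\<exists>Q. \<forall>g. holder_class k \<alpha> S g \<longrightarrow> (\<forall>x. c \<le> g x) \<longrightarrow> holder_class k \<alpha> Q (\<lambda>x. inverse (g x))"
proof (induction k)
  case 0
  have "holder_class 0 \<alpha> (inverse c + inverse c * inverse c * \<bar>S\<bar>) (\<lambda>x. inverse (g x))"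
    if g: "holder_class 0 \<alpha> S g" "\<And>x. c \<le> g x" for g
  proof -
    have pos: "0 < g x" for x using g(2)[of x] c by linarith
    have ic: "inverse (g x) \<le> inverse c" for x using g(2) c by (intro le_imp_inverse_le) auto
    have "\<bar>inverse (g s) - inverse (g s')\<bar> \<le> (inverse c + inverse c * inverse c * \<bar>S\<bar>) * \<bar>s - s'\<bar> powr \<alpha>"
      if "\<bar>s - s'\<bar> < 1" for s s'
    proof -
      have "inverse (g s) - inverse (g s') = inverse (g s) * inverse (g s') * (g s' - g s)"
        using pos[of s] pos[of s'] by (simp add: field_simps)
      then have "\<bar>inverse (g s) - inverse (g s')\<bar> = inverse (g s) * inverse (g s') * \<bar>g s' - g s\<bar>"
        using pos[of s] pos[of s'] by (simp add: abs_mult)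
      also have "\<bar>g s' - g s\<bar> = \<bar>g s - g s'\<bar>" by simp
      also have "inverse (g s) * inverse (g s') * \<bar>g s - g s'\<bar>
          \<le> inverse c * inverse c * (S * \<bar>s - s'\<bar> powr \<alpha>)"
        using g(1) that c less_imp_le[OF pos] by (intro mult_mono ic) auto
      also have "\<dots> \<le> (inverse c * inverse c * \<bar>S\<bar>) * \<bar>s - s'\<bar> powr \<alpha>"
        using c by (simp add: mult_left_mono mult_right_mono)
      also have "\<dots> \<le> (inverse c + inverse c * inverse c * \<bar>S\<bar>) * \<bar>s - s'\<bar> powr \<alpha>"
        using c by (intro mult_right_mono) auto
      finally show ?thesis .
    qed
    moreover have "\<bar>inverse (g x)\<bar> \<le> inverse c + inverse c * inverse c * \<bar>S\<bar>" for x
    proof -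
      have "0 \<le> inverse c * inverse c * \<bar>S\<bar>" using c by simp
      then show ?thesis using ic[of x] pos[of x] by (simp add: add_increasing2)
    qed
    ultimately show ?thesis by simp
  qed
  then show ?case by blast
next
  case (Suc k)
  then obtain Q where Q: "\<And>g. holder_class k \<alpha> S g \<Longrightarrow> (\<And>x. c \<le> g x) \<Longrightarrow> holder_class k \<alpha> Q (\<lambda>x. inverse (g x))"
    by blast
  obtain P where P: "\<And>f g. holder_class k \<alpha> Q f \<Longrightarrow> holder_class k \<alpha> Q g \<Longrightarrow> holder_class k \<alpha> P (\<lambda>x. f x * g x)"
    using holder_class_mult[OF \<alpha>, of k Q Q] by blast
  obtain P' where P': "\<And>f g. holder_class k \<alpha> P f \<Longrightarrow> holder_class k \<alpha> S g \<Longrightarrow> holder_class k \<alpha> P' (\<lambda>x. f x * g x)"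
    using holder_class_mult[OF \<alpha>, of k P S] by blast
  show ?case
  proof (intro exI[of _ "inverse c + \<bar>P'\<bar>"] allI impI)
    fix g assume g: "holder_class (Suc k) \<alpha> S g" and low: "\<forall>x. c \<le> g x"
    have pos: "0 < g x" for x using low c by (metis less_le_trans)
    obtain g' where
      g': "\<And>x. (g has_real_derivative g' x) (at x)" "holder_class k \<alpha> S g'" "\<And>x. \<bar>g x\<bar> \<le> S"
      using g by auto
    have i: "holder_class k \<alpha> Q (\<lambda>x. inverse (g x))"
      using Q holder_class_Suc_imp[OF \<alpha> g] low by blast
    have "holder_class k \<alpha> (1 * P') (\<lambda>x. - 1 * ((inverse (g x) * inverse (g x)) * g' x))"
      by (intro holder_class_cmult P' P i g'(2)) simp
    moreover have "1 * P' \<le> inverse c + \<bar>P'\<bar>" using c by (simp add: add_increasing)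
    ultimately have h: "holder_class k \<alpha> (inverse c + \<bar>P'\<bar>) (\<lambda>x. - 1 * ((inverse (g x) * inverse (g x)) * g' x))"
      by (rule holder_class_mono)
    have "((\<lambda>x. inverse (g x)) has_real_derivative - 1 * ((inverse (g x) * inverse (g x)) * g' x)) (at x)" for x
      using pos[of x] by (auto intro!: derivative_eq_intros g'(1) simp: mult_ac)
    moreover have "\<bar>inverse (g x)\<bar> \<le> inverse c + \<bar>P'\<bar>" for x
    proof -
      have "inverse (g x) \<le> inverse c" using low c by (intro le_imp_inverse_le) auto
      then show ?thesis using pos[of x] by simp
    qed
    ultimately show "holder_class (Suc k) \<alpha> (inverse c + \<bar>P'\<bar>) (\<lambda>x. inverse (g x))"
      using h by (rule holder_class_SucI)
  qed
qed

lemma holder_class_sum: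
  assumes "finite I" "0 < \<alpha>" "\<And>i. i \<in> I \<Longrightarrow> holder_class k \<alpha> R (f i)"
  shows "holder_class k \<alpha> (real (card I) * R) (\<lambda>x. \<Sum>i\<in>I. f i x)"
  using assms(1,3)
proof (induction I rule: finite_induct)
  case empty
  then show ?case using holder_class_const[OF assms(2), of k 0] by simp
next
  case (insert i I)
  then have "holder_class k \<alpha> (R + real (card I) * R) (\<lambda>x. f i x + (\<Sum>i\<in>I. f i x))"
    by (intro holder_class_add) auto
  with insert show ?case by (simp add: algebra_simps)
qed

lemma iter_vderiv_Suc: "iter_vderiv (Suc k) f = iter_vderiv k (\<lambda>s. vector_derivative f (at s))"
  unfolding iter_vderiv_def funpow_Suc_right by simp

lemma vnorm_component: "i \<in> {1..m} \<Longrightarrow> norm (v i) \<le> vnorm m v"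
  unfolding vnorm_def by (intro member_le_L2_set) auto

lemma vnorm_nonneg: "0 \<le> vnorm m v"
  by (simp add: vnorm_def)

lemma vnorm_1: "vnorm 1 v = norm (v 1)"
  by (simp add: vnorm_def)

text \<open>
  The Hoelder norm is a sum of two nonnegative terms, so each is at most \<open>R\<close>.
\<close>

lemma holder_ballD:
  fixes g :: "real \<Rightarrow> nat \<Rightarrow> 'a :: real_normed_vector"
  assumes "g \<in> holder_ball m \<beta> R" and k: "k = nat (\<lceil>\<beta>\<rceil> - 1)"
  shows "times_differentiable m k g"
    and "\<And>j s. j \<le> k \<Longrightarrow> vnorm m (vderiv j g s) \<le> R"
    and "\<And>s s'. \<bar>s - s'\<bar> < 1 \<Longrightarrow>
           vnorm m (\<lambda>i. vderiv k g s i - vderiv k g s' i) \<le> R * \<bar>s - s'\<bar> powr (\<beta> - real k)"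
proof -
  define H where "H = holder_seminorm m (\<beta> - real k) (vderiv k g)"
  define N where "N = Max ((\<lambda>j. SUP s. ereal (vnorm m (vderiv j g s))) ` {0..k})"
  have le: "holder_norm m \<beta> g \<le> ereal R" using assms(1) by (simp add: holder_ball_def)
  show td: "times_differentiable m k g"
    using le unfolding holder_norm_def Let_def k[symmetric] by (auto split: if_splits)
  then have HN: "H + N \<le> ereal R"
    using le unfolding holder_norm_def Let_def k[symmetric] H_def N_def by simp
  have N_upper: "ereal (vnorm m (vderiv j g s)) \<le> N" if "j \<le> k" for j s
  proof -
    have "ereal (vnorm m (vderiv j g s)) \<le> (SUP s. ereal (vnorm m (vderiv j g s)))"
      by (rule SUP_upper) simp
    also have "\<dots> \<le> N" unfolding N_def using that by (intro Max_ge) auto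
    finally show ?thesis .
  qed
  have H_upper: "ereal (vnorm m (\<lambda>i. vderiv k g s i - vderiv k g s' i) / \<bar>s - s'\<bar> powr (\<beta> - real k)) \<le> H"
    if "0 < \<bar>s - s'\<bar>" "\<bar>s - s'\<bar> < 1" for s s'
    unfolding H_def holder_seminorm_def
    by (rule SUP_upper2[of "(s, s')"]) (use that in auto)
  have "ereal 0 \<le> ereal (vnorm m (vderiv 0 g 0))"
    by (simp add: vnorm_nonneg)
  also have "\<dots> \<le> N" by (rule N_upper) simp
  finally have N0: "0 \<le> N" by (simp only: zero_ereal_def)
  have "ereal 0 \<le> ereal (vnorm m (\<lambda>i. vderiv k g (1/2) i - vderiv k g 0 i) / \<bar>1/2 - 0\<bar> powr (\<beta> - real k))"
    by (simp add: vnorm_nonneg)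
  also have "\<dots> \<le> H" by (rule H_upper) auto
  finally have H0: "0 \<le> H" by (simp only: zero_ereal_def)
  have "0 + N \<le> H + N" using H0 by (intro add_mono order_refl)
  from order_trans[OF this HN] have NR: "N \<le> ereal R" by simp
  have "H + 0 \<le> H + N" using N0 by (intro add_mono order_refl)
  from order_trans[OF this HN] have HR: "H \<le> ereal R" by simp
  show "vnorm m (vderiv j g s) \<le> R" if "j \<le> k" for j s
    using order_trans[OF N_upper[OF that, of s] NR] by simp
  show "vnorm m (\<lambda>i. vderiv k g s i - vderiv k g s' i) \<le> R * \<bar>s - s'\<bar> powr (\<beta> - real k)"
    if "\<bar>s - s'\<bar> < 1" for s s'
  proof (cases "s = s'")
    case True then show ?thesis by (simp add: vnorm_def L2_set_def)
  next
    case False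
    then have p: "0 < \<bar>s - s'\<bar>" by simp
    have "ereal (vnorm m (\<lambda>i. vderiv k g s i - vderiv k g s' i) / \<bar>s - s'\<bar> powr (\<beta> - real k)) \<le> ereal R"
      by (rule order_trans[OF H_upper[OF p that] HR])
    then have "vnorm m (\<lambda>i. vderiv k g s i - vderiv k g s' i) / \<bar>s - s'\<bar> powr (\<beta> - real k) \<le> R"
      by (simp only: ereal_less_eq)
    moreover have "0 < \<bar>s - s'\<bar> powr (\<beta> - real k)" using p by simp
    ultimately show ?thesis by (simp only: pos_divide_le_eq)
  qed
qed

lemma holder_class_of_iter_vderiv:
  assumes "\<And>j s. j < k \<Longrightarrow> iter_vderiv j f differentiable (at s)"
    and "\<And>j s. j \<le> k \<Longrightarrow> \<bar>iter_vderiv j f s\<bar> \<le> R"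
    and "\<And>s s'. \<bar>s - s'\<bar> < 1 \<Longrightarrow> \<bar>iter_vderiv k f s - iter_vderiv k f s'\<bar> \<le> R * \<bar>s - s'\<bar> powr \<alpha>"
  shows "holder_class k \<alpha> R f"
  using assms
proof (induction k arbitrary: f)
  case 0
  then show ?case by (auto simp: iter_vderiv_def)
next
  case (Suc k)
  let ?f' = "\<lambda>s. vector_derivative f (at s)"
  have "f differentiable (at s)" for s using Suc.prems(1)[of 0 s] by (simp add: iter_vderiv_def)
  then have "(f has_real_derivative ?f' s) (at s)" for s
    by (simp add: vector_derivative_works has_real_derivative_iff_has_vector_derivative)
  moreover have h: "holder_class k \<alpha> R ?f'"
  proof (rule Suc.IH)
    show "iter_vderiv j ?f' differentiable (at s)" if "j < k" for j s
      using Suc.prems(1)[of "Suc j" s] that by (simp add: iter_vderiv_Suc)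
    show "\<bar>iter_vderiv j ?f' s\<bar> \<le> R" if "j \<le> k" for j s
      using Suc.prems(2)[of "Suc j" s] that by (simp add: iter_vderiv_Suc)
    show "\<bar>iter_vderiv k ?f' s - iter_vderiv k ?f' s'\<bar> \<le> R * \<bar>s - s'\<bar> powr \<alpha>"
      if "\<bar>s - s'\<bar> < 1" for s s'
      using Suc.prems(3)[OF that] by (simp add: iter_vderiv_Suc)
  qed
  moreover have "\<bar>f x\<bar> \<le> R" for x using Suc.prems(2)[of 0 x] by (simp add: iter_vderiv_def)
  ultimately show ?case using h by (intro holder_class_SucI[where f' = ?f']) auto
qed

lemma holder_ball_imp_holder_class:
  fixes g :: "real \<Rightarrow> nat \<Rightarrow> real"
  assumes "g \<in> holder_ball m \<beta> R" "k = nat (\<lceil>\<beta>\<rceil> - 1)" "i \<in> {1..m}"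
  shows "holder_class k (\<beta> - real k) R (\<lambda>x. g x i)"
proof (rule holder_class_of_iter_vderiv)
  note D = holder_ballD[OF assms(1,2)]
  show "iter_vderiv j (\<lambda>x. g x i) differentiable (at s)" if "j < k" for j s
    using D(1) assms(3) that by (simp add: times_differentiable_def)
  show "\<bar>iter_vderiv j (\<lambda>x. g x i) s\<bar> \<le> R" if "j \<le> k" for j s
    using vnorm_component[OF assms(3), of "vderiv j g s"] D(2)[OF that, of s] by (simp add: vderiv_def)
  show "\<bar>iter_vderiv k (\<lambda>x. g x i) s - iter_vderiv k (\<lambda>x. g x i) s'\<bar> \<le> R * \<bar>s - s'\<bar> powr (\<beta> - real k)"
    if "\<bar>s - s'\<bar> < 1" for s s'
    using vnorm_component[OF assms(3), of "\<lambda>i. vderiv k g s i - vderiv k g s' i"] D(3)[OF that]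
    by (simp add: vderiv_def)
qed

lemma holder_class_imp_iter_vderiv:
  assumes "holder_class k \<alpha> R f"
  shows "(\<forall>j<k. \<forall>s. iter_vderiv j f differentiable (at s))
    \<and> (\<forall>j\<le>k. \<forall>s. \<bar>iter_vderiv j f s\<bar> \<le> R)
    \<and> (\<forall>s s'. \<bar>s - s'\<bar> < 1 \<longrightarrow> \<bar>iter_vderiv k f s - iter_vderiv k f s'\<bar> \<le> R * \<bar>s - s'\<bar> powr \<alpha>)"
  using assms
proof (induction k arbitrary: f)
  case 0
  then show ?case by (simp add: iter_vderiv_def)
next
  case (Suc k)
  then obtain f' where f': "\<And>x. (f has_real_derivative f' x) (at x)" "holder_class k \<alpha> R f'" "\<And>x. \<bar>f x\<bar> \<le> R"
    by auto
  have "(\<lambda>s. vector_derivative f (at s)) = f'"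
    using f'(1) by (intro ext vector_derivative_at) (simp add: has_real_derivative_iff_has_vector_derivative)
  then have v: "iter_vderiv (Suc j) f = iter_vderiv j f'" for j
    by (simp only: iter_vderiv_Suc)
  have 0: "iter_vderiv 0 f = f" by (simp add: iter_vderiv_def)
  have d: "f differentiable (at s)" for s
    using f'(1) by (metis has_real_derivative_iff_has_vector_derivative differentiableI_vector)
  have "iter_vderiv j f differentiable (at s)" if "j < Suc k" for j s
    using Suc.IH[OF f'(2)] that d by (cases j) (auto simp: v 0)
  moreover have "\<bar>iter_vderiv j f s\<bar> \<le> R" if "j \<le> Suc k" for j s
    using Suc.IH[OF f'(2)] that f'(3) by (cases j) (auto simp: v 0)
  ultimately show ?case using Suc.IH[OF f'(2)] by (auto simp: v)
qed

lemma holder_class_imp_holder_ball: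
  assumes f: "holder_class k (\<beta> - real k) R f" and k: "k = nat (\<lceil>\<beta>\<rceil> - 1)"
  shows "(\<lambda>u _. f u) \<in> holder_ball 1 \<beta> (2 * R)"
proof -
  let ?g = "\<lambda>u (_::nat). f u"
  note I = holder_class_imp_iter_vderiv[OF f]
  have vd: "vderiv j ?g s i = iter_vderiv j f s" for j s i by (simp add: vderiv_def)
  have "holder_seminorm 1 (\<beta> - real k) (vderiv k ?g) \<le> ereal R"
    unfolding holder_seminorm_def vnorm_1 vd
    by (rule SUP_least) (use I in \<open>auto simp: divide_le_eq\<close>)
  moreover have "Max ((\<lambda>j. SUP s. ereal (vnorm 1 (vderiv j ?g s))) ` {0..k}) \<le> ereal R"
    unfolding vnorm_1 vd using I by (subst Max_le_iff) (auto intro!: SUP_least)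
  ultimately have "holder_seminorm 1 (\<beta> - real k) (vderiv k ?g)
      + Max ((\<lambda>j. SUP s. ereal (vnorm 1 (vderiv j ?g s))) ` {0..k}) \<le> ereal R + ereal R"
    by (rule add_mono)
  moreover have "times_differentiable 1 k ?g"
    using I by (simp add: times_differentiable_def)
  ultimately show ?thesis
    unfolding holder_ball_def holder_norm_def Let_def k[symmetric] by simp
qed

lemma holder_order:
  assumes "0 < \<beta>" "k = nat (\<lceil>\<beta>\<rceil> - 1)"
  shows "0 < \<beta> - real k" "\<beta> - real k \<le> 1" "k = 0 \<Longrightarrow> \<beta> \<le> 1" "0 < k \<Longrightarrow> 1 < \<beta>"
proof -
  have c: "1 \<le> \<lceil>\<beta>\<rceil>" using assms(1) by linarith
  then have k: "real k = of_int \<lceil>\<beta>\<rceil> - 1" using assms(2) by simp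
  have b: "of_int \<lceil>\<beta>\<rceil> - 1 < \<beta>" "\<beta> \<le> of_int \<lceil>\<beta>\<rceil>" by linarith+
  show "0 < \<beta> - real k" "\<beta> - real k \<le> 1" using b k by linarith+
  show "\<beta> \<le> 1" if "k = 0"
  proof -
    have "real k = 0" using that by simp
    then show ?thesis using b k by linarith
  qed
  show "1 < \<beta>" if "0 < k"
  proof -
    have "1 \<le> real k" using that by simp
    then show ?thesis using b k by linarith
  qed
qed

text \<open>
  The definition only compares points at distance less than 1. Further points are at most
  \<open>2 * R\<close> apart, and for \<open>\<beta> > 1\<close> the function is Lipschitz.
\<close>

lemma holder_class_holder_continuous:
  assumes \<beta>: "0 < \<beta>" "k = nat (\<lceil>\<beta>\<rceil> - 1)" and f: "holder_class k (\<beta> - real k) R f"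
  shows "\<bar>f s - f s'\<bar> \<le> 2 * R * \<bar>s - s'\<bar> powr (min 1 \<beta>)"
proof -
  note o = holder_order[OF \<beta>]
  have R: "0 \<le> R" using f holder_class_nonneg by blast
  show ?thesis
  proof (cases "k = 0")
    case True
    then have \<beta>1: "min 1 \<beta> = \<beta>" using o(3) by simp
    show ?thesis
    proof (cases "\<bar>s - s'\<bar> < 1")
      case True
      then have "\<bar>f s - f s'\<bar> \<le> R * \<bar>s - s'\<bar> powr \<beta>" using f \<open>k = 0\<close> by simp
      also have "\<dots> \<le> 2 * R * \<bar>s - s'\<bar> powr \<beta>" using R by (intro mult_right_mono) auto
      finally show ?thesis by (simp only: \<beta>1)
    next
      case False
      have "\<bar>f s - f s'\<bar> \<le> 2 * R * 1" using holder_class_bound[OF f, of s] holder_class_bound[OF f, of s'] by linarith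
      also have "\<dots> \<le> 2 * R * \<bar>s - s'\<bar> powr \<beta>"
        using False R \<beta> by (intro mult_left_mono ge_one_powr_ge_zero) auto
      finally show ?thesis by (simp only: \<beta>1)
    qed
  next
    case False
    then obtain j where j: "k = Suc j" by (cases k) auto
    then obtain f' where f': "\<And>x. (f has_real_derivative f' x) (at x)" "holder_class j (\<beta> - real k) R f'"
      using f by auto
    have "\<bar>f s - f s'\<bar> \<le> R * \<bar>s - s'\<bar>"
      by (rule derivative_bound_imp_Lipschitz[OF f'(1)]) (rule holder_class_bound[OF f'(2)])
    also have "\<dots> \<le> 2 * R * \<bar>s - s'\<bar>" using R by (intro mult_right_mono) auto
    finally show ?thesis using o(4) j by simp
  qed
qed

section \<open>Moment bounds\<close>

text \<open>
  A bound on the \<open>L\<close>-norm of order \<open>N\<close>, stated without roots.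
\<close>

definition moment_le :: "'w measure \<Rightarrow> nat \<Rightarrow> ('w \<Rightarrow> real) \<Rightarrow> real \<Rightarrow> bool" where
  "moment_le M N Z B \<longleftrightarrow> Z \<in> borel_measurable M \<and> 0 \<le> B
     \<and> integrable M (\<lambda>w. \<bar>Z w\<bar> ^ N) \<and> (\<integral>w. \<bar>Z w\<bar> ^ N \<partial>M) \<le> B ^ N"

lemma moment_le_mono: "moment_le M N Z B \<Longrightarrow> B \<le> C \<Longrightarrow> moment_le M N Z C"
  unfolding moment_le_def by (meson order_trans power_mono)

lemma moment_le_cmult:
  assumes "moment_le M N Z B"
  shows "moment_le M N (\<lambda>w. c * Z w) (\<bar>c\<bar> * B)"
  using assms by (auto simp: moment_le_def abs_mult power_mult_distrib mult_left_mono)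

lemma moment_le_cong_AE:
  assumes "moment_le M N Z B" "AE w in M. Z w = Y w" "Y \<in> borel_measurable M"
  shows "moment_le M N Y B"
proof -
  have [measurable]: "Z \<in> borel_measurable M" "Y \<in> borel_measurable M"
    using assms by (auto simp: moment_le_def)
  have "integrable M (\<lambda>w. \<bar>Z w\<bar> ^ N) = integrable M (\<lambda>w. \<bar>Y w\<bar> ^ N)"
    by (rule integrable_cong_AE) (use assms(2) in auto)
  moreover have "(\<integral>w. \<bar>Z w\<bar> ^ N \<partial>M) = (\<integral>w. \<bar>Y w\<bar> ^ N \<partial>M)"
    by (rule integral_cong_AE) (use assms(2) in auto)
  ultimately show ?thesis using assms by (simp add: moment_le_def)
qed

text \<open>
  Convexity of the power at the mean of \<open>\<bar>x\<bar> / A\<close> and \<open>\<bar>y\<bar> / B\<close> with weights \<open>A\<close> and \<open>B\<close>.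
\<close>

lemma power_sum_convexity:
  fixes x y A B :: real
  assumes "0 < A" "0 < B"
  shows "\<bar>x + y\<bar> ^ N \<le> (A + B) ^ N * (A / (A + B) * (\<bar>x\<bar> ^ N / A ^ N) + B / (A + B) * (\<bar>y\<bar> ^ N / B ^ N))"
proof -
  have conv: "convex_on {0::real..} (\<lambda>x. x ^ N)"
  proof (cases "even N")
    case True
    then show ?thesis by (rule convex_on_subset[OF convex_power_even]) auto
  next
    case False then show ?thesis by (rule convex_power_odd)
  qed
  have w: "1 - B / (A + B) = A / (A + B)" using assms by (simp add: field_simps)
  have e: "(\<bar>x\<bar> + \<bar>y\<bar>) / (A + B) = (1 - B / (A + B)) *\<^sub>R (\<bar>x\<bar> / A) + (B / (A + B)) *\<^sub>R (\<bar>y\<bar> / B)"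
    unfolding w using assms by (simp add: add_divide_distrib)
  have "((\<bar>x\<bar> + \<bar>y\<bar>) / (A + B)) ^ N \<le> (1 - B / (A + B)) * (\<bar>x\<bar> / A) ^ N + B / (A + B) * (\<bar>y\<bar> / B) ^ N"
    unfolding e by (rule convex_onD[OF conv]) (use assms in auto)
  also note w
  finally have "(\<bar>x\<bar> + \<bar>y\<bar>) ^ N \<le> (A + B) ^ N * (A / (A + B) * (\<bar>x\<bar> ^ N / A ^ N) + B / (A + B) * (\<bar>y\<bar> ^ N / B ^ N))"
    using assms by (simp add: power_divide divide_le_eq mult.commute)
  moreover have "\<bar>x + y\<bar> ^ N \<le> (\<bar>x\<bar> + \<bar>y\<bar>) ^ N" by (intro power_mono) auto
  ultimately show ?thesis by linarith
qed

lemma le_power_if_le_larger_powers: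
  fixes c v :: real
  assumes "\<And>e. 0 < e \<Longrightarrow> v \<le> (c + e) ^ N"
  shows "v \<le> c ^ N"
proof -
  have "((\<lambda>e. (c + e) ^ N) \<longlongrightarrow> (c + 0) ^ N) (at_right 0)"
    by (intro tendsto_intros)
  moreover have "eventually (\<lambda>e. v \<le> (c + e) ^ N) (at_right 0)"
    using assms by (auto simp: eventually_at_right_field intro!: exI[of _ 1])
  ultimately show ?thesis
    using tendsto_lowerbound[of "\<lambda>e. (c + e) ^ N" "(c + 0) ^ N" "at_right (0::real)" v] by simp
qed

text \<open>
  Minkowski's inequality. The convexity estimate divides by the bounds, so it is applied with
  slightly larger, positive ones.
\<close>

lemma moment_le_add:
  assumes X: "moment_le M N X A" and Y: "moment_le M N Y B"
  shows "moment_le M N (\<lambda>w. X w + Y w) (A + B)"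
proof -
  have [measurable]: "X \<in> borel_measurable M" "Y \<in> borel_measurable M"
    using X Y by (auto simp: moment_le_def)
  have AB: "0 \<le> A" "0 \<le> B" using X Y by (auto simp: moment_le_def)
  let ?S = "\<lambda>a b w. (a + b) ^ N * (a / (a + b) * (\<bar>X w\<bar> ^ N / a ^ N) + b / (a + b) * (\<bar>Y w\<bar> ^ N / b ^ N))"
  have iS: "integrable M (?S a b)" for a b
    using X Y by (intro integrable_mult_right Bochner_Integration.integrable_add integrable_divide)
      (auto simp: moment_le_def)
  have i: "integrable M (\<lambda>w. \<bar>X w + Y w\<bar> ^ N)"
  proof (rule Bochner_Integration.integrable_bound[OF iS[of 1 1]])
    show "AE w in M. norm (\<bar>X w + Y w\<bar> ^ N) \<le> norm (?S 1 1 w)"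
    proof (intro AE_I2)
      fix w
      have "\<bar>X w + Y w\<bar> ^ N \<le> ?S 1 1 w" by (rule power_sum_convexity) auto
      then show "norm (\<bar>X w + Y w\<bar> ^ N) \<le> norm (?S 1 1 w)"
        by (simp add: order_trans[OF _ abs_ge_self])
    qed
  qed measurable
  have "(\<integral>w. \<bar>X w + Y w\<bar> ^ N \<partial>M) \<le> (A + B + e) ^ N" if e: "0 < e" for e
  proof -
    \<comment> \<open>Strictly positive bounds that still add up to \<open>A + B + e\<close>.\<close>
    define a where "a = A + e / 2"
    define b where "b = B + e / 2"
    have ab: "0 < a" "0 < b" "A \<le> a" "B \<le> b" using AB e by (auto simp: a_def b_def)
    have "(\<integral>w. \<bar>X w + Y w\<bar> ^ N \<partial>M) \<le> (\<integral>w. ?S a b w \<partial>M)"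
      by (intro integral_mono i iS power_sum_convexity ab)
    also have "\<dots> = (a + b) ^ N * (a / (a + b) * ((\<integral>w. \<bar>X w\<bar> ^ N \<partial>M) / a ^ N) + b / (a + b) * ((\<integral>w. \<bar>Y w\<bar> ^ N \<partial>M) / b ^ N))"
      using X Y unfolding moment_le_def by simp
    also have "\<dots> \<le> (a + b) ^ N * (a / (a + b) * 1 + b / (a + b) * 1)"
    proof -
      have "(\<integral>w. \<bar>X w\<bar> ^ N \<partial>M) \<le> a ^ N" "(\<integral>w. \<bar>Y w\<bar> ^ N \<partial>M) \<le> b ^ N"
        using X Y ab AB unfolding moment_le_def by (meson order_trans power_mono)+
      then show ?thesis using ab by (intro mult_left_mono add_mono) auto
    qed
    also have "\<dots> = (A + B + e) ^ N"
      using ab by (simp add: add_divide_distrib[symmetric]) (simp add: a_def b_def algebra_simps)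
    finally show ?thesis .
  qed
  then have "(\<integral>w. \<bar>X w + Y w\<bar> ^ N \<partial>M) \<le> (A + B) ^ N" by (rule le_power_if_le_larger_powers)
  then show ?thesis using i AB by (simp add: moment_le_def)
qed

lemma moment_le_zero: "0 < N \<Longrightarrow> moment_le M N (\<lambda>_. 0) 0"
  by (simp add: moment_le_def zero_power)

lemma moment_le_sum:
  assumes "finite I" "0 < N" "\<And>i. i \<in> I \<Longrightarrow> moment_le M N (X i) (B i)"
  shows "moment_le M N (\<lambda>w. \<Sum>i\<in>I. X i w) (\<Sum>i\<in>I. B i)"
  using assms(1,3)
  by (induction I rule: finite_induct) (simp_all add: moment_le_zero[OF assms(2)] moment_le_add)

text \<open>
  Moment bounds pass to almost sure limits, in particular from finite sums to series.
\<close>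

lemma moment_le_Fatou:
  assumes Z: "\<And>n. moment_le M N (Z n) B" and lim: "AE w in M. (\<lambda>n. Z n w) \<longlonglongrightarrow> Y w"
    and [measurable]: "Y \<in> borel_measurable M"
  shows "moment_le M N Y B"
proof -
  have [measurable]: "\<And>n. Z n \<in> borel_measurable M" and B: "0 \<le> B" using Z by (auto simp: moment_le_def)
  have "(\<integral>\<^sup>+w. ennreal (\<bar>Y w\<bar> ^ N) \<partial>M) = (\<integral>\<^sup>+w. liminf (\<lambda>n. ennreal (\<bar>Z n w\<bar> ^ N)) \<partial>M)"
  proof (rule nn_integral_cong_AE)
    show "AE w in M. ennreal (\<bar>Y w\<bar> ^ N) = liminf (\<lambda>n. ennreal (\<bar>Z n w\<bar> ^ N))"
      using lim
    proof eventually_elim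
      case (elim w)
      then have "(\<lambda>n. ennreal (\<bar>Z n w\<bar> ^ N)) \<longlonglongrightarrow> ennreal (\<bar>Y w\<bar> ^ N)"
        by (intro tendsto_intros tendsto_ennrealI)
      then show ?case by (rule lim_imp_Liminf[OF trivial_limit_sequentially, symmetric])
    qed
  qed
  also have "\<dots> \<le> liminf (\<lambda>n. \<integral>\<^sup>+w. ennreal (\<bar>Z n w\<bar> ^ N) \<partial>M)"
    by (rule nn_integral_liminf) measurable
  also have "\<dots> \<le> ennreal (B ^ N)"
  proof -
    have "(\<integral>\<^sup>+w. ennreal (\<bar>Z n w\<bar> ^ N) \<partial>M) \<le> ennreal (B ^ N)" for n
      using Z[of n] by (subst nn_integral_eq_integral) (auto simp: moment_le_def intro: ennreal_leI)
    then show ?thesis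
      by (intro Liminf_le) (auto intro!: always_eventually)
  qed
  finally have le: "(\<integral>\<^sup>+w. ennreal (\<bar>Y w\<bar> ^ N) \<partial>M) \<le> ennreal (B ^ N)" .
  have i: "integrable M (\<lambda>w. \<bar>Y w\<bar> ^ N)"
    by (rule integrableI_bounded) (use le in \<open>auto simp: less_top[symmetric] top_unique\<close>)
  have "(\<integral>w. \<bar>Y w\<bar> ^ N \<partial>M) \<le> B ^ N"
    using le B by (subst (asm) nn_integral_eq_integral[OF i]) auto
  with i B show ?thesis by (simp add: moment_le_def)
qed

text \<open>
  The tangent of the concave function \<open>s \<mapsto> s powr (q / N)\<close> at 1.
\<close>

lemma powr_le_affine_power:
  fixes t q :: real
  assumes "0 \<le> t" "0 < q" "q \<le> real N"
  shows "t powr q \<le> q / real N * t ^ N + (1 - q / real N)"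
proof (cases "t = 0")
  case True
  then show ?thesis using assms by (cases "N = 0") auto
next
  case False
  then have t: "0 < t" using assms by simp
  have N: "0 < real N" using assms by linarith
  have "(t ^ N) powr (q / real N) * 1 powr (1 - q / real N) \<le> q / real N * t ^ N + (1 - q / real N) * 1"
    by (rule Youngs_inequality_0) (use assms t N in auto)
  moreover have "(t ^ N) powr (q / real N) = t powr q"
    using t N by (simp add: powr_realpow[symmetric] powr_powr)
  ultimately show ?thesis by simp
qed

context prob_space
begin

text \<open>
  Lyapunov's inequality, from the tangent inequality at \<open>\<bar>Z\<bar> / B\<close>.
\<close>

lemma moment_le_powr:
  assumes Z: "moment_le M N Z B" and q: "0 < q" "q \<le> real N" and B: "0 < B"
  shows "integrable M (\<lambda>w. \<bar>Z w\<bar> powr q)" "expectation (\<lambda>w. \<bar>Z w\<bar> powr q) \<le> B powr q"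
proof -
  have [measurable]: "Z \<in> borel_measurable M" and i: "integrable M (\<lambda>w. \<bar>Z w\<bar> ^ N)"
    and le: "expectation (\<lambda>w. \<bar>Z w\<bar> ^ N) \<le> B ^ N" using Z by (auto simp: moment_le_def)
  have N: "0 < real N" using q by linarith
  let ?f = "\<lambda>w. B powr q * (q / real N * (\<bar>Z w\<bar> ^ N / B ^ N) + (1 - q / real N))"
  have pw: "\<bar>Z w\<bar> powr q \<le> ?f w" for w
  proof -
    have "(\<bar>Z w\<bar> / B) powr q \<le> q / real N * (\<bar>Z w\<bar> / B) ^ N + (1 - q / real N)"
      by (rule powr_le_affine_power) (use B q in auto)
    then have "\<bar>Z w\<bar> powr q / B powr q \<le> q / real N * (\<bar>Z w\<bar> ^ N / B ^ N) + (1 - q / real N)"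
      using B by (simp add: powr_divide power_divide)
    then show ?thesis using B by (simp add: divide_le_eq mult.commute)
  qed
  have if': "integrable M ?f"
    using i by (intro integrable_mult_right Bochner_Integration.integrable_add integrable_divide integrable_const) auto
  show int: "integrable M (\<lambda>w. \<bar>Z w\<bar> powr q)"
    by (rule Bochner_Integration.integrable_bound[OF if']) (use pw in \<open>auto intro: order_trans[OF _ abs_ge_self]\<close>)
  have "expectation (\<lambda>w. \<bar>Z w\<bar> powr q) \<le> expectation ?f"
    by (intro integral_mono int if' pw)
  also have "\<dots> = B powr q * (q / real N * (expectation (\<lambda>w. \<bar>Z w\<bar> ^ N) / B ^ N) + (1 - q / real N))"
    using i by (simp add: prob_space)
  also have "\<dots> \<le> B powr q * (q / real N * 1 + (1 - q / real N))"
    using le B q by (intro mult_left_mono add_mono) auto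
  finally show "expectation (\<lambda>w. \<bar>Z w\<bar> powr q) \<le> B powr q" by simp
qed

lemma moment_le_imp_Lp_bound:
  assumes Z: "moment_le M N Z B" and q: "1 \<le> q" "q \<le> real N"
  shows "Lp_bound M q Z B"
proof -
  have B: "0 \<le> B" using Z by (simp add: moment_le_def)
  have Ze: "moment_le M N Z (B + e)" if "0 < e" for e using that by (intro moment_le_mono[OF Z]) simp
  have "expectation (\<lambda>w. \<bar>Z w\<bar> powr q) powr (1 / q) \<le> B + e" if e: "0 < e" for e
  proof -
    have "expectation (\<lambda>w. \<bar>Z w\<bar> powr q) \<le> (B + e) powr q"
      using moment_le_powr(2)[OF Ze[OF e]] q B e by simp
    then have "expectation (\<lambda>w. \<bar>Z w\<bar> powr q) powr (1 / q) \<le> ((B + e) powr q) powr (1 / q)"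
      using q by (intro powr_mono2) auto
    then show ?thesis using q B e by (simp add: powr_powr)
  qed
  then have "expectation (\<lambda>w. \<bar>Z w\<bar> powr q) powr (1 / q) \<le> B" by (rule field_le_epsilon)
  moreover have "integrable M (\<lambda>w. \<bar>Z w\<bar> powr q)"
    using moment_le_powr(1)[OF Ze[of 1], of q] q B by simp
  ultimately show ?thesis using Z by (simp add: Lp_bound_def moment_le_def)
qed

lemma moment_le_antimono_order:
  assumes Z: "moment_le M N Z B" and m: "0 < m" "m \<le> N"
  shows "moment_le M m Z B"
proof -
  have B: "0 \<le> B" using Z by (simp add: moment_le_def)
  have Ze: "moment_le M N Z (B + e)" if "0 < e" for e using that by (intro moment_le_mono[OF Z]) simp
  have p: "\<bar>Z w\<bar> powr real m = \<bar>Z w\<bar> ^ m" for w using m by (simp add: powr_realpow')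
  have "expectation (\<lambda>w. \<bar>Z w\<bar> ^ m) \<le> (B + e) ^ m" if e: "0 < e" for e
    using moment_le_powr(2)[OF Ze[OF e], of "real m"] m B e by (simp add: p powr_realpow)
  then have "expectation (\<lambda>w. \<bar>Z w\<bar> ^ m) \<le> B ^ m" by (rule le_power_if_le_larger_powers)
  moreover have "integrable M (\<lambda>w. \<bar>Z w\<bar> ^ m)"
    using moment_le_powr(1)[OF Ze[of 1], of "real m"] m B by (simp add: p)
  ultimately show ?thesis using Z B by (simp add: moment_le_def)
qed

text \<open>
  The exceptional null set does not depend on the coefficients of a filter, only on the rate \<open>r\<close>.
\<close>

lemma AE_summable_geometric_weights:
  assumes Z: "\<And>j. moment_le M N (Z j) B" and N: "0 < N"
    and r: "0 \<le> r" "r < 1"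
  shows "AE w in M. summable (\<lambda>j. r ^ j * \<bar>Z j w\<bar>)"
proof -
  have Z1: "moment_le M 1 (Z j) B" for j using moment_le_antimono_order[OF Z, of 1] N by simp
  have [measurable]: "\<And>j. Z j \<in> borel_measurable M" and B: "0 \<le> B" using Z1 by (auto simp: moment_le_def)
  have "(\<integral>\<^sup>+w. (\<Sum>j. ennreal (r ^ j * \<bar>Z j w\<bar>)) \<partial>M) = (\<Sum>j. \<integral>\<^sup>+w. ennreal (r ^ j * \<bar>Z j w\<bar>) \<partial>M)"
    by (rule nn_integral_suminf) measurable
  also have "\<dots> \<le> (\<Sum>j. ennreal (B * r ^ j))"
  proof (intro suminf_le)
    fix j
    have "(\<integral>\<^sup>+w. ennreal (r ^ j * \<bar>Z j w\<bar>) \<partial>M) = ennreal (r ^ j * expectation (\<lambda>w. \<bar>Z j w\<bar>))"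
      using Z1[of j] r by (subst nn_integral_eq_integral) (auto simp: moment_le_def)
    also have "\<dots> \<le> ennreal (B * r ^ j)"
      using Z1[of j] r by (intro ennreal_leI) (simp add: moment_le_def mult.commute[of B] mult_left_mono)
    finally show "(\<integral>\<^sup>+w. ennreal (r ^ j * \<bar>Z j w\<bar>) \<partial>M) \<le> ennreal (B * r ^ j)" .
  qed auto
  also have "\<dots> < \<infinity>"
    using B r by (subst suminf_ennreal2) (auto intro!: summable_mult summable_geometric)
  finally have "AE w in M. (\<Sum>j. ennreal (r ^ j * \<bar>Z j w\<bar>)) \<noteq> \<infinity>"
    by (intro nn_integral_PInf_AE) auto
  then show ?thesis
  proof eventually_elim
    case (elim w)
    then show ?case using r by (intro summable_suminf_not_top) auto
  qed
qed

lemma summable_weighted: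
  fixes Z :: "nat \<Rightarrow> real"
  assumes "summable (\<lambda>j. r ^ j * \<bar>Z j\<bar>)" "\<And>j. \<bar>c j\<bar> \<le> K * r ^ j"
  shows "summable (\<lambda>j. \<bar>c j * Z j\<bar>)"
proof (rule summable_comparison_test')
  show "summable (\<lambda>j. K * (r ^ j * \<bar>Z j\<bar>))" using assms(1) by (rule summable_mult)
  show "norm \<bar>c j * Z j\<bar> \<le> K * (r ^ j * \<bar>Z j\<bar>)" for j
    using mult_right_mono[OF assms(2)[of j], of "\<bar>Z j\<bar>"] by (simp add: abs_mult mult.assoc)
qed

lemma moment_le_geometric_sum:
  assumes Z: "\<And>j. moment_le M N (Z j) B" and N: "0 < N"
    and r: "0 \<le> r" "r < 1" and c: "\<And>j. \<bar>c j\<bar> \<le> K * r ^ j"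
  shows "moment_le M N (\<lambda>w. \<Sum>j<J. c j * Z j w) (K * B / (1 - r))"
proof -
  have B: "0 \<le> B" using Z by (auto simp: moment_le_def)
  have K: "0 \<le> K" using c[of 0] by simp
  have "(\<Sum>j<J. \<bar>c j\<bar> * B) \<le> (\<Sum>j<J. K * B * r ^ j)"
    using mult_right_mono[OF c B] by (intro sum_mono) (simp add: mult_ac)
  also have "\<dots> = K * B * (\<Sum>j<J. r ^ j)" by (simp add: sum_distrib_left)
  also have "\<dots> \<le> K * B * (1 / (1 - r))"
    using sum_le_suminf[of "\<lambda>n. r ^ n" "{..<J}"] r K B
    by (intro mult_left_mono) (simp_all add: suminf_geometric summable_geometric)
  finally have le: "(\<Sum>j<J. \<bar>c j\<bar> * B) \<le> K * B / (1 - r)" by simp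
  have "moment_le M N (\<lambda>w. \<Sum>j<J. c j * Z j w) (\<Sum>j<J. \<bar>c j\<bar> * B)"
    by (rule moment_le_sum) (use N moment_le_cmult[OF Z] in auto)
  then show ?thesis using le by (rule moment_le_mono)
qed

lemma moment_le_suminf:
  assumes Z: "\<And>j. moment_le M N (Z j) B" and N: "0 < N"
    and r: "0 \<le> r" "r < 1" and c: "\<And>j. \<bar>c j\<bar> \<le> K * r ^ j"
  shows "moment_le M N (\<lambda>w. \<Sum>j. c j * Z j w) (K * B / (1 - r))"
proof -
  have [measurable]: "\<And>j. Z j \<in> borel_measurable M" using Z by (auto simp: moment_le_def)
  have "AE w in M. (\<lambda>J. \<Sum>j<J. c j * Z j w) \<longlonglongrightarrow> (\<Sum>j. c j * Z j w)"
    using AE_summable_geometric_weights[where Z = Z and r = r and B = B, OF Z N r]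
  proof eventually_elim
    case (elim w)
    show ?case
      by (rule summable_LIMSEQ) (use summable_rabs_cancel[OF summable_weighted[OF elim c]] in simp)
  qed
  then show ?thesis
    by (rule moment_le_Fatou[where Z = "\<lambda>J w. \<Sum>j<J. c j * Z j w", rotated])
       (measurable, rule moment_le_geometric_sum[OF Z N r c])
qed

end

section \<open>Moments of sums of independent variables\<close>

text \<open>
  The induction step of the moment bound for sums: \<open>x\<close> bounds the norm of the old sum, \<open>b\<close>
  stands for the new coefficient, and the term linear in \<open>b\<close> is absent because the new summand
  is centred. All remaining terms carry a factor \<open>b\<^sup>2\<close>, and so \<open>x\<^sup>2\<close> only grows by a multiple of
  \<open>b\<^sup>2\<close>.
\<close>

lemma binomial_tail_bound:
  fixes x b c A :: real
  assumes x: "0 \<le> x" and b: "0 \<le> b" and A: "1 \<le> A" and k: "0 < k" and c: "c = 4 ^ k * A"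
  shows "x ^ (2 * k) + (\<Sum>j=2..2*k. real ((2 * k) choose j) * (b ^ j * A) * x ^ (2 * k - j))
          \<le> (x\<^sup>2 + c * b\<^sup>2) ^ k"
proof -
  have c1: "1 \<le> c" unfolding c using A by (intro mult_ge1_I) auto
  \<comment> \<open>A common upper bound for \<open>x\<close> and \<open>b\<close> that keeps the square.\<close>
  define m where "m = sqrt (x\<^sup>2 + b\<^sup>2)"
  have m: "x \<le> m" "b \<le> m" "0 \<le> m"
    unfolding m_def by (auto intro: real_le_rsqrt)
  have m2: "m ^ (2 * k - 2) = (x\<^sup>2 + b\<^sup>2) ^ (k - 1)"
  proof -
    have "2 * k - 2 = 2 * (k - 1)" by simp
    then show ?thesis by (simp add: m_def power_mult)
  qed
  have bnd: "b ^ j * x ^ (2 * k - j) \<le> b\<^sup>2 * (x\<^sup>2 + b\<^sup>2) ^ (k - 1)" if j: "j \<in> {2..2*k}" for j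
  proof -
    have "b ^ j * x ^ (2 * k - j) = b\<^sup>2 * (b ^ (j - 2) * x ^ (2 * k - j))"
    proof -
      obtain i where "j = i + 2" using j by (metis add.commute atLeastAtMost_iff le_Suc_ex)
      then show ?thesis by (simp add: power_add power2_eq_square mult_ac)
    qed
    also have "\<dots> \<le> b\<^sup>2 * (m ^ (j - 2) * m ^ (2 * k - j))"
      using x b m by (intro mult_left_mono mult_mono power_mono) auto
    also have "m ^ (j - 2) * m ^ (2 * k - j) = m ^ (2 * k - 2)"
      using j by (simp add: power_add[symmetric])
    finally show ?thesis by (simp only: m2)
  qed
  have "(\<Sum>j=2..2*k. real ((2 * k) choose j) * (b ^ j * A) * x ^ (2 * k - j))
      \<le> (\<Sum>j=2..2*k. real ((2 * k) choose j) * (A * (b\<^sup>2 * (x\<^sup>2 + b\<^sup>2) ^ (k - 1))))"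
  proof (rule sum_mono)
    fix j assume "j \<in> {2..2*k}"
    then have "A * (b ^ j * x ^ (2 * k - j)) \<le> A * (b\<^sup>2 * (x\<^sup>2 + b\<^sup>2) ^ (k - 1))"
      using A by (intro mult_left_mono bnd) auto
    from mult_left_mono[OF this, of "real ((2 * k) choose j)"]
    show "real ((2 * k) choose j) * (b ^ j * A) * x ^ (2 * k - j)
        \<le> real ((2 * k) choose j) * (A * (b\<^sup>2 * (x\<^sup>2 + b\<^sup>2) ^ (k - 1)))"
      by (simp add: mult_ac)
  qed
  also have "\<dots> = real (\<Sum>j=2..2*k. (2 * k) choose j) * (A * (b\<^sup>2 * (x\<^sup>2 + b\<^sup>2) ^ (k - 1)))"
    by (simp add: sum_distrib_right)
  also have "\<dots> \<le> 4 ^ k * (A * (b\<^sup>2 * (x\<^sup>2 + b\<^sup>2) ^ (k - 1)))"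
  proof (intro mult_right_mono)
    have "(\<Sum>j=2..2*k. (2 * k) choose j) \<le> (\<Sum>j\<le>2*k. (2 * k) choose j)"
      by (rule sum_mono2) auto
    also have "\<dots> = 4 ^ k" by (simp add: choose_row_sum power_mult)
    finally have "real (\<Sum>j=2..2*k. (2 * k) choose j) \<le> real (4 ^ k)" by (simp only: of_nat_le_iff)
    then show "real (\<Sum>j=2..2*k. (2 * k) choose j) \<le> 4 ^ k" by simp
  qed (use A in auto)
  also have "\<dots> = c * b\<^sup>2 * (x\<^sup>2 + b\<^sup>2) ^ (k - 1)" by (simp add: c mult_ac)
  also have "\<dots> \<le> c * b\<^sup>2 * (x\<^sup>2 + c * b\<^sup>2) ^ (k - 1)"
    using c1 by (intro mult_left_mono power_mono add_left_mono) (auto simp: mult_le_cancel_right1)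
  finally have 1: "(\<Sum>j=2..2*k. real ((2 * k) choose j) * (b ^ j * A) * x ^ (2 * k - j))
      \<le> c * b\<^sup>2 * (x\<^sup>2 + c * b\<^sup>2) ^ (k - 1)" .
  have "x ^ (2 * k) = x\<^sup>2 * (x\<^sup>2) ^ (k - 1)"
    using k by (simp add: power_mult power_Suc[symmetric] del: power_Suc)
  also have "\<dots> \<le> x\<^sup>2 * (x\<^sup>2 + c * b\<^sup>2) ^ (k - 1)"
    using c1 by (intro mult_left_mono power_mono) auto
  finally have 2: "x ^ (2 * k) \<le> x\<^sup>2 * (x\<^sup>2 + c * b\<^sup>2) ^ (k - 1)" .
  have "(x\<^sup>2 + c * b\<^sup>2) ^ k = (x\<^sup>2 + c * b\<^sup>2) * (x\<^sup>2 + c * b\<^sup>2) ^ (k - 1)"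
    using k by (simp add: power_Suc[symmetric] del: power_Suc)
  then show ?thesis using 1 2 by (simp add: distrib_right)
qed

context prob_space
begin

text \<open>
  Binomial expansion. Independence factorises the mixed moments, and the first moment of the
  centred variable \<open>V\<close> removes the linear term.
\<close>

lemma independent_pair_moment:
  assumes ind: "indep_var borel V borel U"
    and U: "moment_le M (2 * k) U x" and V: "moment_le M (2 * k) V B" and V0: "expectation V = 0"
    and b: "0 \<le> b" and A: "1 \<le> A" and k: "0 < k"
    and mom: "\<And>j. j \<in> {1..2*k} \<Longrightarrow> expectation (\<lambda>w. \<bar>V w\<bar> ^ j) \<le> b ^ j * A"
  shows "expectation (\<lambda>w. (V w + U w) ^ (2 * k)) \<le> (x\<^sup>2 + 4 ^ k * A * b\<^sup>2) ^ k"
proof -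
  have [measurable]: "U \<in> borel_measurable M" "V \<in> borel_measurable M" and x: "0 \<le> x"
    using U V by (auto simp: moment_le_def)
  have iU: "integrable M (\<lambda>w. U w ^ j)" and iV: "integrable M (\<lambda>w. V w ^ j)" if "j \<le> 2 * k" for j
  proof -
    have "integrable M (\<lambda>w. \<bar>U w\<bar> ^ j)" "integrable M (\<lambda>w. \<bar>V w\<bar> ^ j)"
      using moment_le_antimono_order[OF U, of j] moment_le_antimono_order[OF V, of j] that
      by (cases "j = 0"; simp add: moment_le_def)+
    note i = this
    show "integrable M (\<lambda>w. U w ^ j)"
      by (rule Bochner_Integration.integrable_bound[OF i(1)]) (auto simp: power_abs)
    show "integrable M (\<lambda>w. V w ^ j)"
      by (rule Bochner_Integration.integrable_bound[OF i(2)]) (auto simp: power_abs)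
  qed
  have ind': "indep_var borel (\<lambda>w. V w ^ i) borel (\<lambda>w. U w ^ j)" for i j
    using indep_var_compose[OF ind, of "\<lambda>v. v ^ i" borel "\<lambda>u. u ^ j" borel] by (simp add: comp_def)
  have iVU: "integrable M (\<lambda>w. V w ^ j * U w ^ (2 * k - j))" if "j \<le> 2 * k" for j
    by (rule indep_var_integrable[OF ind' iV iU]) (use that in auto)
  have eVU: "expectation (\<lambda>w. V w ^ j * U w ^ (2 * k - j))
      = expectation (\<lambda>w. V w ^ j) * expectation (\<lambda>w. U w ^ (2 * k - j))" if "j \<le> 2 * k" for j
    by (rule indep_var_lebesgue_integral[OF ind' iV iU]) (use that in auto)
  have Ub: "\<bar>expectation (\<lambda>w. U w ^ j)\<bar> \<le> x ^ j" if "j \<le> 2 * k" for j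
  proof (cases "j = 0")
    case False
    have "\<bar>expectation (\<lambda>w. U w ^ j)\<bar> \<le> expectation (\<lambda>w. \<bar>U w ^ j\<bar>)" by (rule integral_abs_bound)
    also have "\<dots> \<le> x ^ j"
      using moment_le_antimono_order[OF U, of j] that False by (simp add: moment_le_def power_abs)
    finally show ?thesis .
  qed (simp add: prob_space)
  let ?t = "\<lambda>j. real ((2 * k) choose j) * (expectation (\<lambda>w. V w ^ j) * expectation (\<lambda>w. U w ^ (2 * k - j)))"
  have "expectation (\<lambda>w. (V w + U w) ^ (2 * k)) = (\<Sum>j\<le>2*k. ?t j)"
    unfolding binomial_ring mult.assoc
    by (subst Bochner_Integration.integral_sum) (auto intro!: integrable_mult_right iVU simp: eVU)
  also have "{..2*k} = insert 0 (insert 1 {2..2*k})" using k by auto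
  also have "(\<Sum>j\<in>insert 0 (insert 1 {2..2*k}). ?t j) = expectation (\<lambda>w. U w ^ (2 * k)) + (\<Sum>j=2..2*k. ?t j)"
    by (simp add: V0 prob_space)
  also have "\<dots> \<le> x ^ (2 * k) + (\<Sum>j=2..2*k. real ((2 * k) choose j) * (b ^ j * A) * x ^ (2 * k - j))"
  proof (intro add_mono sum_mono)
    show "expectation (\<lambda>w. U w ^ (2 * k)) \<le> x ^ (2 * k)" using Ub[of "2 * k"] by linarith
    fix j assume j: "j \<in> {2..2*k}"
    have "\<bar>expectation (\<lambda>w. V w ^ j)\<bar> \<le> expectation (\<lambda>w. \<bar>V w ^ j\<bar>)" by (rule integral_abs_bound)
    also have "\<dots> \<le> b ^ j * A" using mom[of j] j by (simp add: power_abs)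
    finally have "\<bar>expectation (\<lambda>w. V w ^ j)\<bar> * \<bar>expectation (\<lambda>w. U w ^ (2 * k - j))\<bar>
        \<le> (b ^ j * A) * x ^ (2 * k - j)"
      using b A by (intro mult_mono Ub) auto
    then have "expectation (\<lambda>w. V w ^ j) * expectation (\<lambda>w. U w ^ (2 * k - j))
        \<le> (b ^ j * A) * x ^ (2 * k - j)"
      by (simp add: abs_mult[symmetric])
    from mult_left_mono[OF this, of "real ((2 * k) choose j)"]
    show "?t j \<le> real ((2 * k) choose j) * (b ^ j * A) * x ^ (2 * k - j)"
      by (simp add: mult.assoc)
  qed
  also have "\<dots> \<le> (x\<^sup>2 + 4 ^ k * A * b\<^sup>2) ^ k"
    by (rule binomial_tail_bound) (use x b A k in auto)
  finally show ?thesis .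
qed

text \<open>
  An inequality of Marcinkiewicz-Zygmund type for even moments, by adding one summand at a time.
\<close>

lemma independent_sum_moment:
  fixes Z :: "'i \<Rightarrow> 'a \<Rightarrow> real" and b :: "'i \<Rightarrow> real"
  assumes S: "finite S" and ind: "indep_vars (\<lambda>_. borel) Z S"
    and Z0: "\<And>s. s \<in> S \<Longrightarrow> expectation (Z s) = 0"
    and Z: "\<And>s. s \<in> S \<Longrightarrow> moment_le M (2 * k) (Z s) B" and B: "1 \<le> B" and k: "0 < k"
  shows "moment_le M (2 * k) (\<lambda>w. \<Sum>s\<in>S. b s * Z s w) (sqrt (4 ^ k * B ^ (2 * k) * (\<Sum>s\<in>S. (b s)\<^sup>2)))"
  using S ind Z0 Z
proof (induction S rule: finite_induct)
  case empty
  then show ?case using k moment_le_zero[of "2 * k"] by simp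
next
  case (insert i S)
  let ?A = "B ^ (2 * k)"
  let ?x = "sqrt (4 ^ k * ?A * (\<Sum>s\<in>S. (b s)\<^sup>2))"
  let ?U = "\<lambda>w. \<Sum>s\<in>S. b s * Z s w"
  let ?V = "\<lambda>w. b i * Z i w"
  have IH: "moment_le M (2 * k) ?U ?x"
    using insert.IH indep_vars_subset[OF insert.prems(1), of S] insert.prems(2,3) by auto
  have V: "moment_le M (2 * k) ?V (\<bar>b i\<bar> * B)" using insert.prems(3) by (intro moment_le_cmult) auto
  have UV: "moment_le M (2 * k) (\<lambda>w. ?V w + ?U w) (\<bar>b i\<bar> * B + ?x)" by (rule moment_le_add[OF V IH])
  have "indep_vars (\<lambda>_. borel) (\<lambda>s w. b s * Z s w) (insert i S)"
    using indep_vars_compose2[OF insert.prems(1), of "\<lambda>s z. b s * z" "\<lambda>_. borel"] by simp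
  then have ind: "indep_var borel ?V borel ?U"
    using indep_vars_sum[OF insert.hyps(1,2), of "\<lambda>s w. b s * Z s w"] by simp
  have mom: "expectation (\<lambda>w. \<bar>?V w\<bar> ^ j) \<le> \<bar>b i\<bar> ^ j * ?A" if j: "j \<in> {1..2*k}" for j
  proof -
    have "expectation (\<lambda>w. \<bar>Z i w\<bar> ^ j) \<le> B ^ j"
      using moment_le_antimono_order[OF insert.prems(3)[of i], of j] j by (simp add: moment_le_def)
    also have "\<dots> \<le> ?A" using B j by (intro power_increasing) auto
    finally show ?thesis by (simp add: abs_mult power_mult_distrib mult_left_mono)
  qed
  have A1: "1 \<le> ?A" using B by (rule one_le_power)
  have s0: "0 \<le> (\<Sum>s\<in>S. (b s)\<^sup>2)" by (rule sum_nonneg) simp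
  have V0: "expectation ?V = 0" using insert.prems(2)[of i] by simp
  have "expectation (\<lambda>w. (?V w + ?U w) ^ (2 * k)) \<le> (?x\<^sup>2 + 4 ^ k * ?A * \<bar>b i\<bar>\<^sup>2) ^ k"
    by (rule independent_pair_moment[OF ind IH V V0 _ A1 k mom]) auto
  also have "?x\<^sup>2 + 4 ^ k * ?A * \<bar>b i\<bar>\<^sup>2 = 4 ^ k * ?A * (\<Sum>s\<in>insert i S. (b s)\<^sup>2)"
    using insert.hyps s0 A1 by (simp add: distrib_left)
  also have "\<dots> ^ k = sqrt (4 ^ k * ?A * (\<Sum>s\<in>insert i S. (b s)\<^sup>2)) ^ (2 * k)"
    using A1 by (simp add: power_mult sum_nonneg)
  finally have "expectation (\<lambda>w. \<bar>?V w + ?U w\<bar> ^ (2 * k)) \<le> sqrt (4 ^ k * ?A * (\<Sum>s\<in>insert i S. (b s)\<^sup>2)) ^ (2 * k)"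
    by (simp add: power_even_abs)
  then show ?case using UV insert.hyps A1 by (simp add: moment_le_def sum_nonneg)
qed

end

section \<open>Linear filters of white noise\<close>

lemma L2_product:
  assumes "moment_le M 2 Y A" "moment_le M 2 Z B"
  shows "integrable M (\<lambda>w. Y w * Z w)" "(\<integral>w. \<bar>Y w * Z w\<bar> \<partial>M) \<le> A\<^sup>2 + B\<^sup>2"
proof -
  have [measurable]: "Y \<in> borel_measurable M" "Z \<in> borel_measurable M"
    and i: "integrable M (\<lambda>w. (Y w)\<^sup>2)" "integrable M (\<lambda>w. (Z w)\<^sup>2)"
    and le: "(\<integral>w. (Y w)\<^sup>2 \<partial>M) \<le> A\<^sup>2" "(\<integral>w. (Z w)\<^sup>2 \<partial>M) \<le> B\<^sup>2"
    using assms by (auto simp: moment_le_def)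
  have pw: "\<bar>Y w * Z w\<bar> \<le> (Y w)\<^sup>2 + (Z w)\<^sup>2" for w
  proof -
    have "2 * (\<bar>Y w\<bar> * \<bar>Z w\<bar>) \<le> \<bar>Y w\<bar>\<^sup>2 + \<bar>Z w\<bar>\<^sup>2"
      using sum_squares_bound[of "\<bar>Y w\<bar>" "\<bar>Z w\<bar>"] by simp
    moreover have "0 \<le> \<bar>Y w\<bar> * \<bar>Z w\<bar>" by simp
    ultimately have "\<bar>Y w\<bar> * \<bar>Z w\<bar> \<le> \<bar>Y w\<bar>\<^sup>2 + \<bar>Z w\<bar>\<^sup>2" by linarith
    then show ?thesis by (simp add: abs_mult)
  qed
  have iS: "integrable M (\<lambda>w. (Y w)\<^sup>2 + (Z w)\<^sup>2)" using i by (rule Bochner_Integration.integrable_add)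
  show int: "integrable M (\<lambda>w. Y w * Z w)"
    by (rule Bochner_Integration.integrable_bound[OF iS])
       (use pw in \<open>auto intro!: AE_I2 order_trans[OF _ abs_ge_self]\<close>)
  have "(\<integral>w. \<bar>Y w * Z w\<bar> \<partial>M) \<le> (\<integral>w. (Y w)\<^sup>2 + (Z w)\<^sup>2 \<partial>M)"
    by (intro integral_mono integrable_abs int iS pw)
  also have "\<dots> \<le> A\<^sup>2 + B\<^sup>2" using i le by simp
  finally show "(\<integral>w. \<bar>Y w * Z w\<bar> \<partial>M) \<le> A\<^sup>2 + B\<^sup>2" .
qed

locale white_noise = prob_space M for M :: "'w measure" +
  fixes \<xi> :: "int \<Rightarrow> 'w \<Rightarrow> real"
  assumes innovations: "innovations M \<xi>"
begin

lemma noise_indep: "indep_vars (\<lambda>_. borel) \<xi> UNIV"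
  using innovations by (simp add: innovations_def)

lemma noise_measurable [measurable]: "\<xi> t \<in> borel_measurable M"
  using noise_indep by (auto simp: indep_vars_def)

lemma noise_distr: "distr M borel (\<xi> t) = distr M borel (\<xi> 0)"
  using innovations by (simp add: innovations_def)

lemma noise_transfer:
  fixes g :: "real \<Rightarrow> real"
  assumes [measurable]: "g \<in> borel_measurable borel"
  shows "integrable M (\<lambda>w. g (\<xi> t w)) \<longleftrightarrow> integrable M (\<lambda>w. g (\<xi> 0 w))"
    and "expectation (\<lambda>w. g (\<xi> t w)) = expectation (\<lambda>w. g (\<xi> 0 w))"
proof -
  show "integrable M (\<lambda>w. g (\<xi> t w)) \<longleftrightarrow> integrable M (\<lambda>w. g (\<xi> 0 w))"
    using integrable_distr_eq[of "\<xi> t" M borel g] integrable_distr_eq[of "\<xi> 0" M borel g]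
      noise_distr[of t] by simp
  show "expectation (\<lambda>w. g (\<xi> t w)) = expectation (\<lambda>w. g (\<xi> 0 w))"
    using integral_distr[of "\<xi> t" M borel g] integral_distr[of "\<xi> 0" M borel g]
      noise_distr[of t] by simp
qed

lemma noise_moment: "moment_le M N (\<xi> 0) B \<Longrightarrow> moment_le M N (\<xi> t) B"
  using noise_transfer[of "\<lambda>x. \<bar>x\<bar> ^ N" t] by (simp add: moment_le_def)

lemma noise_mean: "expectation (\<xi> t) = 0"
  using noise_transfer(2)[of "\<lambda>x. x" t] innovations by (simp add: innovations_def)

lemma noise_variance: "expectation (\<lambda>w. (\<xi> t w)\<^sup>2) = 1"
proof -
  have "expectation (\<lambda>w. (\<xi> 0 w - expectation (\<xi> 0))\<^sup>2) = 1" "expectation (\<xi> 0) = 0"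
    using innovations unfolding innovations_def by auto
  then have "expectation (\<lambda>w. (\<xi> 0 w)\<^sup>2) = 1" by (simp only: diff_zero)
  then show ?thesis using noise_transfer(2)[of "\<lambda>x. x\<^sup>2" t] by simp
qed

lemma noise_L2: "moment_le M 2 (\<xi> t) 1"
proof -
  have "moment_le M 2 (\<xi> 0) 1"
    using noise_variance[of 0] innovations by (simp add: moment_le_def innovations_def)
  then show ?thesis by (rule noise_moment)
qed

lemma noise_integrable: "integrable M (\<xi> t)"
  using noise_transfer(1)[of "\<lambda>x. x" t] innovations by (simp add: innovations_def)

lemma noise_separated_indep:
  assumes "A \<inter> B = {}" "f \<in> borel_measurable (PiM A (\<lambda>_. borel))" "g \<in> borel_measurable (PiM B (\<lambda>_. borel))"
  shows "indep_var borel (\<lambda>w. f (restrict (\<lambda>i. \<xi> i w) A)) borel (\<lambda>w. g (restrict (\<lambda>i. \<xi> i w) B))"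
  using indep_var_compose[OF indep_var_restrict[OF noise_indep assms(1)] assms(2,3)]
  by (simp add: comp_def)

lemma noise_orthogonal:
  "integrable M (\<lambda>w. \<xi> s w * \<xi> t w)"
  "expectation (\<lambda>w. \<xi> s w * \<xi> t w) = (if s = t then 1 else 0)"
proof -
  show "integrable M (\<lambda>w. \<xi> s w * \<xi> t w)" by (rule L2_product[OF noise_L2 noise_L2])
  show "expectation (\<lambda>w. \<xi> s w * \<xi> t w) = (if s = t then 1 else 0)"
  proof (cases "s = t")
    case True
    then show ?thesis using noise_variance[of t] by (simp add: power2_eq_square)
  next
    case False
    have "indep_var borel (\<xi> s) borel (\<xi> t)"
      using noise_separated_indep[of "{s}" "{t}" "\<lambda>f. f s" "\<lambda>f. f t"] False by simp
    from indep_var_lebesgue_integral[OF this noise_integrable noise_integrable]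
    show ?thesis using False by (simp add: noise_mean)
  qed
qed

definition linear_filter :: "(nat \<Rightarrow> real) \<Rightarrow> int \<Rightarrow> 'w \<Rightarrow> real" where
  "linear_filter c t w = (\<Sum>j. c j * \<xi> (t - int j) w)"

lemma linear_filter_measurable [measurable]: "linear_filter c t \<in> borel_measurable M"
  unfolding linear_filter_def by measurable

lemma AE_noise_summable:
  assumes "0 \<le> r" "r < 1"
  shows "AE w in M. \<forall>t. summable (\<lambda>j. r ^ j * \<bar>\<xi> (t - int j) w\<bar>)"
  unfolding AE_all_countable
  using AE_summable_geometric_weights[where N = 2 and B = 1, OF noise_L2 _ assms] by simp

lemma filter_summable:
  assumes "summable (\<lambda>j. r ^ j * \<bar>\<xi> (t - int j) w\<bar>)" "\<And>j. \<bar>c j\<bar> \<le> K * r ^ j"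
  shows "summable (\<lambda>j. c j * \<xi> (t - int j) w)" "summable (\<lambda>j. \<bar>c j * \<xi> (t - int j) w\<bar>)"
proof -
  show "summable (\<lambda>j. \<bar>c j * \<xi> (t - int j) w\<bar>)"
    by (rule summable_weighted[where Z = "\<lambda>j. \<xi> (t - int j) w", OF assms])
  then show "summable (\<lambda>j. c j * \<xi> (t - int j) w)" by (rule summable_rabs_cancel)
qed

lemma linear_filter_moment:
  assumes "moment_le M N (\<xi> 0) B" "0 < N" "0 \<le> r" "r < 1" "\<And>j. \<bar>c j\<bar> \<le> K * r ^ j"
  shows "moment_le M N (linear_filter c t) (K * B / (1 - r))"
  unfolding linear_filter_def
  by (rule moment_le_suminf[where Z = "\<lambda>j. \<xi> (t - int j)"]) (use assms noise_moment in auto)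

lemma linear_filter_L2:
  assumes "0 \<le> r" "r < 1" "\<And>j. \<bar>c j\<bar> \<le> K * r ^ j"
  shows "moment_le M 2 (linear_filter c t) (K / (1 - r))"
  using linear_filter_moment[of 2 1, OF noise_L2 _ assms] by simp

text \<open>
  Only the innovations are integrated against \<open>Y\<close>. Taking for \<open>Y\<close> a constant, an innovation
  and another filter gives the mean of a filter, its covariance with the noise, and the
  covariance of two filters.
\<close>

lemma linear_filter_inner:
  assumes r: "0 \<le> r" "r < 1" and c: "\<And>j. \<bar>c j\<bar> \<le> K * r ^ j" and Y: "moment_le M 2 Y B"
  shows "(\<lambda>j. c j * expectation (\<lambda>w. Y w * \<xi> (t - int j) w)) sums expectation (\<lambda>w. Y w * linear_filter c t w)"
proof -
  let ?f = "\<lambda>j w. Y w * (c j * \<xi> (t - int j) w)"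
  have i: "integrable M (\<lambda>w. Y w * \<xi> (t - int j) w)" for j by (rule L2_product[OF Y noise_L2])
  have "integrable M (\<lambda>w. c j * (Y w * \<xi> (t - int j) w))" for j
    by (intro integrable_mult_right i)
  then have if': "integrable M (?f j)" for j by (simp only: mult.left_commute)
  have s1: "AE w in M. summable (\<lambda>j. norm (?f j w))"
    using AE_noise_summable[OF r]
  proof eventually_elim
    case (elim w)
    show ?case
      using summable_mult[OF filter_summable(2)[OF elim[rule_format, of t] c], of "\<bar>Y w\<bar>"] by (simp add: abs_mult)
  qed
  have s2: "summable (\<lambda>j. expectation (\<lambda>w. norm (?f j w)))"
  proof (rule summable_comparison_test')
    show "summable (\<lambda>j. K * (B\<^sup>2 + 1\<^sup>2) * r ^ j)" using r by (intro summable_mult summable_geometric) auto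
    fix j
    have "expectation (\<lambda>w. norm (?f j w)) = \<bar>c j\<bar> * expectation (\<lambda>w. \<bar>Y w * \<xi> (t - int j) w\<bar>)"
      by (subst integral_mult_right_zero[symmetric]) (simp add: abs_mult mult_ac)
    also have "\<dots> \<le> (K * r ^ j) * (B\<^sup>2 + 1\<^sup>2)"
      by (intro mult_mono c L2_product(2)[OF Y noise_L2]) (use c[of j] in \<open>auto intro: order_trans[OF abs_ge_zero]\<close>)
    finally show "norm (expectation (\<lambda>w. norm (?f j w))) \<le> K * (B\<^sup>2 + 1\<^sup>2) * r ^ j" by (simp add: mult_ac)
  qed
  have "(\<lambda>j. expectation (?f j)) sums expectation (\<lambda>w. \<Sum>j. ?f j w)"
    by (rule sums_integral[OF if' s1 s2])
  moreover have "expectation (?f j) = c j * expectation (\<lambda>w. Y w * \<xi> (t - int j) w)" for j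
    by (subst integral_mult_right_zero[symmetric]) (simp add: mult_ac)
  moreover have "expectation (\<lambda>w. \<Sum>j. ?f j w) = expectation (\<lambda>w. Y w * linear_filter c t w)"
  proof (rule integral_cong_AE)
    show "AE w in M. (\<Sum>j. ?f j w) = Y w * linear_filter c t w"
      using AE_noise_summable[OF r]
    proof eventually_elim
      case (elim w)
      show ?case unfolding linear_filter_def
        by (rule suminf_mult) (rule filter_summable(1)[OF elim[rule_format, of t] c])
    qed
    have [measurable]: "Y \<in> borel_measurable M" using Y by (simp add: moment_le_def)
    show "(\<lambda>w. \<Sum>j. ?f j w) \<in> borel_measurable M" "(\<lambda>w. Y w * linear_filter c t w) \<in> borel_measurable M"
      by measurable
  qed
  ultimately show ?thesis by simp
qed

lemma linear_filter_mean:
  assumes r: "0 \<le> r" "r < 1" and c: "\<And>j. \<bar>c j\<bar> \<le> K * r ^ j"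
  shows "expectation (linear_filter c t) = 0"
proof -
  have "moment_le M 2 (\<lambda>_. 1) 1" by (simp add: moment_le_def prob_space)
  from linear_filter_inner[OF r c this, of t]
  have "(\<lambda>j. 0) sums expectation (linear_filter c t)" by (simp add: noise_mean)
  then show ?thesis using sums_unique2[OF _ sums_zero] by blast
qed

lemma linear_filter_noise_covariance:
  assumes r: "0 \<le> r" "r < 1" and c: "\<And>j. \<bar>c j\<bar> \<le> K * r ^ j"
  shows "expectation (\<lambda>w. linear_filter c t w * \<xi> s w) = (if s \<le> t then c (nat (t - s)) else 0)"
proof -
  have "(\<lambda>j. c j * expectation (\<lambda>w. \<xi> s w * \<xi> (t - int j) w)) sums expectation (\<lambda>w. \<xi> s w * linear_filter c t w)"
    by (rule linear_filter_inner[OF r c noise_L2])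
  then have 1: "(\<lambda>j. c j * (if s = t - int j then 1 else 0)) sums expectation (\<lambda>w. linear_filter c t w * \<xi> s w)"
    by (simp add: noise_orthogonal mult.commute)
  have "(\<lambda>j. c j * (if s = t - int j then 1 else 0)) sums (if s \<le> t then c (nat (t - s)) else 0)"
  proof (cases "s \<le> t")
    case True
    then have "(\<lambda>j. c j * (if s = t - int j then 1 else 0)) = (\<lambda>j. if j = nat (t - s) then c j else 0)"
      by (auto simp: fun_eq_iff)
    then show ?thesis using sums_single[of "nat (t - s)" c] True by simp
  next
    case False
    then have "(\<lambda>j. c j * (if s = t - int j then 1 else 0)) = (\<lambda>j. 0)" by (auto simp: fun_eq_iff)
    then show ?thesis using False by simp
  qed
  with 1 show ?thesis by (rule sums_unique2)
qed

text \<open>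
  The innovation at time \<open>s - j\<close> enters the first filter with lag \<open>t - s + j\<close>, if it is not
  later than \<open>t\<close>.
\<close>

lemma linear_filter_covariance:
  assumes r: "0 \<le> r" "r < 1" and c: "\<And>j. \<bar>c j\<bar> \<le> K * r ^ j" and d: "\<And>j. \<bar>d j\<bar> \<le> L * r ^ j"
  shows "(\<lambda>j. d j * (if s - int j \<le> t then c (nat (t - s + int j)) else 0))
      sums expectation (\<lambda>w. linear_filter c t w * linear_filter d s w)"
proof -
  have e: "t - (s - int j) = t - s + int j" for j by simp
  show ?thesis
    using linear_filter_inner[OF r d linear_filter_L2[OF r c, of t], of s]
    by (simp only: linear_filter_noise_covariance[OF r c] e)
qed

text \<open>
  Splitting off the innovation with nonzero coefficient leaves an independent remainder \<open>R\<close>,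
  and for each value of \<open>R\<close> just one value of the innovation makes the filter vanish.
\<close>

lemma linear_filter_atomless:
  assumes r: "0 \<le> r" "r < 1" and c: "\<And>j. \<bar>c j\<bar> \<le> K * r ^ j" and c0: "c j0 \<noteq> 0"
    and atomless: "\<And>x. prob {w \<in> space M. \<xi> 0 w = x} = 0"
  shows "AE w in M. linear_filter c t w \<noteq> 0"
proof -
  define s where "s = t - int j0"
  define R where "R w = (\<Sum>j. (if j = j0 then 0 else c j) * \<xi> (t - int j) w)" for w
  have [measurable]: "R \<in> borel_measurable M" unfolding R_def by measurable
  have split: "AE w in M. linear_filter c t w = c j0 * \<xi> s w + R w"
    using AE_noise_summable[OF r]
  proof eventually_elim
    case (elim w)
    note sm = filter_summable(1)[OF elim[rule_format, of t] c]
    let ?h = "\<lambda>j. (if j = j0 then c j0 * \<xi> s w else 0)"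
    have h: "?h sums (c j0 * \<xi> s w)" using sums_single[of j0 "\<lambda>_. c j0 * \<xi> s w"] by simp
    have "(\<lambda>j. c j * \<xi> (t - int j) w - ?h j) sums (linear_filter c t w - c j0 * \<xi> s w)"
      unfolding linear_filter_def by (intro sums_diff summable_sums sm h)
    moreover have "(\<lambda>j. c j * \<xi> (t - int j) w - ?h j) = (\<lambda>j. (if j = j0 then 0 else c j) * \<xi> (t - int j) w)"
      by (auto simp: fun_eq_iff s_def)
    ultimately have "R w = linear_filter c t w - c j0 * \<xi> s w"
      unfolding R_def by (simp add: sums_iff)
    then show ?case by simp
  qed
  let ?B = "UNIV - {s}"
  define g where "g f = (\<Sum>j. if j = j0 then 0 else c j * f (t - int j))" for f :: "int \<Rightarrow> real"
  have "(\<lambda>f. if j = j0 then 0 else c j * f (t - int j)) \<in> borel_measurable (PiM ?B (\<lambda>_. borel :: real measure))" for j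
  proof (cases "j = j0")
    case False
    then have [measurable]: "t - int j \<in> ?B" by (simp add: s_def)
    then have "(\<lambda>f. c j * f (t - int j)) \<in> borel_measurable (PiM ?B (\<lambda>_. borel :: real measure))"
      by (intro borel_measurable_times borel_measurable_const measurable_component_singleton)
    then show ?thesis using False by simp
  qed simp
  then have g: "g \<in> borel_measurable (PiM ?B (\<lambda>_. borel))"
    unfolding g_def by (rule borel_measurable_suminf)
  have gR: "g (restrict (\<lambda>i. \<xi> i w) ?B) = R w" for w
    unfolding g_def R_def by (rule arg_cong[where f = suminf]) (auto simp: fun_eq_iff s_def)
  have f: "(\<lambda>f. f s) \<in> borel_measurable (PiM {s} (\<lambda>_. borel :: real measure))"
    by (rule measurable_component_singleton) simp
  have ind: "indep_var borel (\<xi> s) borel R"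
    using noise_separated_indep[OF _ f g] by (simp add: gR)
  let ?D1 = "distr M borel (\<xi> s)" and ?D2 = "distr M borel R"
  let ?Q = "{z :: real \<times> real. c j0 * fst z + snd z = 0}"
  interpret D1: prob_space ?D1 by (rule prob_space_distr) simp
  interpret D2: prob_space ?D2 by (rule prob_space_distr) simp
  interpret P: pair_sigma_finite ?D1 ?D2 ..
  have Q: "?Q \<in> sets (borel \<Otimes>\<^sub>M borel)"
  proof -
    have "?Q = (\<lambda>z. c j0 * fst z + snd z) -` {0} \<inter> space (borel \<Otimes>\<^sub>M borel)" by (auto simp: space_pair_measure)
    also have "\<dots> \<in> sets (borel \<Otimes>\<^sub>M borel)" by measurable
    finally show ?thesis .
  qed
  have null: "emeasure ?D1 {x} = 0" for x
  proof -
    have "emeasure (distr M borel (\<xi> 0)) {x} = emeasure M {w \<in> space M. \<xi> 0 w = x}"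
      by (subst emeasure_distr) (auto intro!: arg_cong[where f = "emeasure M"])
    also have "\<dots> = 0" using atomless[of x] by (simp add: emeasure_eq_measure)
    finally show ?thesis by (simp only: noise_distr[of s])
  qed
  have "emeasure M {w \<in> space M. c j0 * \<xi> s w + R w = 0}
      = emeasure (distr M (borel \<Otimes>\<^sub>M borel) (\<lambda>w. (\<xi> s w, R w))) ?Q"
    using Q by (subst emeasure_distr) (auto intro!: arg_cong[where f = "emeasure M"])
  also have "\<dots> = emeasure (?D1 \<Otimes>\<^sub>M ?D2) ?Q"
    using ind unfolding indep_var_distribution_eq by simp
  also have "\<dots> = (\<integral>\<^sup>+y. emeasure ?D1 ((\<lambda>x. (x, y)) -` ?Q) \<partial>?D2)"
    by (rule P.emeasure_pair_measure_alt2) (use Q in simp)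
  also have "\<dots> = (\<integral>\<^sup>+y. 0 \<partial>?D2)"
  proof (intro nn_integral_cong)
    fix y
    have "(\<lambda>x. (x, y)) -` ?Q = {- y / c j0}" using c0 by (auto simp: field_simps)
    then show "emeasure ?D1 ((\<lambda>x. (x, y)) -` ?Q) = 0" by (simp add: null)
  qed
  finally have z: "emeasure M {w \<in> space M. c j0 * \<xi> s w + R w = 0} = 0" by simp
  have "AE w in M. c j0 * \<xi> s w + R w \<noteq> 0"
    by (rule AE_I[OF _ z]) auto
  with split show ?thesis by eventually_elim simp
qed

end

section \<open>Quadratic forms in white noise\<close>

context white_noise
begin

definition noise_product :: "int \<Rightarrow> int \<Rightarrow> 'w \<Rightarrow> real" where
  "noise_product m s w = \<xi> s w * \<xi> (s - m) w - (if m = 0 then 1 else 0)"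

lemma noise_product_measurable [measurable]: "noise_product m s \<in> borel_measurable M"
  unfolding noise_product_def by measurable

lemma noise_product_mean: "expectation (noise_product m s) = 0"
  unfolding noise_product_def using noise_orthogonal[of s "s - m"] by (simp add: prob_space)

text \<open>
  \<open>\<bar>x y\<bar> ^ (2 * k) \<le> x ^ (4 * k) + y ^ (4 * k)\<close>, and the centring adds at most 1.
\<close>

lemma noise_product_moment:
  assumes k: "0 < k" and i: "integrable M (\<lambda>w. \<bar>\<xi> 0 w\<bar> ^ (4 * k))"
  shows "moment_le M (2 * k) (noise_product m s) (2 + 2 * expectation (\<lambda>w. \<bar>\<xi> 0 w\<bar> ^ (4 * k)))"
proof -
  let ?\<mu> = "expectation (\<lambda>w. \<bar>\<xi> 0 w\<bar> ^ (4 * k))"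
  have \<mu>0: "0 \<le> ?\<mu>" by (intro integral_nonneg_AE) auto
  have it: "integrable M (\<lambda>w. \<bar>\<xi> t w\<bar> ^ (4 * k))" and et: "expectation (\<lambda>w. \<bar>\<xi> t w\<bar> ^ (4 * k)) = ?\<mu>" for t
    using noise_transfer[of "\<lambda>x. \<bar>x\<bar> ^ (4 * k)" t] i by auto
  have pw: "\<bar>x * y\<bar> ^ (2 * k) \<le> \<bar>x\<bar> ^ (4 * k) + \<bar>y\<bar> ^ (4 * k)" for x y :: real
  proof -
    let ?m = "max \<bar>x\<bar> \<bar>y\<bar>"
    have "\<bar>x * y\<bar> ^ (2 * k) \<le> (?m * ?m) ^ (2 * k)"
      unfolding abs_mult by (intro power_mono mult_mono) auto
    also have "\<dots> = ?m ^ (4 * k)" by (simp add: power_mult_distrib power_add[symmetric])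
    also have "\<dots> \<le> \<bar>x\<bar> ^ (4 * k) + \<bar>y\<bar> ^ (4 * k)" by (auto simp: max_def)
    finally show ?thesis .
  qed
  let ?g = "\<lambda>w. \<bar>\<xi> s w\<bar> ^ (4 * k) + \<bar>\<xi> (s - m) w\<bar> ^ (4 * k)"
  have ig: "integrable M ?g" by (intro Bochner_Integration.integrable_add it)
  have int: "integrable M (\<lambda>w. \<bar>\<xi> s w * \<xi> (s - m) w\<bar> ^ (2 * k))"
    by (rule Bochner_Integration.integrable_bound[OF ig])
       (use pw in \<open>auto intro!: AE_I2 order_trans[OF _ abs_ge_self]\<close>)
  have "expectation (\<lambda>w. \<bar>\<xi> s w * \<xi> (s - m) w\<bar> ^ (2 * k)) \<le> expectation ?g"
    by (intro integral_mono int ig pw)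
  also have "\<dots> = 2 * ?\<mu>" using it et[of s] et[of "s - m"] by simp
  also have "\<dots> \<le> (1 + 2 * ?\<mu>) ^ 1" by simp
  also have "\<dots> \<le> (1 + 2 * ?\<mu>) ^ (2 * k)" using \<mu>0 k by (intro power_increasing) auto
  finally have "moment_le M (2 * k) (\<lambda>w. \<xi> s w * \<xi> (s - m) w) (1 + 2 * ?\<mu>)"
    using int \<mu>0 by (simp add: moment_le_def)
  moreover have "moment_le M (2 * k) (\<lambda>w. - (if m = 0 then 1 else 0)) 1"
    using k by (simp add: moment_le_def prob_space zero_power)
  ultimately have "moment_le M (2 * k) (\<lambda>w. \<xi> s w * \<xi> (s - m) w + - (if m = 0 then 1 else 0)) ((1 + 2 * ?\<mu>) + 1)"
    by (rule moment_le_add)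
  then show ?thesis by (simp add: noise_product_def[abs_def] add.commute)
qed

text \<open>
  The integers coloured alternately in blocks of length \<open>\<bar>m\<bar>\<close>. For \<open>m = 0\<close> division by 0 yields
  0, and all integers get the same colour.
\<close>

definition colour_class :: "int \<Rightarrow> int set" where
  "colour_class m = {s. even (s div \<bar>m\<bar>)}"

lemma colour_shift: "m \<noteq> 0 \<Longrightarrow> s - m \<in> colour_class m \<longleftrightarrow> s \<notin> colour_class m"
proof -
  assume m: "m \<noteq> 0"
  have "(s - m) div \<bar>m\<bar> = s div \<bar>m\<bar> - sgn m"
  proof (cases "0 < m")
    case True
    have "(s - m) div m = s div m - 1" using div_add_self2[of m "s - m"] True by simp
    then show ?thesis using True by simp
  next
    case False
    have "(s + - m) div (- m) = s div (- m) + 1" using div_add_self2[of "- m" s] m by simp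
    then show ?thesis using False m by simp
  qed
  then show ?thesis using m by (auto simp: colour_class_def sgn_if)
qed

text \<open>
  A shift by \<open>m \<noteq> 0\<close> changes the colour. So within one colour the index pairs \<open>{s, s - m}\<close> are
  pairwise disjoint.
\<close>

lemma noise_product_indep:
  assumes "S \<subseteq> colour_class m \<or> S \<subseteq> - colour_class m"
  shows "indep_vars (\<lambda>_. borel) (noise_product m) S"
proof -
  let ?K = "\<lambda>s. {s, s - m}"
  have disj: "disjoint_family_on ?K S"
    unfolding disjoint_family_on_def
  proof (intro ballI impI)
    fix s s' assume "s \<in> S" "s' \<in> S" "s \<noteq> s'"
    with assms colour_shift[of m s] colour_shift[of m s'] show "?K s \<inter> ?K s' = {}"
      by (cases "m = 0") auto
  qed
  have "indep_vars (\<lambda>s. PiM (?K s) (\<lambda>_. borel)) (\<lambda>s w. restrict (\<lambda>i. \<xi> i w) (?K s)) S"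
    by (rule indep_vars_restrict[OF noise_indep _ disj]) simp
  then have "indep_vars (\<lambda>_. borel)
      (\<lambda>s w. (\<lambda>f. f s * f (s - m) - (if m = 0 then 1 else 0)) (restrict (\<lambda>i. \<xi> i w) (?K s))) S"
  proof (rule indep_vars_compose2)
    fix s
    have [measurable]: "s \<in> ?K s" "s - m \<in> ?K s" by auto
    show "(\<lambda>f. f s * f (s - m) - (if m = 0 then 1 else 0)) \<in> borel_measurable (PiM (?K s) (\<lambda>_. borel :: real measure))"
      by measurable
  qed
  then show ?thesis by (simp add: noise_product_def[abs_def])
qed

lemma diagonal_sum_moment:
  assumes k: "0 < k" and i: "integrable M (\<lambda>w. \<bar>\<xi> 0 w\<bar> ^ (4 * k))" and S: "finite S"
    and B: "B = 2 + 2 * expectation (\<lambda>w. \<bar>\<xi> 0 w\<bar> ^ (4 * k))" and b: "(\<Sum>s\<in>S. (b s)\<^sup>2) \<le> V"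
  shows "moment_le M (2 * k) (\<lambda>w. \<Sum>s\<in>S. b s * noise_product m s w) (2 * sqrt (4 ^ k * B ^ (2 * k) * V))"
proof -
  have B1: "1 \<le> B" unfolding B by (simp add: add_increasing2 integral_nonneg_AE)
  have part: "moment_le M (2 * k) (\<lambda>w. \<Sum>s\<in>R. b s * noise_product m s w) (sqrt (4 ^ k * B ^ (2 * k) * V))"
    if R: "R \<subseteq> S" "R \<subseteq> colour_class m \<or> R \<subseteq> - colour_class m" for R
  proof (rule moment_le_mono)
    have fin: "finite R" using R(1) S by (rule finite_subset)
    show "moment_le M (2 * k) (\<lambda>w. \<Sum>s\<in>R. b s * noise_product m s w) (sqrt (4 ^ k * B ^ (2 * k) * (\<Sum>s\<in>R. (b s)\<^sup>2)))"
      by (rule independent_sum_moment[OF fin noise_product_indep[OF R(2)] noise_product_mean _ B1 k])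
         (unfold B, rule noise_product_moment[OF k i])
    have "(\<Sum>s\<in>R. (b s)\<^sup>2) \<le> (\<Sum>s\<in>S. (b s)\<^sup>2)" by (rule sum_mono2[OF S R(1)]) simp
    then show "sqrt (4 ^ k * B ^ (2 * k) * (\<Sum>s\<in>R. (b s)\<^sup>2)) \<le> sqrt (4 ^ k * B ^ (2 * k) * V)"
      using b B1 by (intro real_sqrt_le_mono mult_left_mono) auto
  qed
  \<comment> \<open>For \<open>m = 0\<close> the second part is empty.\<close>
  let ?A = "S \<inter> colour_class m" and ?B = "S - colour_class m"
  have "moment_le M (2 * k) (\<lambda>w. (\<Sum>s\<in>?A. b s * noise_product m s w) + (\<Sum>s\<in>?B. b s * noise_product m s w))
      (sqrt (4 ^ k * B ^ (2 * k) * V) + sqrt (4 ^ k * B ^ (2 * k) * V))"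
    by (intro moment_le_add part) auto
  moreover have "(\<Sum>s\<in>?A. b s * noise_product m s w) + (\<Sum>s\<in>?B. b s * noise_product m s w)
      = (\<Sum>s\<in>S. b s * noise_product m s w)" for w
    using S by (subst sum.union_disjoint[symmetric]) (auto intro!: sum.cong)
  ultimately show ?thesis by simp
qed

text \<open>
  For fixed lags \<open>i\<close> and \<open>j\<close> the sum over \<open>t\<close> is a diagonal sum with shift \<open>m = l + j - i\<close>, and
  its norm is of order \<open>r ^ i * r ^ j\<close> times the Euclidean norm of the weights. Minkowski's
  inequality sums these over the lags.
\<close>

lemma double_sum_moment:
  assumes k: "0 < k" and i: "integrable M (\<lambda>w. \<bar>\<xi> 0 w\<bar> ^ (4 * k))" and S: "finite S"
    and B: "B = 2 + 2 * expectation (\<lambda>w. \<bar>\<xi> 0 w\<bar> ^ (4 * k))"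
    and r: "0 \<le> r" "r < 1" and c: "\<And>t j. \<bar>c t j\<bar> \<le> K * r ^ j"
  shows "moment_le M (2 * k)
      (\<lambda>w. \<Sum>i<J. \<Sum>j<J. \<Sum>t\<in>S. v t * c t i * c (t - l) j * noise_product (l + int j - int i) (t - int i) w)
      (2 * sqrt (4 ^ k * B ^ (2 * k)) * (K / (1 - r))\<^sup>2 * sqrt (\<Sum>t\<in>S. (v t)\<^sup>2))"
proof -
  let ?c = "2 * sqrt (4 ^ k * B ^ (2 * k))" and ?V = "\<Sum>t\<in>S. (v t)\<^sup>2"
  have K: "0 \<le> K" using c[of 0 0] by simp
  have B0: "0 \<le> B" unfolding B by (simp add: add_increasing integral_nonneg_AE)
  have inner: "moment_le M (2 * k)
      (\<lambda>w. \<Sum>t\<in>S. v t * c t i * c (t - l) j * noise_product (l + int j - int i) (t - int i) w)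
      (?c * sqrt ?V * (K * r ^ i) * (K * r ^ j))" for i j
  proof -
    let ?S = "(\<lambda>t. t - int i) ` S"
    let ?b = "\<lambda>s. v (s + int i) * c (s + int i) i * c (s + int i - l) j"
    have e: "(\<Sum>s\<in>?S. ?b s * noise_product (l + int j - int i) s w)
        = (\<Sum>t\<in>S. v t * c t i * c (t - l) j * noise_product (l + int j - int i) (t - int i) w)" for w
      by (subst sum.reindex) (auto simp: inj_on_def)
    have "(\<Sum>s\<in>?S. (?b s)\<^sup>2) = (\<Sum>t\<in>S. (v t)\<^sup>2 * (c t i)\<^sup>2 * (c (t - l) j)\<^sup>2)"
      by (subst sum.reindex) (auto simp: inj_on_def power_mult_distrib)
    also have "\<dots> \<le> (\<Sum>t\<in>S. (v t)\<^sup>2 * (K * r ^ i)\<^sup>2 * (K * r ^ j)\<^sup>2)"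
      using c K r by (intro sum_mono mult_mono) (auto simp: abs_le_square_iff[symmetric] abs_mult)
    also have "\<dots> = ?V * ((K * r ^ i) * (K * r ^ j))\<^sup>2"
      unfolding sum_distrib_right by (intro sum.cong refl) (simp add: power_mult_distrib mult_ac)
    finally have "moment_le M (2 * k) (\<lambda>w. \<Sum>s\<in>?S. ?b s * noise_product (l + int j - int i) s w)
        (2 * sqrt (4 ^ k * B ^ (2 * k) * (?V * ((K * r ^ i) * (K * r ^ j))\<^sup>2)))"
      by (intro diagonal_sum_moment[OF k i _ B]) (use S in auto)
    moreover have "2 * sqrt (4 ^ k * B ^ (2 * k) * (?V * ((K * r ^ i) * (K * r ^ j))\<^sup>2))
        = ?c * sqrt ?V * (K * r ^ i) * (K * r ^ j)"
      using K r by (simp add: real_sqrt_mult abs_mult)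
    ultimately show ?thesis by (simp add: e)
  qed
  have geo: "(\<Sum>i<J. K * r ^ i) \<le> K / (1 - r)"
    using sum_le_suminf[of "\<lambda>n. r ^ n" "{..<J}"] r K
    by (simp add: suminf_geometric summable_geometric sum_distrib_left[symmetric] divide_inverse mult_left_mono)
  have "moment_le M (2 * k)
      (\<lambda>w. \<Sum>i<J. \<Sum>j<J. \<Sum>t\<in>S. v t * c t i * c (t - l) j * noise_product (l + int j - int i) (t - int i) w)
      (\<Sum>i<J. \<Sum>j<J. ?c * sqrt ?V * (K * r ^ i) * (K * r ^ j))"
    using k by (intro moment_le_sum inner) auto
  moreover have "(\<Sum>i<J. \<Sum>j<J. ?c * sqrt ?V * (K * r ^ i) * (K * r ^ j))
      \<le> ?c * (K / (1 - r))\<^sup>2 * sqrt ?V"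
  proof -
    have "(\<Sum>i<J. \<Sum>j<J. ?c * sqrt ?V * (K * r ^ i) * (K * r ^ j)) = (?c * sqrt ?V) * ((\<Sum>i<J. K * r ^ i) * (\<Sum>j<J. K * r ^ j))"
      unfolding sum_product unfolding sum_distrib_left by (simp only: mult.assoc)
    also have "\<dots> \<le> (?c * sqrt ?V) * ((K / (1 - r)) * (K / (1 - r)))"
      using K r B0 by (intro mult_left_mono mult_mono geo sum_nonneg mult_nonneg_nonneg) (auto intro: sum_nonneg)
    finally show ?thesis by (simp only: power2_eq_square mult_ac)
  qed
  ultimately show ?thesis by (rule moment_le_mono)
qed

text \<open>
  Dominated convergence, with the product of the two series of absolute values as the
  dominating function.
\<close>

lemma truncated_covariance_limit:
  assumes r: "0 \<le> r" "r < 1" and c: "\<And>j. \<bar>c j\<bar> \<le> K * r ^ j" and d: "\<And>j. \<bar>d j\<bar> \<le> K * r ^ j"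
  shows "(\<lambda>J. \<Sum>i<J. \<Sum>j<J. c i * d j * (if t - int i = s - int j then 1 else 0))
      \<longlonglongrightarrow> expectation (\<lambda>w. linear_filter c t w * linear_filter d s w)"
proof -
  let ?X = "\<lambda>c t J w. \<Sum>i<J. c i * \<xi> (t - int i) w"
  let ?G = "\<lambda>t w. \<Sum>i. (K * r ^ i) * \<bar>\<xi> (t - int i) w\<bar>"
  have K: "0 \<le> K" using c[of 0] by simp
  have G: "moment_le M 2 (?G t) (K * 1 / (1 - r))" for t
  proof (rule moment_le_suminf)
    show "moment_le M 2 (\<lambda>w. \<bar>\<xi> (t - int j) w\<bar>) 1" for j
      using noise_L2[of "t - int j"] by (simp add: moment_le_def)
    show "\<bar>K * r ^ j\<bar> \<le> K * r ^ j" for j using K r by simp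
  qed (use r in auto)
  have e: "expectation (\<lambda>w. ?X c t J w * ?X d s J w) = (\<Sum>i<J. \<Sum>j<J. c i * d j * (if t - int i = s - int j then 1 else 0))" for J
  proof -
    have "(\<lambda>w. ?X c t J w * ?X d s J w) = (\<lambda>w. \<Sum>i<J. \<Sum>j<J. c i * d j * (\<xi> (t - int i) w * \<xi> (s - int j) w))"
      by (simp add: fun_eq_iff sum_product mult_ac)
    then show ?thesis
      by (simp add: noise_orthogonal Bochner_Integration.integral_sum Bochner_Integration.integrable_sum)
  qed
  have dom: "\<bar>?X c t J w\<bar> \<le> ?G t w" if sm: "summable (\<lambda>j. r ^ j * \<bar>\<xi> (t - int j) w\<bar>)" and c: "\<And>j. \<bar>c j\<bar> \<le> K * r ^ j" for c t J w
  proof -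
    have s': "summable (\<lambda>j. (K * r ^ j) * \<bar>\<xi> (t - int j) w\<bar>)"
      using summable_mult[OF sm, of K] by (simp add: mult.assoc)
    have "\<bar>?X c t J w\<bar> \<le> (\<Sum>i<J. (K * r ^ i) * \<bar>\<xi> (t - int i) w\<bar>)"
      by (intro order_trans[OF sum_abs] sum_mono) (simp add: abs_mult mult_right_mono c)
    also have "\<dots> \<le> ?G t w" using K r by (intro sum_le_suminf s') auto
    finally show ?thesis .
  qed
  have "(\<lambda>J. expectation (\<lambda>w. ?X c t J w * ?X d s J w))
      \<longlonglongrightarrow> expectation (\<lambda>w. linear_filter c t w * linear_filter d s w)"
  proof (rule integral_dominated_convergence[where w = "\<lambda>w. ?G t w * ?G s w"])
    show "integrable M (\<lambda>w. ?G t w * ?G s w)" by (rule L2_product[OF G G])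
    show "AE w in M. (\<lambda>J. ?X c t J w * ?X d s J w) \<longlonglongrightarrow> linear_filter c t w * linear_filter d s w"
      using AE_noise_summable[OF r]
    proof eventually_elim
      case (elim w)
      show ?case unfolding linear_filter_def
        by (intro tendsto_mult summable_LIMSEQ filter_summable(1)[where K = K, OF elim[rule_format]] c d)
    qed
    fix J
    show "AE w in M. norm (?X c t J w * ?X d s J w) \<le> ?G t w * ?G s w"
      using AE_noise_summable[OF r]
    proof eventually_elim
      case (elim w)
      have 1: "\<bar>?X c t J w\<bar> \<le> ?G t w" and 2: "\<bar>?X d s J w\<bar> \<le> ?G s w"
        using dom[OF elim[rule_format] c] dom[OF elim[rule_format] d] by auto
      show ?case
        unfolding real_norm_def abs_mult using 1 by (intro mult_mono 1 2) auto
    qed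
  qed measurable
  then show ?thesis by (simp only: e)
qed

text \<open>
  The bound for truncated filters does not depend on the truncation, so it survives in the
  limit.
\<close>

lemma quadratic_form_moment:
  assumes k: "0 < k" and i: "integrable M (\<lambda>w. \<bar>\<xi> 0 w\<bar> ^ (4 * k))" and S: "finite S"
    and B: "B = 2 + 2 * expectation (\<lambda>w. \<bar>\<xi> 0 w\<bar> ^ (4 * k))"
    and r: "0 \<le> r" "r < 1" and c: "\<And>t j. \<bar>c t j\<bar> \<le> K * r ^ j"
  shows "moment_le M (2 * k)
      (\<lambda>w. \<Sum>t\<in>S. v t * (linear_filter (c t) t w * linear_filter (c (t - l)) (t - l) w
         - expectation (\<lambda>w. linear_filter (c t) t w * linear_filter (c (t - l)) (t - l) w)))
      (2 * sqrt (4 ^ k * B ^ (2 * k)) * (K / (1 - r))\<^sup>2 * sqrt (\<Sum>t\<in>S. (v t)\<^sup>2))"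
proof -
  let ?D = "\<lambda>J w. \<Sum>i<J. \<Sum>j<J. \<Sum>t\<in>S. v t * c t i * c (t - l) j * noise_product (l + int j - int i) (t - int i) w"
  let ?X = "\<lambda>t J w. \<Sum>i<J. c t i * \<xi> (t - int i) w"
  let ?e = "\<lambda>t J. \<Sum>i<J. \<Sum>j<J. c t i * c (t - l) j * (if t - int i = t - l - int j then 1 else 0)"
  have D: "?D J w = (\<Sum>t\<in>S. v t * (?X t J w * ?X (t - l) J w - ?e t J))" for J w
  proof -
    have "(\<Sum>t\<in>S. v t * (?X t J w * ?X (t - l) J w - ?e t J))
        = (\<Sum>t\<in>S. v t * (\<Sum>i<J. \<Sum>j<J. c t i * c (t - l) j * (\<xi> (t - int i) w * \<xi> (t - l - int j) w
             - (if t - int i = t - l - int j then 1 else 0))))"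
      by (simp add: sum_product right_diff_distrib sum_subtractf mult_ac)
    also have "\<dots> = (\<Sum>t\<in>S. \<Sum>i<J. \<Sum>j<J. v t * c t i * c (t - l) j * noise_product (l + int j - int i) (t - int i) w)"
      unfolding sum_distrib_left
    proof (intro sum.cong refl)
      fix t i j
      have "(t - int i = t - l - int j) = (l + int j - int i = 0)" by auto
      moreover have "t - int i - (l + int j - int i) = t - l - int j" by simp
      ultimately show "v t * (c t i * c (t - l) j * (\<xi> (t - int i) w * \<xi> (t - l - int j) w
             - (if t - int i = t - l - int j then 1 else 0)))
          = v t * c t i * c (t - l) j * noise_product (l + int j - int i) (t - int i) w"
        by (simp only: noise_product_def mult.assoc)
    qed
    also have "\<dots> = (\<Sum>i<J. \<Sum>t\<in>S. \<Sum>j<J. v t * c t i * c (t - l) j * noise_product (l + int j - int i) (t - int i) w)"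
      by (rule sum.swap)
    also have "\<dots> = ?D J w" by (intro sum.cong refl) (rule sum.swap)
    finally show ?thesis by simp
  qed
  show ?thesis
  proof (rule moment_le_Fatou[where Z = ?D])
    show "moment_le M (2 * k) (?D J) (2 * sqrt (4 ^ k * B ^ (2 * k)) * (K / (1 - r))\<^sup>2 * sqrt (\<Sum>t\<in>S. (v t)\<^sup>2))" for J
      by (rule double_sum_moment[OF k i S B r c])
    show "AE w in M. (\<lambda>J. ?D J w) \<longlonglongrightarrow> (\<Sum>t\<in>S. v t * (linear_filter (c t) t w * linear_filter (c (t - l)) (t - l) w
         - expectation (\<lambda>w. linear_filter (c t) t w * linear_filter (c (t - l)) (t - l) w)))"
      using AE_noise_summable[OF r]
    proof eventually_elim
      case (elim w)
      have X: "(\<lambda>J. ?X t J w) \<longlonglongrightarrow> linear_filter (c t) t w" for t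
        unfolding linear_filter_def by (intro summable_LIMSEQ filter_summable(1)[where K = K, OF elim[rule_format]] c)
      show ?case unfolding D
        by (intro tendsto_sum tendsto_mult tendsto_diff tendsto_const X truncated_covariance_limit[OF r c c])
    qed
  qed measurable
qed

end

section \<open>Uniqueness of the solution of the recursion\<close>

context white_noise
begin

text \<open>
  The first sum collects the forcing terms of the last \<open>m + 1\<close> times; the second the values
  from before that period which still enter the recursion during its first \<open>p\<close> steps.
\<close>

lemma recursion_iterate:
  fixes x :: "int \<Rightarrow> real" and a :: "int \<Rightarrow> nat \<Rightarrow> real"
  assumes rec: "\<And>t. x t = (\<Sum>j=1..p. a t j * x (t - int j)) + e t"
    and cut: "\<And>t j. p < j \<Longrightarrow> a t j = 0"
  shows "x t = (\<Sum>n\<le>m. green (\<lambda>k. a (t - int n + int k)) n * e (t - int n))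
     + (\<Sum>k\<le>m. green (\<lambda>i. a (t - int (m - k) + int i)) (m - k)
          * (\<Sum>j=k+1..p. a (t - int (m - k)) j * x (t - int (m - k) - int j)))"
proof -
  define t0 where "t0 = t - int m"
  define f where "f k = (\<Sum>j=k+1..p. a (t0 + int k) j * x (t0 + int k - int j)) + e (t0 + int k)" for k
  have "x (t0 + int k) = (\<Sum>i<k. a (t0 + int k) (k - i) * x (t0 + int i)) + f k" for k
  proof -
    have "(\<Sum>j=1..p. a (t0 + int k) j * x (t0 + int k - int j))
        = (\<Sum>j=1..max k p. a (t0 + int k) j * x (t0 + int k - int j))"
      by (rule sum.mono_neutral_left) (auto simp: cut)
    also have "{1..max k p} = {1..k} \<union> {k+1..max k p}" by auto
    also have "(\<Sum>j\<in>{1..k} \<union> {k+1..max k p}. a (t0 + int k) j * x (t0 + int k - int j))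
        = (\<Sum>j=1..k. a (t0 + int k) j * x (t0 + int k - int j))
          + (\<Sum>j=k+1..max k p. a (t0 + int k) j * x (t0 + int k - int j))"
      by (rule sum.union_disjoint) auto
    also have "(\<Sum>j=1..k. a (t0 + int k) j * x (t0 + int k - int j))
        = (\<Sum>i<k. a (t0 + int k) (k - i) * x (t0 + int i))"
      by (rule sum.reindex_bij_witness[where i = "\<lambda>i. k - i" and j = "\<lambda>i. k - i"])
         (auto simp: add_diff_eq)
    also have "(\<Sum>j=k+1..max k p. a (t0 + int k) j * x (t0 + int k - int j))
        = (\<Sum>j=k+1..p. a (t0 + int k) j * x (t0 + int k - int j))"
      by (rule sum.mono_neutral_right) (auto simp: cut)
    finally show ?thesis using rec[of "t0 + int k"] by (simp add: f_def)
  qed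
  then have "x (t0 + int m) = (\<Sum>k\<le>m. green (\<lambda>i. a (t0 + int (k + i))) (m - k) * f k)"
    by (rule variation_of_constants[where x = "\<lambda>k. x (t0 + int k)" and b = "\<lambda>k. a (t0 + int k)"])
  then have 1: "x t = (\<Sum>k\<le>m. green (\<lambda>i. a (t0 + int (k + i))) (m - k) * e (t0 + int k))
      + (\<Sum>k\<le>m. green (\<lambda>i. a (t0 + int (k + i))) (m - k) * (\<Sum>j=k+1..p. a (t0 + int k) j * x (t0 + int k - int j)))"
    by (simp add: t0_def f_def distrib_left sum.distrib)
  have "(\<Sum>k\<le>m. green (\<lambda>i. a (t0 + int (k + i))) (m - k) * e (t0 + int k))
      = (\<Sum>n\<le>m. green (\<lambda>k. a (t - int n + int k)) n * e (t - int n))"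
    by (rule sum.reindex_bij_witness[where i = "\<lambda>k. m - k" and j = "\<lambda>k. m - k"])
       (auto simp: t0_def of_nat_diff algebra_simps)
  moreover have "(\<Sum>k\<le>m. green (\<lambda>i. a (t0 + int (k + i))) (m - k) * (\<Sum>j=k+1..p. a (t0 + int k) j * x (t0 + int k - int j)))
      = (\<Sum>k\<le>m. green (\<lambda>i. a (t - int (m - k) + int i)) (m - k)
          * (\<Sum>j=k+1..p. a (t - int (m - k)) j * x (t - int (m - k) - int j)))"
    by (intro sum.cong refl) (auto simp: t0_def of_nat_diff algebra_simps)
  ultimately show ?thesis using 1 by simp
qed

lemma boundary_term_bound:
  fixes x :: "int \<Rightarrow> real" and a :: "int \<Rightarrow> nat \<Rightarrow> real"
  assumes G: "\<And>t n. \<bar>green (\<lambda>k. a (t - int n + int k)) n\<bar> \<le> K * r ^ n" and r: "0 < r" "r < 1"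
    and a: "\<And>t j. \<bar>a t j\<bar> \<le> L" and pm: "p \<le> m"
    and x: "\<And>k j. k < p \<Longrightarrow> j \<in> {1..p} \<Longrightarrow> \<bar>x (t - int (m - k) - int j)\<bar> \<le> B"
  shows "\<bar>\<Sum>k\<le>m. green (\<lambda>i. a (t - int (m - k) + int i)) (m - k)
          * (\<Sum>j=k+1..p. a (t - int (m - k)) j * x (t - int (m - k) - int j))\<bar>
      \<le> real p * (real p * (K * L * B * r ^ (m - p)))"
proof -
  have K: "0 \<le> K" using G[of 0 0] by simp
  have L: "0 \<le> L" using a[of 0 0] by linarith
  let ?R = "\<lambda>k. (\<Sum>j=k+1..p. a (t - int (m - k)) j * x (t - int (m - k) - int j))"
  have "(\<Sum>k\<le>m. green (\<lambda>i. a (t - int (m - k) + int i)) (m - k) * ?R k)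
      = (\<Sum>k<p. green (\<lambda>i. a (t - int (m - k) + int i)) (m - k) * ?R k)"
    by (rule sum.mono_neutral_right) (use pm in auto)
  also have "\<bar>\<dots>\<bar> \<le> (\<Sum>k<p. real p * (K * L * B * r ^ (m - p)))"
  proof (intro order_trans[OF sum_abs] sum_mono)
    fix k assume "k \<in> {..<p}"
    then have k: "k < p" by simp
    have B: "0 \<le> B" using x[OF k, of p] k by (intro order_trans[OF abs_ge_zero]) auto
    have "\<bar>?R k\<bar> \<le> (\<Sum>j=k+1..p. L * B)"
      unfolding abs_mult[symmetric] using k
      by (intro order_trans[OF sum_abs] sum_mono) (auto simp: abs_mult intro!: mult_mono a x L)
    also have "\<dots> \<le> real p * (L * B)"
      using L B k by (simp add: mult_right_mono)
    finally have R: "\<bar>?R k\<bar> \<le> real p * (L * B)" .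
    have "K * r ^ (m - k) \<le> K * r ^ (m - p)"
      using K r k by (intro mult_left_mono power_decreasing) auto
    then have "\<bar>green (\<lambda>i. a (t - int (m - k) + int i)) (m - k)\<bar> \<le> K * r ^ (m - p)"
      using G[of t "m - k"] by linarith
    then have "\<bar>green (\<lambda>i. a (t - int (m - k) + int i)) (m - k)\<bar> * \<bar>?R k\<bar> \<le> (K * r ^ (m - p)) * (real p * (L * B))"
      using K r by (intro mult_mono R) auto
    then show "\<bar>green (\<lambda>i. a (t - int (m - k) + int i)) (m - k) * ?R k\<bar> \<le> real p * (K * L * B * r ^ (m - p))"
      by (simp add: abs_mult mult_ac)
  qed
  finally show ?thesis by simp
qed

text \<open>
  The partial sums \<open>Sm\<close> of the filter converge almost surely. Their distance to \<open>X t\<close> is the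
  boundary term, which tends to 0 in probability, and the mean of the distance truncated at 1
  detects both facts at once.
\<close>

lemma recursion_solution_unique:
  fixes X :: "int \<Rightarrow> 'w \<Rightarrow> real" and a :: "int \<Rightarrow> nat \<Rightarrow> real" and s :: "int \<Rightarrow> real"
  assumes X [measurable]: "\<And>t. X t \<in> borel_measurable M"
    and rec: "\<And>t. AE w in M. X t w = (\<Sum>j=1..p. a t j * X (t - int j) w) + s t * \<xi> t w"
    and bounded: "bounded_in_prob_at_minus_inf M X"
    and cut: "\<And>t j. p < j \<Longrightarrow> a t j = 0" and a: "\<And>t j. \<bar>a t j\<bar> \<le> L" and s: "\<And>t. \<bar>s t\<bar> \<le> S"
    and G: "\<And>t n. \<bar>green (\<lambda>k. a (t - int n + int k)) n\<bar> \<le> K * r ^ n" and r: "0 < r" "r < 1"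
  shows "AE w in M. X t w = linear_filter (\<lambda>n. green (\<lambda>k. a (t - int n + int k)) n * s (t - int n)) t w"
proof -
  define c where "c n = green (\<lambda>k. a (t - int n + int k)) n * s (t - int n)" for n
  define Sm where "Sm m w = (\<Sum>n\<le>m. c n * \<xi> (t - int n) w)" for m w
  have [measurable]: "Sm m \<in> borel_measurable M" for m unfolding Sm_def by measurable
  have K: "0 \<le> K" using G[of 0 0] by simp
  have c: "\<bar>c n\<bar> \<le> (K * S) * r ^ n" for n
  proof -
    have "\<bar>c n\<bar> \<le> (K * r ^ n) * S"
      unfolding c_def abs_mult using K r by (intro mult_mono G s) auto
    then show ?thesis by (simp add: mult_ac)
  qed
  have "AE w in M. \<forall>t. X t w = (\<Sum>j=1..p. a t j * X (t - int j) w) + s t * \<xi> t w"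
    unfolding AE_all_countable using rec by blast
  then have iter: "AE w in M. \<forall>m. X t w = Sm m w
      + (\<Sum>k\<le>m. green (\<lambda>i. a (t - int (m - k) + int i)) (m - k)
          * (\<Sum>j=k+1..p. a (t - int (m - k)) j * X (t - int (m - k) - int j) w))"
  proof eventually_elim
    case (elim w)
    show ?case
    proof
      fix m
      show "X t w = Sm m w
      + (\<Sum>k\<le>m. green (\<lambda>i. a (t - int (m - k) + int i)) (m - k)
          * (\<Sum>j=k+1..p. a (t - int (m - k)) j * X (t - int (m - k) - int j) w))"
        unfolding Sm_def c_def mult.assoc
        by (rule recursion_iterate[where x = "\<lambda>t. X t w" and e = "\<lambda>t. s t * \<xi> t w", OF elim[rule_format] cut])
    qed
  qed
  let ?d = "\<lambda>m w. min 1 \<bar>X t w - Sm m w\<bar>"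
  let ?Y = "linear_filter c t"
  have lim: "(\<lambda>m. expectation (?d m)) \<longlonglongrightarrow> expectation (\<lambda>w. min 1 \<bar>X t w - ?Y w\<bar>)"
  proof (rule integral_dominated_convergence[where w = "\<lambda>_. 1"])
    show "AE w in M. (\<lambda>m. ?d m w) \<longlonglongrightarrow> min 1 \<bar>X t w - ?Y w\<bar>"
      using AE_noise_summable[OF less_imp_le[OF r(1)] r(2)]
    proof eventually_elim
      case (elim w)
      have "(\<lambda>m. Sm m w) \<longlonglongrightarrow> ?Y w"
        unfolding Sm_def linear_filter_def
        by (rule summable_LIMSEQ') (rule filter_summable(1)[OF elim[rule_format, of t] c])
      then show ?case by (intro tendsto_intros)
    qed
  qed auto
  have small: "\<exists>m0. \<forall>m\<ge>m0. expectation (?d m) \<le> e" if e: "0 < e" for e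
  proof -
    \<comment> \<open>At most \<open>p * p\<close> values of the process occur in the boundary term, each large with probability at most \<open>e'\<close>.\<close>
    define e' where "e' = e / (2 * (1 + real p * real p))"
    have pp: "0 < 2 * (1 + real p * real p)" by (simp add: add_pos_nonneg)
    have e': "0 < e'" unfolding e'_def using e pp by simp
    have "e' * (2 * (1 + real p * real p)) = e" unfolding e'_def using pp by simp
    then have "2 * (real p * real p * e') + 2 * e' = e" by (simp add: algebra_simps)
    then have pe: "real p * real p * e' \<le> e / 2" using e' by linarith
    obtain B0 t1 where B0: "\<And>t. t \<le> t1 \<Longrightarrow> prob {w \<in> space M. B0 < \<bar>X t w\<bar>} \<le> e'"
      using bounded e' unfolding bounded_in_prob_at_minus_inf_def by blast
    define B where "B = \<bar>B0\<bar>"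
    have B: "prob {w \<in> space M. B < \<bar>X t w\<bar>} \<le> e'" if "t \<le> t1" for t
    proof -
      have "prob {w \<in> space M. B < \<bar>X t w\<bar>} \<le> prob {w \<in> space M. B0 < \<bar>X t w\<bar>}"
        by (rule finite_measure_mono) (auto simp: B_def)
      then show ?thesis using B0[OF that] by linarith
    qed
    have "(\<lambda>n. real p * (real p * (K * L * B * r ^ n))) \<longlonglongrightarrow> real p * (real p * (K * L * B * 0))"
      using r by (intro tendsto_intros LIMSEQ_power_zero) auto
    then have "\<forall>\<^sub>F n in sequentially. real p * (real p * (K * L * B * r ^ n)) < e / 2"
      using e by (intro order_tendstoD(2)) auto
    then obtain n0 where n0: "\<And>n. n0 \<le> n \<Longrightarrow> real p * (real p * (K * L * B * r ^ n)) < e / 2"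
      unfolding eventually_sequentially by blast
    \<comment> \<open>So far back that all boundary values lie before \<open>t1\<close> and are multiplied by a small enough power of \<open>r\<close>.\<close>
    define m0 where "m0 = p + n0 + nat (t + int p - t1)"
    have "expectation (?d m) \<le> e" if m: "m0 \<le> m" for m
    proof -
      let ?I = "\<lambda>k j. {w \<in> space M. B < \<bar>X (t - int (m - k) - int j) w\<bar>}"
      let ?g = "\<lambda>w. e / 2 + (\<Sum>k<p. \<Sum>j=1..p. indicator (?I k j) w :: real)"
      have "AE w in M. ?d m w \<le> ?g w"
        using iter AE_space
      proof eventually_elim
        case (elim w)
        have nn: "0 \<le> (\<Sum>k<p. \<Sum>j=1..p. indicator (?I k j) w :: real)" by (intro sum_nonneg) auto
        show ?case
        proof (cases "\<exists>k<p. \<exists>j\<in>{1..p}. w \<in> ?I k j")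
          case True
          then obtain k j where kj: "k < p" "j \<in> {1..p}" "w \<in> ?I k j" by blast
          have "1 = (indicator (?I k j) w :: real)" using kj by simp
          also have "\<dots> \<le> (\<Sum>j=1..p. indicator (?I k j) w)"
            by (rule member_le_sum[of j _ "\<lambda>j. indicator (?I k j) w"]) (use kj in auto)
          also have "\<dots> \<le> (\<Sum>k<p. \<Sum>j=1..p. indicator (?I k j) w)"
            by (rule member_le_sum[of k _ "\<lambda>k. \<Sum>j=1..p. indicator (?I k j) w"]) (use kj in \<open>auto intro: sum_nonneg\<close>)
          finally show ?thesis using e by linarith
        next
          case False
          have "\<bar>X t w - Sm m w\<bar> \<le> real p * (real p * (K * L * B * r ^ (m - p)))"
          proof -
            have "\<bar>X (t - int (m - k) - int j) w\<bar> \<le> B" if "k < p" "j \<in> {1..p}" for k j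
            proof (rule ccontr)
              assume "\<not> \<bar>X (t - int (m - k) - int j) w\<bar> \<le> B"
              then have "w \<in> ?I k j" using elim(2) by simp
              with False that show False by blast
            qed
            note b = boundary_term_bound[where x = "\<lambda>t. X t w" and m = m and p = p, OF G r a _ this]
            have "p \<le> m" using m by (simp add: m0_def)
            from b[OF this] show ?thesis using elim(1)[rule_format, of m] by linarith
          qed
          also have "\<dots> < e / 2" by (rule n0) (use m in \<open>simp add: m0_def\<close>)
          finally show ?thesis using nn by linarith
        qed
      qed
      moreover have ig: "integrable M ?g"
        by (intro Bochner_Integration.integrable_add Bochner_Integration.integrable_sum integrable_const)
           (auto simp: integrable_indicator_iff emeasure_eq_measure)
      moreover have "integrable M (?d m)"
        by (rule integrable_const_bound[where B = 1]) auto
      ultimately have "expectation (?d m) \<le> expectation ?g" by (intro integral_mono_AE) auto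
      also have "\<dots> = e / 2 + (\<Sum>k<p. \<Sum>j=1..p. prob (?I k j))"
        by (subst Bochner_Integration.integral_add)
           (auto simp: Bochner_Integration.integral_sum prob_space integrable_indicator_iff emeasure_eq_measure
              intro!: Bochner_Integration.integrable_sum)
      also have "\<dots> \<le> e / 2 + (\<Sum>k<p. \<Sum>j=1..p. e')"
      proof (intro add_left_mono sum_mono)
        fix k j assume "k \<in> {..<p}" "j \<in> {1..p}"
        then have "t - int (m - k) - int j \<le> t1"
          using m by (auto simp: m0_def of_nat_diff)
        then show "prob (?I k j) \<le> e'" by (rule B)
      qed
      also have "\<dots> = e / 2 + real p * real p * e'" by simp
      finally show ?thesis using pe by linarith
    qed
    then show ?thesis by blast
  qed
  have "expectation (\<lambda>w. min 1 \<bar>X t w - ?Y w\<bar>) \<le> 0 + e" if "0 < e" for e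
    using small[OF that] by (intro LIMSEQ_le_const2[OF lim]) auto
  then have "expectation (\<lambda>w. min 1 \<bar>X t w - ?Y w\<bar>) \<le> 0" by (rule field_le_epsilon)
  moreover have "0 \<le> expectation (\<lambda>w. min 1 \<bar>X t w - ?Y w\<bar>)" by (intro integral_nonneg_AE) auto
  ultimately have "expectation (\<lambda>w. min 1 \<bar>X t w - ?Y w\<bar>) = 0" by simp
  moreover have "integrable M (\<lambda>w. min 1 \<bar>X t w - ?Y w\<bar>)"
    by (rule integrable_const_bound[where B = 1]) auto
  ultimately have "AE w in M. min 1 \<bar>X t w - ?Y w\<bar> = 0"
    by (subst (asm) integral_nonneg_eq_0_iff_AE) auto
  then show ?thesis unfolding c_def[abs_def, symmetric] by eventually_elim (auto simp: min_def split: if_splits)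
qed

end

section \<open>Estimates uniform over the parameter class\<close>

lemma abs_int_powr_le:
  assumes "0 < \<alpha>" "\<alpha> \<le> 1"
  shows "\<bar>real_of_int n\<bar> powr \<alpha> \<le> \<bar>real_of_int n\<bar>"
proof (cases "n = 0")
  case False
  then have "1 \<le> \<bar>real_of_int n\<bar>" by linarith
  then show ?thesis using powr_mono[of \<alpha> 1 "\<bar>real_of_int n\<bar>"] assms by simp
qed simp

text \<open>
  Between integer times a Hoelder condition of order \<open>min 1 \<beta>\<close> is weakened to a linear bound,
  which is the form of drift that \<open>perturbation_bound\<close> expects.
\<close>

lemma holder_class_on_grid:
  assumes \<beta>: "0 < \<beta>" "k = nat (\<lceil>\<beta>\<rceil> - 1)" and f: "holder_class k (\<beta> - real k) R f" and T: "0 < T"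
  shows "\<bar>f (real_of_int a / real T) - f (real_of_int b / real T)\<bar>
           \<le> 2 * R * real T powr (- min 1 \<beta>) * \<bar>real_of_int (a - b)\<bar>"
proof -
  have R: "0 \<le> R" using f holder_class_nonneg by blast
  have "real_of_int a / real T - real_of_int b / real T = real_of_int (a - b) / real T"
    by (simp add: diff_divide_distrib)
  then have "\<bar>real_of_int a / real T - real_of_int b / real T\<bar> = \<bar>real_of_int (a - b)\<bar> / real T"
    by (simp only: abs_divide abs_of_nat)
  then have "\<bar>real_of_int a / real T - real_of_int b / real T\<bar> powr min 1 \<beta>
      = \<bar>real_of_int (a - b)\<bar> powr min 1 \<beta> / real T powr min 1 \<beta>"
    by (simp only: powr_divide)
  also have "\<dots> = \<bar>real_of_int (a - b)\<bar> powr min 1 \<beta> * real T powr (- min 1 \<beta>)"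
    by (simp only: powr_minus divide_inverse)
  also have "\<dots> \<le> \<bar>real_of_int (a - b)\<bar> * real T powr (- min 1 \<beta>)"
    using \<beta>(1) by (intro mult_right_mono abs_int_powr_le) auto
  finally have "2 * R * \<bar>real_of_int a / real T - real_of_int b / real T\<bar> powr min 1 \<beta>
      \<le> 2 * R * (\<bar>real_of_int (a - b)\<bar> * real T powr (- min 1 \<beta>))"
    using R by (intro mult_left_mono) auto
  with holder_class_holder_continuous[OF \<beta> f, of "real_of_int a / real T" "real_of_int b / real T"]
  show ?thesis by (simp only: mult_ac)
qed

text \<open>
  The response at time \<open>t\<close> to a unit impulse \<open>n\<close> steps earlier.
\<close>

definition tvar_green :: "nat \<Rightarrow> (real \<Rightarrow> nat \<Rightarrow> real) \<Rightarrow> nat \<Rightarrow> int \<Rightarrow> nat \<Rightarrow> real" where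
  "tvar_green p \<theta> T t n = green (\<lambda>k. lag_cut p (\<theta> (real_of_int (t - int n + int k) / real T))) n"

abbreviation frozen_green :: "nat \<Rightarrow> (nat \<Rightarrow> real) \<Rightarrow> nat \<Rightarrow> real" where
  "frozen_green p \<theta> \<equiv> green (\<lambda>_. lag_cut p \<theta>)"

lemma lag_cut_on_grid:
  assumes \<beta>: "0 < \<beta>" and \<theta>: "\<theta> \<in> holder_ball p \<beta> R" and T: "0 < T" and R: "0 \<le> R"
  shows "\<bar>lag_cut p (\<theta> (real_of_int a / real T)) j - lag_cut p (\<theta> (real_of_int b / real T)) j\<bar>
           \<le> 2 * R * real T powr (- min 1 \<beta>) * \<bar>real_of_int (a - b)\<bar>"
proof (cases "j \<in> {1..p}")
  case True
  from holder_class_on_grid[OF \<beta> refl holder_ball_imp_holder_class[OF \<theta> refl True] T, of a b] True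
  show ?thesis by (simp add: lag_cut_def)
next
  case False
  then show ?thesis using R by (auto simp: lag_cut_def)
qed

text \<open>
  The decay of the frozen response is governed by \<open>\<delta>\<close> and \<open>p\<close>, and the drift of the coefficients
  by \<open>R0\<close> and \<open>\<beta>\<close>. This is why all constants, \<open>T0\<close> included, can be chosen before \<open>\<theta>\<close>.
\<close>

lemma tvar_green_uniform:
  fixes p :: nat and \<delta> \<beta> R0 :: real
  assumes \<delta>: "0 < \<delta>" "\<delta> < 1" and \<beta>: "0 < \<beta>" and R0: "0 < R0"
  shows "\<exists>r K C T0. 0 < r \<and> r < 1 \<and> 0 \<le> K \<and> 0 \<le> C \<and> (1::nat) \<le> T0 \<and>
     (\<forall>\<theta>\<in>holder_ball p \<beta> R0 \<inter> stable_set p \<delta>. \<forall>T\<ge>T0.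
        (\<forall>u n. \<bar>frozen_green p (\<theta> u) n\<bar> \<le> K * r ^ n)
        \<and> (\<forall>t n. \<bar>tvar_green p \<theta> T t n\<bar> \<le> K * r ^ n)
        \<and> (\<forall>t t0 n. \<bar>tvar_green p \<theta> T t n - frozen_green p (\<theta> (real_of_int t0 / real T)) n\<bar>
             \<le> C * real T powr (- min 1 \<beta>) * (1 + \<bar>real_of_int (t - t0)\<bar>) * r ^ n))"
proof -
  \<comment> \<open>Two rates strictly between \<open>\<delta>\<close> and 1: one for the frozen, one for the time varying response.\<close>
  define r0 where "r0 = (2 * \<delta> + 1) / 3"
  define r where "r = (\<delta> + 2) / 3"
  have r: "\<delta> < r0" "0 < r0" "r0 < r" "r < 1" using \<delta> by (auto simp: r0_def r_def)
  define K0 where "K0 = (1 / (1 - \<delta> / r0)) ^ p"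
  have K0: "0 \<le> K0" unfolding K0_def using r \<delta> by (intro zero_le_power) (simp add: field_simps)
  define W where "W = K0 * (2 * K0) * real p * (1 / r) ^ p / (1 - r0 / r)\<^sup>2"
  define A where "A = 2 * K0 * real p * (1 / r) ^ p / (1 - r0 / r)\<^sup>2 * (2 * R0)"
  have W0: "0 \<le> W" and A0: "0 \<le> A" unfolding W_def A_def using K0 r R0 by auto
  define \<alpha> where "\<alpha> = min 1 \<beta>"
  have \<alpha>: "0 < \<alpha>" "\<alpha> \<le> 1" using \<beta> by (auto simp: \<alpha>_def)
  \<comment> \<open>Large enough for the smallness condition of \<open>green_decay\<close>, with drift \<open>\<epsilon>\<close> per unit of time.\<close>
  define T0 where "T0 = nat \<lceil>A powr (1 / \<alpha>)\<rceil> + 1"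
  show ?thesis
  proof (rule exI[of _ r], rule exI[of _ "2 * K0"], rule exI[of _ "W * (2 * R0)"], rule exI[of _ T0],
      intro conjI ballI allI impI)
    show "0 < r" "r < 1" "0 \<le> 2 * K0" "0 \<le> W * (2 * R0)" "1 \<le> T0"
      using r K0 W0 R0 by (auto simp: T0_def)
    fix \<theta> T assume "\<theta> \<in> holder_ball p \<beta> R0 \<inter> stable_set p \<delta>" and T: "T0 \<le> T"
    then have \<theta>: "\<theta> \<in> holder_ball p \<beta> R0" "\<theta> \<in> stable_set p \<delta>" by auto
    have T1: "0 < T" using T by (simp add: T0_def)
    define \<epsilon> where "\<epsilon> = 2 * R0 * real T powr (- min 1 \<beta>)"
    have \<epsilon>0: "0 \<le> \<epsilon>" unfolding \<epsilon>_def using R0 by simp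
    have psi: "\<bar>frozen_green p (\<theta> u) n\<bar> \<le> K0 * r0 ^ n" for u n
      unfolding K0_def by (rule green_stable_decay[OF \<delta>(1) r(1) \<theta>(2)])
    have "K0 * r0 ^ n \<le> 2 * K0 * r ^ n" for n
    proof -
      have "K0 * r0 ^ n \<le> (2 * K0) * r ^ n"
        using K0 r by (intro mult_mono power_mono) auto
      then show ?thesis by simp
    qed
    then show "\<bar>frozen_green p (\<theta> u) n\<bar> \<le> 2 * K0 * r ^ n" for u n
      using psi[of u n] by (rule order_trans[rotated])
    have "A \<le> real T powr \<alpha>"
    proof -
      have "A powr (1 / \<alpha>) \<le> real T" using T unfolding T0_def by linarith
      then have "(A powr (1 / \<alpha>)) powr \<alpha> \<le> real T powr \<alpha>" using \<alpha> by (intro powr_mono2) auto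
      then show ?thesis using A0 \<alpha> by (simp add: powr_powr)
    qed
    then have "A * real T powr (- \<alpha>) \<le> real T powr \<alpha> * real T powr (- \<alpha>)" by (rule mult_right_mono) simp
    also have "\<dots> = 1" using T1 by (simp add: powr_add[symmetric])
    also have "A * real T powr (- \<alpha>) = 2 * K0 * real p * (1 / r) ^ p / (1 - r0 / r)\<^sup>2 * \<epsilon>"
      unfolding A_def \<epsilon>_def \<alpha>_def by (simp only: mult.assoc)
    finally have small: "2 * K0 * real p * (1 / r) ^ p / (1 - r0 / r)\<^sup>2 * \<epsilon> \<le> 1" .
    let ?b = "\<lambda>t n k. lag_cut p (\<theta> (real_of_int (t - int n + int k) / real T))"
    have cut: "lag_cut p x j = 0" if "p < j" for x j using that by (simp add: lag_cut_def)
    have grid: "\<bar>lag_cut p (\<theta> (real_of_int a / real T)) j - lag_cut p (\<theta> (real_of_int b / real T)) j\<bar>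
        \<le> \<epsilon> * \<bar>real_of_int (a - b)\<bar>" for a b j
      unfolding \<epsilon>_def by (rule lag_cut_on_grid[OF \<beta> \<theta>(1) T1 less_imp_le[OF R0]])
    have decay: "\<bar>green (?b t n) m\<bar> \<le> 2 * K0 * r ^ m" for t n m
    proof (rule green_decay[where p = p and \<epsilon> = \<epsilon>])
      fix m n' j assume "n' \<le> (m::nat)"
      then have "\<bar>real_of_int ((t - int n + int n') - (t - int n + int m))\<bar> = real (m - n')" by simp
      then show "\<bar>?b t n n' j - ?b t n m j\<bar> \<le> \<epsilon> * real (m - n')"
        using grid[of "t - int n + int n'" j "t - int n + int m"] by simp
    qed (use r K0 \<epsilon>0 psi cut small in auto)
    then show "\<bar>tvar_green p \<theta> T t n\<bar> \<le> 2 * K0 * r ^ n" for t n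
      by (simp add: tvar_green_def)
    fix t t0 n
    have "\<bar>green (?b t n) n - frozen_green p (\<theta> (real_of_int t0 / real T)) n\<bar>
        \<le> K0 * (2 * K0) * real p * (1 / r) ^ p / (1 - r0 / r)\<^sup>2 * \<epsilon> * (1 + \<bar>real_of_int (t - t0)\<bar>) * r ^ n"
    proof (rule perturbation_bound)
      fix n' j assume n': "n' \<le> n"
      have "\<bar>real_of_int ((t - int n + int n') - t0)\<bar> \<le> \<bar>real_of_int (t - t0)\<bar> + real (n - n')"
        using n' by (simp add: of_nat_diff)
      then have "\<epsilon> * \<bar>real_of_int ((t - int n + int n') - t0)\<bar> \<le> \<epsilon> * (\<bar>real_of_int (t - t0)\<bar> + real (n - n'))"
        using \<epsilon>0 by (rule mult_left_mono)
      then show "\<bar>?b t n n' j - lag_cut p (\<theta> (real_of_int t0 / real T)) j\<bar> \<le> \<epsilon> * (\<bar>real_of_int (t - t0)\<bar> + real (n - n'))"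
        using grid[of "t - int n + int n'" j t0] by linarith
    qed (use r K0 \<epsilon>0 psi decay cut in auto)
    then show "\<bar>tvar_green p \<theta> T t n - frozen_green p (\<theta> (real_of_int t0 / real T)) n\<bar>
        \<le> W * (2 * R0) * real T powr (- min 1 \<beta>) * (1 + \<bar>real_of_int (t - t0)\<bar>) * r ^ n"
      by (simp add: tvar_green_def W_def \<epsilon>_def mult_ac)
  qed
qed

section \<open>The local spectral density and its Fourier coefficients\<close>

lemma ar_poly_unit_circle:
  "(cmod (ar_poly p \<theta> (exp (- \<i> * complex_of_real x)) u))\<^sup>2
     = (1 - (\<Sum>j=1..p. cos (real j * x) * \<theta> u j))\<^sup>2 + (\<Sum>j=1..p. sin (real j * x) * \<theta> u j)\<^sup>2"
proof -
  have e: "exp (- \<i> * complex_of_real x) ^ j = cis (- (real j * x))" for j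
    by (simp add: exp_of_nat_mult[symmetric] cis_conv_exp mult_ac)
  have "Re (ar_poly p \<theta> (exp (- \<i> * complex_of_real x)) u) = 1 - (\<Sum>j=1..p. cos (real j * x) * \<theta> u j)"
    "Im (ar_poly p \<theta> (exp (- \<i> * complex_of_real x)) u) = (\<Sum>j=1..p. sin (real j * x) * \<theta> u j)"
    unfolding ar_poly_def e by (simp_all add: sum_negf[symmetric] mult.commute)
  then show ?thesis by (simp add: cmod_power2)
qed

lemma norm_exp_minus_ii [simp]: "cmod (exp (- \<i> * complex_of_real x)) = 1"
  using norm_exp_i_times[of "- x"] by simp

lemma spectral_density_eq:
  "tvar_spectral_density p \<theta> \<sigma> u x = 1 / (2 * pi) * ((\<sigma> u * \<sigma> u) * inverse
     ((1 - (\<Sum>j=1..p. cos (real j * x) * \<theta> u j)) * (1 - (\<Sum>j=1..p. cos (real j * x) * \<theta> u j))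
      + (\<Sum>j=1..p. sin (real j * x) * \<theta> u j) * (\<Sum>j=1..p. sin (real j * x) * \<theta> u j)))"
  using ar_poly_unit_circle[of p \<theta> x u]
  by (simp add: tvar_spectral_density_def power_int_minus power2_eq_square)

text \<open>
  The density is a fixed rational expression in \<open>\<sigma>\<close> and the components of \<open>\<theta>\<close>, whose
  coefficients \<open>cos (j x)\<close> and \<open>sin (j x)\<close> are bounded uniformly in \<open>x\<close>.
\<close>

lemma spectral_density_holder:
  assumes \<delta>: "0 < \<delta>" "\<delta> < 1" and \<beta>: "0 < \<beta>"
  shows "\<exists>R. \<forall>\<rho> \<theta> \<sigma> x. (\<theta>, \<sigma>) \<in> tvar_class p \<beta> R0 \<delta> \<rho> \<sigma>p
           \<longrightarrow> (\<lambda>u _. tvar_spectral_density p \<theta> \<sigma> u x) \<in> holder_ball 1 \<beta> R"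
proof -
  define k where "k = nat (\<lceil>\<beta>\<rceil> - 1)"
  define \<alpha> where "\<alpha> = \<beta> - real k"
  have \<alpha>: "0 < \<alpha>" "\<alpha> \<le> 1" using holder_order[OF \<beta> k_def] by (auto simp: \<alpha>_def)
  define Ra where "Ra = 1 + 1 * (real p * (1 * R0))"
  obtain Q1 where Q1: "\<And>f g. holder_class k \<alpha> Ra f \<Longrightarrow> holder_class k \<alpha> Ra g \<Longrightarrow> holder_class k \<alpha> Q1 (\<lambda>x. f x * g x)"
    using holder_class_mult[OF \<alpha>, of k Ra Ra] by blast
  have c: "0 < ((1 - \<delta>) ^ p)\<^sup>2" using \<delta> by simp
  obtain Q2 where Q2: "\<And>g. holder_class k \<alpha> (Q1 + Q1) g \<Longrightarrow> (\<And>x. ((1 - \<delta>) ^ p)\<^sup>2 \<le> g x) \<Longrightarrow> holder_class k \<alpha> Q2 (\<lambda>x. inverse (g x))"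
    using holder_class_inverse[OF \<alpha> c, of k "Q1 + Q1"] by blast
  obtain Q3 where Q3: "\<And>f g. holder_class k \<alpha> R0 f \<Longrightarrow> holder_class k \<alpha> R0 g \<Longrightarrow> holder_class k \<alpha> Q3 (\<lambda>x. f x * g x)"
    using holder_class_mult[OF \<alpha>, of k R0 R0] by blast
  obtain Q4 where Q4: "\<And>f g. holder_class k \<alpha> Q3 f \<Longrightarrow> holder_class k \<alpha> Q2 g \<Longrightarrow> holder_class k \<alpha> Q4 (\<lambda>x. f x * g x)"
    using holder_class_mult[OF \<alpha>, of k Q3 Q2] by blast
  show ?thesis
  proof (intro exI[of _ "2 * (1 / (2 * pi) * Q4)"] allI impI)
    fix \<rho> \<theta> \<sigma> x assume tc: "(\<theta>, \<sigma>) \<in> tvar_class p \<beta> R0 \<delta> \<rho> \<sigma>p"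
    then have \<theta>: "\<theta> \<in> holder_ball p \<beta> R0" "\<theta> \<in> stable_set p \<delta>" and \<sigma>: "(\<lambda>u _. \<sigma> u) \<in> holder_ball 1 \<beta> R0"
      by (auto simp: tvar_class_def)
    have h\<sigma>: "holder_class k \<alpha> R0 \<sigma>"
      using holder_ball_imp_holder_class[OF \<sigma> k_def, of 1] by (simp add: \<alpha>_def)
    have h\<theta>: "holder_class k \<alpha> R0 (\<lambda>u. \<theta> u j)" if "j \<in> {1..p}" for j
      unfolding \<alpha>_def by (rule holder_ball_imp_holder_class[OF \<theta>(1) k_def that])
    have hsum: "holder_class k \<alpha> (real p * (1 * R0)) (\<lambda>u. \<Sum>j=1..p. w j * \<theta> u j)"
      if "\<And>j. \<bar>w j\<bar> \<le> 1" for w :: "nat \<Rightarrow> real"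
    proof -
      have "holder_class k \<alpha> (1 * R0) (\<lambda>u. w j * \<theta> u j)" if "j \<in> {1..p}" for j
        by (rule holder_class_cmult[OF h\<theta>[OF that] \<open>\<bar>w j\<bar> \<le> 1\<close>])
      from holder_class_sum[where I = "{1..p}" and f = "\<lambda>j u. w j * \<theta> u j", OF _ \<alpha>(1) this] show ?thesis by simp
    qed
    have R0: "0 \<le> R0" using h\<sigma> holder_class_nonneg by blast
    let ?a = "\<lambda>u. 1 - (\<Sum>j=1..p. cos (real j * x) * \<theta> u j)"
    let ?b = "\<lambda>u. \<Sum>j=1..p. sin (real j * x) * \<theta> u j"
    have "holder_class k \<alpha> (\<bar>1\<bar> + 1 * (real p * (1 * R0))) (\<lambda>u. 1 + - 1 * (\<Sum>j=1..p. cos (real j * x) * \<theta> u j))"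
      by (intro holder_class_add holder_class_const holder_class_cmult hsum \<alpha>) auto
    then have a: "holder_class k \<alpha> Ra ?a" by (simp add: Ra_def)
    have b: "holder_class k \<alpha> Ra ?b"
      by (rule holder_class_mono[OF hsum]) (use R0 in \<open>auto simp: Ra_def\<close>)
    have "holder_class k \<alpha> (Q1 + Q1) (\<lambda>u. ?a u * ?a u + ?b u * ?b u)"
      by (intro holder_class_add Q1 a b)
    moreover have "((1 - \<delta>) ^ p)\<^sup>2 \<le> ?a u * ?a u + ?b u * ?b u" for u
    proof -
      have "((1 - \<delta>) ^ p)\<^sup>2 \<le> (cmod (ar_poly p \<theta> (exp (- \<i> * complex_of_real x)) u))\<^sup>2"
        using \<delta> by (intro power_mono ar_poly_bounds(1)[OF \<delta> \<theta>(2)]) auto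
      then show ?thesis unfolding ar_poly_unit_circle by (simp add: power2_eq_square)
    qed
    ultimately have "holder_class k \<alpha> Q2 (\<lambda>u. inverse (?a u * ?a u + ?b u * ?b u))" by (rule Q2)
    then have "holder_class k \<alpha> Q4 (\<lambda>u. (\<sigma> u * \<sigma> u) * inverse (?a u * ?a u + ?b u * ?b u))"
      by (rule Q4[OF Q3[OF h\<sigma> h\<sigma>]])
    then have "holder_class k \<alpha> (1 / (2 * pi) * Q4) (\<lambda>u. 1 / (2 * pi) * ((\<sigma> u * \<sigma> u) * inverse (?a u * ?a u + ?b u * ?b u)))"
      by (rule holder_class_cmult) simp
    then have "holder_class k (\<beta> - real k) (1 / (2 * pi) * Q4) (\<lambda>u. tvar_spectral_density p \<theta> \<sigma> u x)"
      by (simp only: spectral_density_eq \<alpha>_def)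
    then show "(\<lambda>u _. tvar_spectral_density p \<theta> \<sigma> u x) \<in> holder_ball 1 \<beta> (2 * (1 / (2 * pi) * Q4))"
      by (rule holder_class_imp_holder_ball) (rule k_def)
  qed
qed

lemma ar_poly_nonzero_circle:
  assumes "\<theta> \<in> stable_set p \<delta>" "0 < \<delta>" "\<delta> < 1" "cmod z = 1"
  shows "ar_poly p \<theta> z u \<noteq> 0"
  using ar_poly_bounds(1)[OF assms(2,3,1,4), of u] assms(3)
  by (metis diff_gt_0_iff_gt linorder_not_le norm_zero zero_less_power)

lemma continuous_ar_poly: "continuous_on A (\<lambda>x. ar_poly p \<theta> (exp (- \<i> * complex_of_real x)) u)"
  unfolding ar_poly_def by (intro continuous_intros)

lemma spectral_density_continuous:
  assumes "\<theta> \<in> stable_set p \<delta>" "0 < \<delta>" "\<delta> < 1"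
  shows "continuous_on A (tvar_spectral_density p \<theta> \<sigma> u)"
  unfolding tvar_spectral_density_def[abs_def] power_int_minus
  by (intro continuous_intros continuous_ar_poly) (use ar_poly_nonzero_circle[OF assms] in auto)

lemma local_spectral_density_tvar:
  assumes "\<theta> \<in> stable_set p \<delta>" "0 < \<delta>" "\<delta> < 1"
  shows "local_spectral_density (tvar_spectral_density p \<theta> \<sigma>)"
  unfolding local_spectral_density_def
proof (intro conjI allI)
  show "0 \<le> tvar_spectral_density p \<theta> \<sigma> u x" for u x
    by (simp add: tvar_spectral_density_def)
  show "tvar_spectral_density p \<theta> \<sigma> u (x + 2 * pi) = tvar_spectral_density p \<theta> \<sigma> u x" for u x
  proof -
    have e: "exp (- \<i> * complex_of_real y) = cis (- y)" for y by (simp add: cis_conv_exp)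
    have "cis (- (x + 2 * pi)) = cis (- x)"
      by (simp only: complex_eq_iff cis.sel cos_minus sin_minus cos_periodic sin_periodic simp_thms)
    then have "exp (- \<i> * complex_of_real (x + 2 * pi)) = exp (- \<i> * complex_of_real x)" by (simp only: e)
    then show ?thesis by (simp only: tvar_spectral_density_def)
  qed
  show "set_integrable lborel {a..b} (tvar_spectral_density p \<theta> \<sigma> u)" for u a b
    by (rule borel_integrable_atLeastAtMost') (rule spectral_density_continuous[OF assms])
qed

lemma character_integral:
  "set_lebesgue_integral lborel {-pi..pi} (\<lambda>x. exp (\<i> * of_int k * complex_of_real x)) = (if k = 0 then 2 * pi else 0)"
proof (cases "k = 0")
  case True
  then show ?thesis by (simp add: set_lebesgue_integral_def scaleR_conv_of_real)
next
  case False
  let ?c = "\<i> * of_int k"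
  let ?F = "\<lambda>x. exp (?c * complex_of_real x) / ?c"
  have "set_lebesgue_integral lborel {-pi..pi} (\<lambda>x. exp (?c * complex_of_real x)) = ?F pi - ?F (- pi)"
    unfolding set_lebesgue_integral_def
  proof (rule integral_FTC_atLeastAtMost)
    show "(?F has_vector_derivative exp (?c * complex_of_real x)) (at x within {- pi..pi})" for x
    proof -
      have "((\<lambda>z. exp (?c * z) / ?c) has_field_derivative exp (?c * complex_of_real x)) (at (complex_of_real x))"
        using False by (auto intro!: derivative_eq_intros)
      then show ?thesis by (rule has_vector_derivative_real_field)
    qed
    show "continuous_on {- pi..pi} (\<lambda>x. exp (?c * complex_of_real x))" by (intro continuous_intros)
  qed simp
  also have "exp (?c * complex_of_real pi) = exp (?c * complex_of_real (- pi))"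
  proof -
    have e: "exp (?c * complex_of_real y) = cis (y * of_int k)" for y by (simp add: cis_conv_exp mult_ac)
    show ?thesis unfolding e by (simp add: complex_eq_iff)
  qed
  finally show ?thesis using False by simp
qed

text \<open>
  Integrates series in the frozen response term by term.
\<close>

lemma set_integral_weighted_series:
  fixes F :: "nat \<Rightarrow> real \<Rightarrow> complex" and a :: "nat \<Rightarrow> real"
  assumes F: "\<And>n. continuous_on {-pi..pi} (F n)" "\<And>n x. cmod (F n x) \<le> B"
    and a: "\<And>n. \<bar>a n\<bar> \<le> K * r ^ n" and r: "0 \<le> r" "r < 1"
  shows "(\<lambda>n. of_real (a n) * set_lebesgue_integral lborel {-pi..pi} (F n))
      sums set_lebesgue_integral lborel {-pi..pi} (\<lambda>x. \<Sum>n. of_real (a n) * F n x)"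
proof -
  let ?I = "\<lambda>x. indicator {-pi..pi} x :: real"
  let ?f = "\<lambda>n x. ?I x *\<^sub>R (of_real (a n) * F n x)"
  have B: "0 \<le> B" using F(2)[of 0 0] by (rule order_trans[OF norm_ge_zero])
  have i: "integrable lborel (\<lambda>x. ?I x *\<^sub>R F n x)" for n
    using borel_integrable_atLeastAtMost'[OF F(1)] unfolding set_integrable_def .
  have if': "integrable lborel (?f n)" for n
    using integrable_mult_right[OF i, of "complex_of_real (a n)" n] by simp
  have bnd: "norm (?f n x) \<le> K * r ^ n * B * ?I x" for n x
  proof -
    have "\<bar>a n\<bar> * cmod (F n x) \<le> (K * r ^ n) * B" by (intro mult_mono a F(2)) (use a[of n] in auto)
    then show ?thesis by (auto simp: indicator_def norm_mult)
  qed
  have sg: "summable (\<lambda>n. K * r ^ n * B * c)" for c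
    using r by (intro summable_mult2 summable_mult summable_geometric) auto
  have "(\<lambda>n. integral\<^sup>L lborel (?f n)) sums (\<integral>x. (\<Sum>n. ?f n x) \<partial>lborel)"
  proof (rule sums_integral[OF if'])
    show "AE x in lborel. summable (\<lambda>n. norm (?f n x))"
    proof (rule AE_I2)
      fix x
      show "summable (\<lambda>n. norm (?f n x))"
        by (rule summable_comparison_test'[OF sg[of "?I x"]]) (use bnd in simp)
    qed
    show "summable (\<lambda>n. \<integral>x. norm (?f n x) \<partial>lborel)"
    proof (rule summable_comparison_test'[OF sg[of "2 * pi"]])
      fix n :: nat
      have iI: "integrable lborel (\<lambda>x. K * r ^ n * B * ?I x)"
        by (intro integrable_mult_right integrable_real_indicator) auto
      have "(\<integral>x. norm (?f n x) \<partial>lborel) \<le> (\<integral>x. K * r ^ n * B * ?I x \<partial>lborel)"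
        by (intro integral_mono integrable_norm if' iI bnd)
      also have "\<dots> = K * r ^ n * B * (2 * pi)" by simp
      finally show "norm (\<integral>x. norm (?f n x) \<partial>lborel) \<le> K * r ^ n * B * (2 * pi)" by simp
    qed
  qed
  moreover have "integral\<^sup>L lborel (?f n) = of_real (a n) * set_lebesgue_integral lborel {-pi..pi} (F n)" for n
    unfolding set_lebesgue_integral_def by (subst integral_mult_right_zero[symmetric]) simp
  moreover have "(\<Sum>n. ?f n x) = ?I x *\<^sub>R (\<Sum>n. of_real (a n) * F n x)" for x
    by (cases "x \<in> {-pi..pi}") auto
  ultimately show ?thesis by (simp add: set_lebesgue_integral_def)
qed

text \<open>
  Extending the response by 0 to negative times gives one formula for positive and negative
  lags.
\<close>

definition int_extend :: "(nat \<Rightarrow> real) \<Rightarrow> int \<Rightarrow> real" where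
  "int_extend c i = (if 0 \<le> i then c (nat i) else 0)"

text \<open>
  With \<open>1 / \<theta>(z; u) = (\<Sum>n. g n * z ^ n)\<close> at \<open>z = exp (- i x)\<close>, the density is
  \<open>(\<sigma> u)\<^sup>2 / (2 \<pi>)\<close> times this series times its conjugate. Integrating one series at a time, first
  against characters (\<open>J\<close>) and then the conjugate one, avoids double series.
\<close>

lemma local_cov_tvar:
  assumes \<theta>: "\<theta> \<in> stable_set p \<delta>" and \<delta>: "0 < \<delta>" "\<delta> < 1"
    and psi: "\<And>n. \<bar>frozen_green p (\<theta> u) n\<bar> \<le> K * r ^ n" and r: "0 \<le> r" "r < 1"
  shows "(\<lambda>m. complex_of_real ((\<sigma> u)\<^sup>2 * frozen_green p (\<theta> u) m * int_extend (frozen_green p (\<theta> u)) (int m + l)))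
      sums local_cov (tvar_spectral_density p \<theta> \<sigma>) u l"
proof -
  let ?g = "frozen_green p (\<theta> u)"
  let ?z = "\<lambda>x. exp (- \<i> * complex_of_real x)"
  let ?A = "\<lambda>x. ar_poly p \<theta> (?z x) u"
  let ?e = "\<lambda>k x. exp (\<i> * of_int k * complex_of_real x)"
  let ?I = "\<lambda>f. set_lebesgue_integral lborel {-pi..pi} f"
  have Anz: "?A x \<noteq> 0" for x by (rule ar_poly_nonzero_circle[OF \<theta> \<delta>]) simp
  have ez: "?e k x * ?z x ^ n = ?e (k - int n) x" for k x n
    by (simp add: exp_of_nat_mult[symmetric] exp_add[symmetric] algebra_simps)
  have J: "?I (\<lambda>x. ?e k x / ?A x) = complex_of_real (2 * pi * int_extend ?g k)" for k
  proof -
    have "(\<lambda>n. of_real (?g n) * ?I (\<lambda>x. ?e (k - int n) x)) sums ?I (\<lambda>x. \<Sum>n. of_real (?g n) * ?e (k - int n) x)"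
    proof (rule set_integral_weighted_series[OF _ _ psi r])
      show "continuous_on {-pi..pi} (?e (k - int n))" for n by (intro continuous_intros)
      show "cmod (?e (k - int n) x) \<le> 1" for n x
        using norm_exp_i_times[of "of_int (k - int n) * x"] by (simp add: mult.assoc)
    qed
    moreover have "(\<Sum>n. of_real (?g n) * ?e (k - int n) x) = ?e k x / ?A x" for x
    proof -
      have "(\<lambda>n. ?e k x * (complex_of_real (?g n) * ?z x ^ n)) sums (?e k x * (1 / ?A x))"
        by (intro sums_mult frozen_green_sums[OF \<theta> \<delta>]) simp
      moreover have "?e k x * (complex_of_real (?g n) * ?z x ^ n) = of_real (?g n) * ?e (k - int n) x" for n
        by (subst ez[symmetric]) (simp only: mult_ac)
      ultimately have "(\<lambda>n. of_real (?g n) * ?e (k - int n) x) sums (?e k x * (1 / ?A x))" by (simp only:)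
      from sums_unique[OF this, symmetric] show ?thesis by (simp only: times_divide_eq_right mult_1_right)
    qed
    ultimately have 1: "(\<lambda>n. of_real (?g n) * complex_of_real (if k - int n = 0 then 2 * pi else 0)) sums ?I (\<lambda>x. ?e k x / ?A x)"
      by (simp only: character_integral)
    have "(\<lambda>n. of_real (?g n) * complex_of_real (if k - int n = 0 then 2 * pi else 0)) sums complex_of_real (2 * pi * int_extend ?g k)"
    proof (cases "0 \<le> k")
      case True
      then have "(\<lambda>n. of_real (?g n) * complex_of_real (if k - int n = 0 then 2 * pi else 0))
          = (\<lambda>n. if n = nat k then of_real (?g n) * complex_of_real (2 * pi) else 0)"
        by (auto simp: fun_eq_iff)
      then show ?thesis
        using sums_single[of "nat k" "\<lambda>n. of_real (?g n) * complex_of_real (2 * pi)"] True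
        by (simp add: int_extend_def mult_ac)
    next
      case False
      then have "(\<lambda>n. of_real (?g n) * complex_of_real (if k - int n = 0 then 2 * pi else 0)) = (\<lambda>n. 0)"
        by (auto simp: fun_eq_iff)
      then show ?thesis using False by (simp add: int_extend_def)
    qed
    with 1 show ?thesis by (rule sums_unique2)
  qed
  have "(\<lambda>m. of_real (?g m) * ?I (\<lambda>x. ?e (int m + l) x / ?A x))
      sums ?I (\<lambda>x. \<Sum>m. of_real (?g m) * (?e (int m + l) x / ?A x))"
  proof (rule set_integral_weighted_series[OF _ _ psi r])
    show "continuous_on {-pi..pi} (\<lambda>x. ?e (int m + l) x / ?A x)" for m
      by (intro continuous_intros continuous_ar_poly) (use Anz in auto)
    show "cmod (?e (int m + l) x / ?A x) \<le> 1 / (1 - \<delta>) ^ p" for m x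
    proof -
      have "cmod (?e (int m + l) x) = 1"
        using norm_exp_i_times[of "of_int (int m + l) * x"] by (simp add: mult.assoc)
      moreover have "(1 - \<delta>) ^ p \<le> cmod (?A x)" by (rule ar_poly_bounds(1)[OF \<delta> \<theta>]) simp
      ultimately show ?thesis unfolding norm_divide using \<delta> by (intro frac_le) auto
    qed
  qed
  moreover have "(\<Sum>m. of_real (?g m) * (?e (int m + l) x / ?A x))
      = ?e l x * complex_of_real (1 / (cmod (?A x))\<^sup>2)" for x
  proof -
    have "(\<lambda>m. cnj (complex_of_real (?g m) * ?z x ^ m)) sums cnj (1 / ?A x)"
      unfolding sums_cnj by (intro frozen_green_sums[OF \<theta> \<delta>]) simp
    then have "(\<lambda>m. (?e l x / ?A x) * cnj (complex_of_real (?g m) * ?z x ^ m)) sums ((?e l x / ?A x) * cnj (1 / ?A x))"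
      by (rule sums_mult)
    moreover have "(?e l x / ?A x) * cnj (complex_of_real (?g m) * ?z x ^ m) = of_real (?g m) * (?e (int m + l) x / ?A x)" for m
    proof -
      have "cnj (?z x ^ m) * ?e l x = ?e (int m + l) x"
        by (simp add: exp_cnj exp_of_nat_mult[symmetric] exp_add[symmetric] algebra_simps)
      then show ?thesis by (simp add: field_simps)
    qed
    moreover have "(?e l x / ?A x) * cnj (1 / ?A x) = ?e l x * complex_of_real (1 / (cmod (?A x))\<^sup>2)"
      by (simp add: complex_norm_square del: of_real_power)
    ultimately have "(\<lambda>m. of_real (?g m) * (?e (int m + l) x / ?A x)) sums (?e l x * complex_of_real (1 / (cmod (?A x))\<^sup>2))"
      by (simp only:)
    from sums_unique[OF this, symmetric] show ?thesis .
  qed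
  ultimately have "(\<lambda>m. of_real (?g m) * complex_of_real (2 * pi * int_extend ?g (int m + l)))
      sums ?I (\<lambda>x. ?e l x * complex_of_real (1 / (cmod (?A x))\<^sup>2))"
    by (simp only: J)
  then have "(\<lambda>m. complex_of_real ((\<sigma> u)\<^sup>2 / (2 * pi)) * (of_real (?g m) * complex_of_real (2 * pi * int_extend ?g (int m + l))))
      sums (complex_of_real ((\<sigma> u)\<^sup>2 / (2 * pi)) * ?I (\<lambda>x. ?e l x * complex_of_real (1 / (cmod (?A x))\<^sup>2)))"
    by (rule sums_mult)
  moreover have "complex_of_real ((\<sigma> u)\<^sup>2 / (2 * pi)) * (of_real (?g m) * complex_of_real (2 * pi * int_extend ?g (int m + l)))
      = complex_of_real ((\<sigma> u)\<^sup>2 * ?g m * int_extend ?g (int m + l))" for m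
    by simp
  moreover have "complex_of_real ((\<sigma> u)\<^sup>2 / (2 * pi)) * ?I (\<lambda>x. ?e l x * complex_of_real (1 / (cmod (?A x))\<^sup>2))
      = local_cov (tvar_spectral_density p \<theta> \<sigma>) u l"
  proof -
    have pt: "complex_of_real ((\<sigma> u)\<^sup>2 / (2 * pi)) * (?e l x * complex_of_real (1 / (cmod (?A x))\<^sup>2))
        = ?e l x * complex_of_real (tvar_spectral_density p \<theta> \<sigma> u x)" for x
    proof -
      have "tvar_spectral_density p \<theta> \<sigma> u x = (\<sigma> u)\<^sup>2 / (2 * pi) * (1 / (cmod (?A x))\<^sup>2)"
        unfolding tvar_spectral_density_def power_int_minus power_int_numeral inverse_eq_divide by (rule refl)
      then show ?thesis by (simp only: of_real_mult mult.left_commute mult.assoc)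
    qed
    show ?thesis
      unfolding local_cov_def
      by (subst set_integral_mult_right[symmetric]) (simp only: pt)
  qed
  ultimately show ?thesis by (simp only:)
qed

section \<open>The process at a fixed resolution\<close>

lemma sums_difference_bound:
  fixes a b :: "nat \<Rightarrow> real"
  assumes "a sums A" "b sums B" and "\<And>j. \<bar>a j - b j\<bar> \<le> E * r ^ j" and r: "0 \<le> r" "r < 1"
  shows "\<bar>A - B\<bar> \<le> E / (1 - r)"
proof -
  have d: "(\<lambda>j. a j - b j) sums (A - B)" using assms(1,2) by (rule sums_diff)
  have g: "(\<lambda>j. E * r ^ j) sums (E * (1 / (1 - r)))"
    using r by (intro sums_mult geometric_sums) simp
  have up: "A - B \<le> E * (1 / (1 - r))"
    by (rule sums_le[OF _ d g]) (use assms(3) in \<open>auto simp: abs_le_iff\<close>)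
  have "- (A - B) \<le> E * (1 / (1 - r))"
    by (rule sums_le[OF _ sums_minus[OF d] g]) (use assms(3) in \<open>simp add: abs_le_iff\<close>)
  with up show ?thesis by (simp add: abs_le_iff)
qed

lemma local_cov_neg: "local_cov f u (- l) = cnj (local_cov f u l)"
proof -
  let ?h = "\<lambda>l x. indicat_real {-pi..pi} x *\<^sub>R (exp (\<i> * complex_of_int l * complex_of_real x) * complex_of_real (f u x))"
  have "?h (- l) = (\<lambda>x. cnj (?h l x))" by (simp add: fun_eq_iff exp_cnj)
  then show ?thesis
    unfolding local_cov_def set_lebesgue_integral_def by (simp only: Bochner_Integration.integral_cnj)
qed

text \<open>
  One process at one resolution \<open>T\<close>, together with constants \<open>r\<close>, \<open>K\<close>, \<open>C\<close> as provided by
  \<open>tvar_green_uniform\<close>. The statements with these constants are uniform in all other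
  parameters.
\<close>

locale tvar = white_noise M \<xi> for M :: "'w measure" and \<xi> :: "int \<Rightarrow> 'w \<Rightarrow> real" +
  fixes p :: nat and \<delta> \<beta> R0 \<rho> \<sigma>p :: real and \<theta> :: "real \<Rightarrow> nat \<Rightarrow> real" and \<sigma> :: "real \<Rightarrow> real"
    and r K C :: real and T :: nat and X :: "int \<Rightarrow> 'w \<Rightarrow> real"
  assumes in_class: "(\<theta>, \<sigma>) \<in> tvar_class p \<beta> R0 \<delta> \<rho> \<sigma>p"
    and \<delta>: "0 < \<delta>" "\<delta> < 1" and \<beta>: "0 < \<beta>" and \<rho>: "0 \<le> \<rho>" and \<sigma>p: "0 < \<sigma>p" and T: "0 < T"
    and r: "0 < r" "r < 1" and K: "0 \<le> K" and C: "0 \<le> C"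
    and frozen_decay: "\<And>u n. \<bar>frozen_green p (\<theta> u) n\<bar> \<le> K * r ^ n"
    and green_decays: "\<And>t n. \<bar>tvar_green p \<theta> T t n\<bar> \<le> K * r ^ n"
    and green_close: "\<And>t t0 n. \<bar>tvar_green p \<theta> T t n - frozen_green p (\<theta> (real_of_int t0 / real T)) n\<bar>
             \<le> C * real T powr (- min 1 \<beta>) * (1 + \<bar>real_of_int (t - t0)\<bar>) * r ^ n"
    and X_measurable [measurable]: "\<And>t. X t \<in> borel_measurable M"
    and X_recursion: "\<And>t. AE w in M. X t w = (\<Sum>j=1..p. \<theta> (real_of_int t / real T) j * X (t - int j) w)
                        + \<sigma> (real_of_int t / real T) * \<xi> t w"
    and X_bounded: "bounded_in_prob_at_minus_inf M X"
begin

lemma \<theta>_holder: "\<theta> \<in> holder_ball p \<beta> R0" and \<theta>_stable: "\<theta> \<in> stable_set p \<delta>"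
  and \<sigma>_holder: "(\<lambda>u _. \<sigma> u) \<in> holder_ball 1 \<beta> R0" and \<sigma>_range: "\<rho> * \<sigma>p \<le> \<sigma> u" "\<sigma> u \<le> \<sigma>p"
  using in_class by (auto simp: tvar_class_def)

lemma \<sigma>_nonneg: "0 \<le> \<sigma> u"
  using \<sigma>_range(1)[of u] \<rho> \<sigma>p by (meson mult_nonneg_nonneg less_imp_le order_trans)

lemma \<sigma>_bound: "\<bar>\<sigma> u\<bar> \<le> \<sigma>p"
  using \<sigma>_nonneg[of u] \<sigma>_range(2)[of u] by simp

lemma \<sigma>_holder_class: "holder_class (nat (\<lceil>\<beta>\<rceil> - 1)) (\<beta> - real (nat (\<lceil>\<beta>\<rceil> - 1))) R0 \<sigma>"
  using holder_ball_imp_holder_class[OF \<sigma>_holder refl, of 1] by simp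

lemma R0_nonneg: "0 \<le> R0"
  using \<sigma>_holder_class holder_class_nonneg by blast

lemma lag_cut_bound: "\<bar>lag_cut p (\<theta> u) j\<bar> \<le> R0"
proof (cases "j \<in> {1..p}")
  case True
  then show ?thesis
    using holder_class_bound[OF holder_ball_imp_holder_class[OF \<theta>_holder refl True], of u] by (simp add: lag_cut_def)
next
  case False
  then show ?thesis using R0_nonneg by (auto simp: lag_cut_def)
qed

definition coef :: "int \<Rightarrow> nat \<Rightarrow> real" where
  "coef t n = tvar_green p \<theta> T t n * \<sigma> (real_of_int (t - int n) / real T)"

lemma coef_0: "coef t 0 = \<sigma> (real_of_int t / real T)"
  by (simp add: coef_def tvar_green_def)

lemma coef_decay: "\<bar>coef t n\<bar> \<le> (K * \<sigma>p) * r ^ n"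
proof -
  have "\<bar>coef t n\<bar> \<le> (K * r ^ n) * \<sigma>p"
    unfolding coef_def abs_mult using K r by (intro mult_mono green_decays \<sigma>_bound) auto
  then show ?thesis by (simp add: mult_ac)
qed

lemmas coef_filter = less_imp_le[OF r(1)] r(2) coef_decay

lemma X_eq_filter: "AE w in M. X t w = linear_filter (coef t) t w"
proof -
  have "AE w in M. X t w = linear_filter
      (\<lambda>n. green (\<lambda>k. lag_cut p (\<theta> (real_of_int (t - int n + int k) / real T))) n * \<sigma> (real_of_int (t - int n) / real T)) t w"
  proof (rule recursion_solution_unique[where p = p and a = "\<lambda>t. lag_cut p (\<theta> (real_of_int t / real T))"
        and s = "\<lambda>t. \<sigma> (real_of_int t / real T)" and L = R0 and S = \<sigma>p and K = K and r = r])
    fix t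
    have "(\<Sum>j=1..p. lag_cut p (\<theta> (real_of_int t / real T)) j * X (t - int j) w)
        = (\<Sum>j=1..p. \<theta> (real_of_int t / real T) j * X (t - int j) w)" for w
      by (intro sum.cong refl) (simp add: lag_cut_def)
    then show "AE w in M. X t w = (\<Sum>j=1..p. lag_cut p (\<theta> (real_of_int t / real T)) j * X (t - int j) w)
        + \<sigma> (real_of_int t / real T) * \<xi> t w"
      using X_recursion[of t] by simp
    show "\<bar>green (\<lambda>k. lag_cut p (\<theta> (real_of_int (t - int n + int k) / real T))) n\<bar> \<le> K * r ^ n" for n
      using green_decays[of t n] by (simp add: tvar_green_def)
  qed (use X_bounded r lag_cut_bound \<sigma>_bound in \<open>auto simp: lag_cut_def\<close>)
  then show ?thesis by (simp add: coef_def[abs_def] tvar_green_def)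
qed

lemma X_moment:
  assumes "moment_le M N (\<xi> 0) B" "0 < N"
  shows "moment_le M N (X t) (K * \<sigma>p * B / (1 - r))"
proof (rule moment_le_cong_AE)
  show "moment_le M N (linear_filter (coef t) t) (K * \<sigma>p * B / (1 - r))"
    by (rule linear_filter_moment[OF assms coef_filter])
  show "AE w in M. linear_filter (coef t) t w = X t w"
    using X_eq_filter[of t] by eventually_elim simp
qed measurable

lemma X_L2: "moment_le M 2 (X t) (K * \<sigma>p / (1 - r))"
  using X_moment[OF noise_L2] by simp

lemma X_mean: "expectation (X t) = 0"
proof -
  have "expectation (X t) = expectation (linear_filter (coef t) t)"
    by (rule integral_cong_AE) (use X_eq_filter[of t] in auto)
  then show ?thesis by (simp add: linear_filter_mean[OF coef_filter])
qed

lemma X_product: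
  "expectation (\<lambda>w. X t w * X s w) = expectation (\<lambda>w. linear_filter (coef t) t w * linear_filter (coef s) s w)"
proof (rule integral_cong_AE)
  show "AE w in M. X t w * X s w = linear_filter (coef t) t w * linear_filter (coef s) s w"
    using X_eq_filter[of t] X_eq_filter[of s] by eventually_elim simp
qed measurable

lemma cov_X: "cov M (X t) (X s) = expectation (\<lambda>w. X t w * X s w)"
  by (simp add: cov_def X_mean)

lemma X_noise: "expectation (\<lambda>w. X t w * \<xi> s w) = (if s \<le> t then coef t (nat (t - s)) else 0)"
proof -
  have "expectation (\<lambda>w. X t w * \<xi> s w) = expectation (\<lambda>w. linear_filter (coef t) t w * \<xi> s w)"
  proof (rule integral_cong_AE)
    show "AE w in M. X t w * \<xi> s w = linear_filter (coef t) t w * \<xi> s w"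
      using X_eq_filter[of t] by eventually_elim simp
  qed measurable
  then show ?thesis by (simp only: linear_filter_noise_covariance[OF coef_filter])
qed

text \<open>
  The constant of \<open>covariance_term_close\<close> summed over a geometric series.
\<close>

definition cov_const :: real where
  "cov_const = (2 * C * K * \<sigma>p\<^sup>2 + 4 * K\<^sup>2 * \<sigma>p * R0) / (1 - r)\<^sup>2 / (1 - r)"

text \<open>
  Replacing the responses and the standard deviation one after the other. Each replacement
  costs a factor linear in \<open>j + l\<close>, which \<open>r ^ (j + l)\<close> absorbs; the factor \<open>r ^ j\<close> is left for
  summing over \<open>j\<close>. The freezing time may be either of the two times, because a negative lag
  exchanges their roles.
\<close>

lemma covariance_term_close:
  assumes t0: "t0 = s \<or> t0 = s + int l"
  shows "\<bar>coef s j * coef (s + int l) (j + l)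
      - (\<sigma> (real_of_int t0 / real T))\<^sup>2 * frozen_green p (\<theta> (real_of_int t0 / real T)) j
          * frozen_green p (\<theta> (real_of_int t0 / real T)) (j + l)\<bar>
    \<le> real T powr (- min 1 \<beta>) * ((2 * C * K * \<sigma>p\<^sup>2 + 4 * K\<^sup>2 * \<sigma>p * R0) / (1 - r)\<^sup>2) * r ^ j"
proof -
  let ?u = "real_of_int t0 / real T" and ?\<epsilon> = "real T powr (- min 1 \<beta>)"
  let ?N = "1 + real (j + l)"
  define A B where "A = tvar_green p \<theta> T s j" and "B = tvar_green p \<theta> T (s + int l) (j + l)"
  define a b where "a = frozen_green p (\<theta> ?u) j" and "b = frozen_green p (\<theta> ?u) (j + l)"
  define v v0 where "v = \<sigma> (real_of_int (s - int j) / real T)" and "v0 = \<sigma> ?u"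
  have eps: "0 \<le> ?\<epsilon>" by simp
  have bA: "\<bar>A\<bar> \<le> K * r ^ j" and bB: "\<bar>B\<bar> \<le> K * r ^ (j + l)"
    and ba: "\<bar>a\<bar> \<le> K * r ^ j" and bb: "\<bar>b\<bar> \<le> K * r ^ (j + l)"
    by (simp_all only: A_def B_def a_def b_def green_decays frozen_decay)
  have dA: "\<bar>A - a\<bar> \<le> C * ?\<epsilon> * ?N * r ^ j"
  proof -
    have "\<bar>A - a\<bar> \<le> C * ?\<epsilon> * (1 + \<bar>real_of_int (s - t0)\<bar>) * r ^ j" unfolding A_def a_def by (rule green_close)
    also have "\<dots> \<le> C * ?\<epsilon> * ?N * r ^ j" using t0 C r by (intro mult_right_mono mult_left_mono) auto
    finally show ?thesis .
  qed
  have dB: "\<bar>B - b\<bar> \<le> C * ?\<epsilon> * ?N * r ^ (j + l)"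
  proof -
    have "\<bar>B - b\<bar> \<le> C * ?\<epsilon> * (1 + \<bar>real_of_int (s + int l - t0)\<bar>) * r ^ (j + l)" unfolding B_def b_def by (rule green_close)
    also have "\<dots> \<le> C * ?\<epsilon> * ?N * r ^ (j + l)" using t0 C r by (intro mult_right_mono mult_left_mono) auto
    finally show ?thesis .
  qed
  have bv: "\<bar>v\<bar> \<le> \<sigma>p" "\<bar>v0\<bar> \<le> \<sigma>p" by (simp_all only: v_def v0_def \<sigma>_bound)
  have dv: "\<bar>v - v0\<bar> \<le> 2 * R0 * ?\<epsilon> * ?N"
  proof -
    have "\<bar>v - v0\<bar> \<le> 2 * R0 * ?\<epsilon> * \<bar>real_of_int (s - int j - t0)\<bar>"
      unfolding v_def v0_def by (rule holder_class_on_grid[OF \<beta> refl \<sigma>_holder_class T])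
    also have "\<dots> \<le> 2 * R0 * ?\<epsilon> * ?N" using t0 R0_nonneg by (intro mult_left_mono) auto
    finally show ?thesis .
  qed
  have "\<bar>v\<^sup>2 - v0\<^sup>2\<bar> = \<bar>v - v0\<bar> * \<bar>v + v0\<bar>" by (simp add: abs_mult[symmetric] power2_eq_square algebra_simps)
  also have "\<dots> \<le> (2 * R0 * ?\<epsilon> * ?N) * (2 * \<sigma>p)" using bv R0_nonneg by (intro mult_mono dv) auto
  finally have dv2: "\<bar>v\<^sup>2 - v0\<^sup>2\<bar> \<le> (2 * R0 * ?\<epsilon> * ?N) * (2 * \<sigma>p)" .
  have bv2: "\<bar>v\<^sup>2\<bar> \<le> \<sigma>p\<^sup>2" using bv(1) by (simp add: abs_le_square_iff[symmetric] \<sigma>p less_imp_le)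
  have "A * B * v\<^sup>2 - v0\<^sup>2 * a * b = (A - a) * B * v\<^sup>2 + a * (B - b) * v\<^sup>2 + a * b * (v\<^sup>2 - v0\<^sup>2)"
    by (simp add: algebra_simps)
  also have "\<bar>\<dots>\<bar> \<le> \<bar>A - a\<bar> * \<bar>B\<bar> * \<bar>v\<^sup>2\<bar> + \<bar>a\<bar> * \<bar>B - b\<bar> * \<bar>v\<^sup>2\<bar> + \<bar>a\<bar> * \<bar>b\<bar> * \<bar>v\<^sup>2 - v0\<^sup>2\<bar>"
    unfolding abs_mult[symmetric] by linarith
  also have "\<dots> \<le> (C * ?\<epsilon> * ?N * r ^ j) * (K * r ^ (j + l)) * \<sigma>p\<^sup>2
      + (K * r ^ j) * (C * ?\<epsilon> * ?N * r ^ (j + l)) * \<sigma>p\<^sup>2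
      + (K * r ^ j) * (K * r ^ (j + l)) * ((2 * R0 * ?\<epsilon> * ?N) * (2 * \<sigma>p))"
    using K C r R0_nonneg \<sigma>p by (intro add_mono mult_mono dA dB bA bB ba bb dv2 bv2) auto
  also have "\<dots> = ?\<epsilon> * (2 * C * K * \<sigma>p\<^sup>2 + 4 * K\<^sup>2 * \<sigma>p * R0) * (?N * r ^ (j + l)) * r ^ j"
    by (simp add: algebra_simps power2_eq_square)
  also have "\<dots> \<le> ?\<epsilon> * (2 * C * K * \<sigma>p\<^sup>2 + 4 * K\<^sup>2 * \<sigma>p * R0) * (1 / (1 - r)\<^sup>2) * r ^ j"
  proof (intro mult_right_mono mult_left_mono)
    have "?N * r ^ (j + l) \<le> (\<Sum>k\<le>j+l. (1 + real k) * r ^ k)"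
      using r by (intro member_le_sum) auto
    also have "\<dots> \<le> 1 / (1 - r)\<^sup>2" using r by (intro weighted_geometric_bound) auto
    finally show "?N * r ^ (j + l) \<le> 1 / (1 - r)\<^sup>2" .
  qed (use K C r R0_nonneg \<sigma>p in auto)
  also have "A * B * v\<^sup>2 = coef s j * coef (s + int l) (j + l)"
    by (simp add: coef_def A_def B_def v_def power2_eq_square)
  finally show ?thesis by (simp add: a_def b_def v0_def)
qed

lemma covariance_close:
  assumes t0: "t0 = s \<or> t0 = s + int l"
  shows "cmod (complex_of_real (expectation (\<lambda>w. X (s + int l) w * X s w))
      - local_cov (tvar_spectral_density p \<theta> \<sigma>) (real_of_int t0 / real T) (int l))
    \<le> cov_const * real T powr (- min 1 \<beta>)"
    and "Im (local_cov (tvar_spectral_density p \<theta> \<sigma>) (real_of_int t0 / real T) (int l)) = 0"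
proof -
  let ?u = "real_of_int t0 / real T"
  let ?g = "frozen_green p (\<theta> ?u)"
  let ?L = "local_cov (tvar_spectral_density p \<theta> \<sigma>) ?u (int l)"
  have e: "int_extend ?g (int m + int l) = ?g (m + l)" for m
    by (simp add: int_extend_def nat_add_distrib)
  have s1: "(\<lambda>m. complex_of_real ((\<sigma> ?u)\<^sup>2 * ?g m * ?g (m + l))) sums ?L"
    using local_cov_tvar[OF \<theta>_stable \<delta> frozen_decay less_imp_le[OF r(1)] r(2), of \<sigma> ?u "int l"] by (simp only: e)
  have re: "(\<lambda>m. (\<sigma> ?u)\<^sup>2 * ?g m * ?g (m + l)) sums Re ?L" using sums_Re[OF s1] by simp
  show im: "Im ?L = 0" using sums_Im[OF s1] by (simp add: sums_unique2[OF _ sums_zero])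
  have f: "(if s - int j \<le> s + int l then coef (s + int l) (nat (s + int l - s + int j)) else 0) = coef (s + int l) (j + l)" for j
    by (simp add: nat_add_distrib add.commute)
  have s2: "(\<lambda>j. coef s j * coef (s + int l) (j + l)) sums expectation (\<lambda>w. X (s + int l) w * X s w)"
    using linear_filter_covariance[where c = "coef (s + int l)" and d = "coef s" and t = "s + int l" and s = s,
        OF coef_filter coef_decay]
    by (simp only: f X_product)
  have "\<bar>expectation (\<lambda>w. X (s + int l) w * X s w) - Re ?L\<bar>
      \<le> real T powr (- min 1 \<beta>) * ((2 * C * K * \<sigma>p\<^sup>2 + 4 * K\<^sup>2 * \<sigma>p * R0) / (1 - r)\<^sup>2) / (1 - r)"
    using covariance_term_close[OF t0] r by (intro sums_difference_bound[OF s2 re]) auto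
  also have "\<dots> = cov_const * real T powr (- min 1 \<beta>)" by (simp add: cov_const_def)
  finally have "\<bar>expectation (\<lambda>w. X (s + int l) w * X s w) - Re ?L\<bar> \<le> cov_const * real T powr (- min 1 \<beta>)" .
  moreover have "complex_of_real (expectation (\<lambda>w. X (s + int l) w * X s w)) - ?L
      = complex_of_real (expectation (\<lambda>w. X (s + int l) w * X s w) - Re ?L)"
    using im by (simp add: complex_eq_iff)
  ultimately show "cmod (complex_of_real (expectation (\<lambda>w. X (s + int l) w * X s w)) - ?L)
      \<le> cov_const * real T powr (- min 1 \<beta>)" by (simp only: norm_of_real)
qed

text \<open>
  Negative lags reduce to positive ones by symmetry of the covariance and of the local
  covariance, which is real.
\<close>

lemma weak_local_stationarity:
  "cmod (complex_of_real (cov M (X t) (X (t - l))) - local_cov (tvar_spectral_density p \<theta> \<sigma>) (real_of_int t / real T) l)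
     \<le> cov_const * real T powr (- min 1 \<beta>)"
proof (cases "0 \<le> l")
  case True
  then show ?thesis
    using covariance_close(1)[of t "t - l" "nat l"] by (simp add: cov_X)
next
  case False
  let ?f = "tvar_spectral_density p \<theta> \<sigma>" and ?u = "real_of_int t / real T"
  have "local_cov ?f ?u l = cnj (local_cov ?f ?u (int (nat (- l))))"
    using False local_cov_neg[of ?f ?u "- l"] by simp
  also have "\<dots> = local_cov ?f ?u (int (nat (- l)))"
    using covariance_close(2)[of t t "nat (- l)"] by (simp add: complex_eq_iff)
  finally have e: "local_cov ?f ?u l = local_cov ?f ?u (int (nat (- l)))" .
  show ?thesis
    unfolding e using covariance_close(1)[of t t "nat (- l)"] False by (simp add: cov_X mult.commute)
qed

end

section \<open>Yule-Walker equations and prediction\<close>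

text \<open>
  The recursion holds at all positive times without initial terms, since earlier values of the
  extended response vanish.
\<close>

lemma int_extend_recursion:
  assumes "0 < n"
  shows "int_extend (frozen_green p \<theta>) n = (\<Sum>j=1..p. \<theta> j * int_extend (frozen_green p \<theta>) (n - int j))"
proof -
  let ?g = "frozen_green p \<theta>"
  obtain m where m: "n = int m" "0 < m" using assms by (metis pos_int_cases)
  have "(\<Sum>j=1..p. \<theta> j * int_extend ?g (n - int j)) = (\<Sum>j=1..max p m. lag_cut p \<theta> j * int_extend ?g (n - int j))"
    by (rule sum.mono_neutral_cong_left) (auto simp: lag_cut_def)
  also have "\<dots> = (\<Sum>j=1..m. lag_cut p \<theta> j * ?g (m - j))"
  proof (rule sum.mono_neutral_cong_right)
    fix j assume "j \<in> {1..m}"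
    then have "n - int j = int (m - j)" using m by auto
    then show "lag_cut p \<theta> j * int_extend ?g (n - int j) = lag_cut p \<theta> j * ?g (m - j)"
      by (simp add: int_extend_def)
  qed (auto simp: int_extend_def m(1))
  also have "\<dots> = (\<Sum>i<m. lag_cut p \<theta> (m - i) * ?g i)"
    by (rule sum.reindex_bij_witness[where i = "\<lambda>i. m - i" and j = "\<lambda>i. m - i"]) auto
  also have "\<dots> = ?g m" using green_pos[OF m(2), of "\<lambda>_. lag_cut p \<theta>"] by simp
  finally show ?thesis using m by (simp add: int_extend_def)
qed

lemma trivial_kernel_imp_invertible:
  fixes A :: "complex Matrix.mat"
  assumes A: "A \<in> carrier_mat n n"
    and ker: "\<And>v. v \<in> carrier_vec n \<Longrightarrow> A *\<^sub>v v = 0\<^sub>v n \<Longrightarrow> v = 0\<^sub>v n"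
  shows "invertible_mat A" "\<And>v. v \<in> carrier_vec n \<Longrightarrow> the (mat_inverse A) *\<^sub>v (A *\<^sub>v v) = v"
proof -
  have "Determinant.det A \<noteq> 0" using ker det_0_iff_vec_prod_zero[OF A] by auto
  then have "A \<in> Units (ring_mat TYPE(complex) n ())" by (rule det_non_zero_imp_unit[OF A])
  then have "mat_inverse A \<noteq> None" using mat_inverse(1)[OF A, of "()"] by metis
  then obtain B where B: "mat_inverse A = Some B" by auto
  note I = mat_inverse(2)[OF A B]
  show "invertible_mat A"
    unfolding invertible_mat_def inverts_mat_def using I A by (intro conjI exI[of _ B]) auto
  show "the (mat_inverse A) *\<^sub>v (A *\<^sub>v v) = v" if v: "v \<in> carrier_vec n" for v
    using I A v B assoc_mult_mat_vec[of B n n A n v] by simp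
qed

context tvar
begin

abbreviation dens :: "real \<Rightarrow> real \<Rightarrow> real" where "dens \<equiv> tvar_spectral_density p \<theta> \<sigma>"

lemma local_cov_dens: "(\<lambda>m. complex_of_real ((\<sigma> u)\<^sup>2 * frozen_green p (\<theta> u) m * int_extend (frozen_green p (\<theta> u)) (int m + l)))
      sums local_cov dens u l"
  by (rule local_cov_tvar[OF \<theta>_stable \<delta> frozen_decay less_imp_le[OF r(1)] r(2)])

text \<open>
  The terms of the series satisfy the equation separately, by the recursion of the frozen
  response.
\<close>

lemma Yule_Walker:
  assumes "0 < l"
  shows "(\<Sum>j=1..p. local_cov dens u (l - int j) * complex_of_real (\<theta> u j)) = local_cov dens u l"
proof -
  let ?g = "frozen_green p (\<theta> u)"
  have "(\<lambda>m. \<Sum>j=1..p. complex_of_real ((\<sigma> u)\<^sup>2 * ?g m * int_extend ?g (int m + (l - int j))) * complex_of_real (\<theta> u j))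
      sums (\<Sum>j=1..p. local_cov dens u (l - int j) * complex_of_real (\<theta> u j))"
    by (intro sums_sum sums_mult2 local_cov_dens)
  moreover have "(\<Sum>j=1..p. complex_of_real ((\<sigma> u)\<^sup>2 * ?g m * int_extend ?g (int m + (l - int j))) * complex_of_real (\<theta> u j))
      = complex_of_real ((\<sigma> u)\<^sup>2 * ?g m * int_extend ?g (int m + l))" for m
  proof -
    have "int_extend ?g (int m + l) = (\<Sum>j=1..p. \<theta> u j * int_extend ?g (int m + l - int j))"
      by (rule int_extend_recursion) (use assms in simp)
    then show ?thesis by (simp add: sum_distrib_left add_diff_eq mult_ac)
  qed
  ultimately show ?thesis using local_cov_dens[of u l] sums_unique2 by simp
qed

lemma local_cov_mat_carrier: "local_cov_mat p dens u \<in> carrier_mat p p"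
  by (simp add: local_cov_mat_def)

lemma mult_local_cov_mat:
  assumes "v \<in> carrier_vec p" "i < p"
  shows "vec_index (local_cov_mat p dens u *\<^sub>v v) i = (\<Sum>j<p. local_cov dens u (int i - int j) * vec_index v j)"
  using assms by (simp add: local_cov_mat_def scalar_prod_def atLeast0LessThan)

lemma local_cov_mat_coeffs:
  "local_cov_mat p dens u *\<^sub>v coeff_vec p (\<theta> u) = local_cov_vec p dens u"
proof (rule eq_vecI)
  show "dim_vec (local_cov_mat p dens u *\<^sub>v coeff_vec p (\<theta> u)) = dim_vec (local_cov_vec p dens u)"
    by (simp add: local_cov_mat_def local_cov_vec_def)
  fix i assume "i < dim_vec (local_cov_vec p dens u)"
  then have i: "i < p" by (simp add: local_cov_vec_def)
  have "vec_index (local_cov_mat p dens u *\<^sub>v coeff_vec p (\<theta> u)) i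
      = (\<Sum>j<p. local_cov dens u (int i - int j) * vec_index (coeff_vec p (\<theta> u)) j)"
    by (rule mult_local_cov_mat) (use i in \<open>auto simp: coeff_vec_def\<close>)
  also have "\<dots> = (\<Sum>j=1..p. local_cov dens u (int (Suc i) - int j) * complex_of_real (\<theta> u j))"
    by (rule sum.reindex_bij_witness[where i = "\<lambda>j. j - 1" and j = Suc]) (auto simp: coeff_vec_def)
  also have "\<dots> = local_cov dens u (int (Suc i))" by (rule Yule_Walker) simp
  also have "\<dots> = vec_index (local_cov_vec p dens u) i" using i by (simp add: local_cov_vec_def)
  finally show "vec_index (local_cov_mat p dens u *\<^sub>v coeff_vec p (\<theta> u)) i = vec_index (local_cov_vec p dens u) i" .
qed

text \<open>
  This form of the local covariance is symmetric in \<open>i\<close> and \<open>j\<close>: summed against \<open>cnj (v i) * v j\<close>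
  it becomes a series of squares.
\<close>

lemma local_cov_shifted:
  "(\<lambda>n. complex_of_real ((\<sigma> u)\<^sup>2 * int_extend (frozen_green p (\<theta> u)) (int n - int i) * int_extend (frozen_green p (\<theta> u)) (int n - int j)))
      sums local_cov dens u (int i - int j)"
proof -
  let ?g = "frozen_green p (\<theta> u)"
  let ?f = "\<lambda>n. complex_of_real ((\<sigma> u)\<^sup>2 * int_extend ?g (int n - int i) * int_extend ?g (int n - int j))"
  have "(\<lambda>m. ?f (m + i)) = (\<lambda>m. complex_of_real ((\<sigma> u)\<^sup>2 * ?g m * int_extend ?g (int m + (int i - int j))))"
    by (simp add: fun_eq_iff int_extend_def add_diff_eq)
  then have "(\<lambda>m. ?f (m + i)) sums local_cov dens u (int i - int j)" by (simp only: local_cov_dens)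
  moreover have "(\<Sum>n<i. ?f n) = 0" by (rule sum.neutral) (auto simp: int_extend_def)
  ultimately show ?thesis using sums_iff_shift'[of ?f i] by simp
qed

text \<open>
  The quadratic form of a kernel vector is a vanishing series of squares \<open>\<bar>y n\<bar>\<^sup>2\<close>. The vector
  \<open>y\<close> arises from \<open>v\<close> by a triangular matrix with diagonal \<open>green b 0 = 1\<close>, hence \<open>v = 0\<close>.
\<close>

lemma local_cov_mat_kernel:
  assumes v: "v \<in> carrier_vec p" and ker: "local_cov_mat p dens u *\<^sub>v v = 0\<^sub>v p" and \<sigma>: "\<sigma> u \<noteq> 0"
  shows "v = 0\<^sub>v p"
proof -
  let ?g = "frozen_green p (\<theta> u)"
  define y where "y n = (\<Sum>j<p. vec_index v j * complex_of_real (int_extend ?g (int n - int j)))" for n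
  have "(\<lambda>n. \<Sum>i<p. \<Sum>j<p. (cnj (vec_index v i) * vec_index v j) *
        complex_of_real ((\<sigma> u)\<^sup>2 * int_extend ?g (int n - int i) * int_extend ?g (int n - int j)))
      sums (\<Sum>i<p. \<Sum>j<p. (cnj (vec_index v i) * vec_index v j) * local_cov dens u (int i - int j))"
    by (intro sums_sum sums_mult local_cov_shifted)
  moreover have "(\<Sum>i<p. \<Sum>j<p. (cnj (vec_index v i) * vec_index v j) * local_cov dens u (int i - int j)) = 0"
  proof (rule sum.neutral, intro ballI)
    fix i assume "i \<in> {..<p}"
    then have i: "i < p" by simp
    have "(\<Sum>j<p. (cnj (vec_index v i) * vec_index v j) * local_cov dens u (int i - int j))
        = cnj (vec_index v i) * vec_index (local_cov_mat p dens u *\<^sub>v v) i"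
      unfolding mult_local_cov_mat[OF v i] sum_distrib_left by (intro sum.cong refl) (simp only: mult_ac)
    then show "(\<Sum>j<p. (cnj (vec_index v i) * vec_index v j) * local_cov dens u (int i - int j)) = 0"
      using i by (simp add: ker)
  qed
  moreover have "(\<Sum>i<p. \<Sum>j<p. (cnj (vec_index v i) * vec_index v j) *
        complex_of_real ((\<sigma> u)\<^sup>2 * int_extend ?g (int n - int i) * int_extend ?g (int n - int j)))
      = complex_of_real ((\<sigma> u)\<^sup>2 * (cmod (y n))\<^sup>2)" for n
  proof -
    have "complex_of_real ((\<sigma> u)\<^sup>2 * (cmod (y n))\<^sup>2) = complex_of_real ((\<sigma> u)\<^sup>2) * (cnj (y n) * y n)"
      by (simp only: of_real_mult complex_norm_square mult.commute)
    also have "cnj (y n) = (\<Sum>i<p. cnj (vec_index v i) * complex_of_real (int_extend ?g (int n - int i)))"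
      by (simp add: y_def)
    finally show ?thesis
      by (simp add: y_def sum_product sum_distrib_left mult_ac)
  qed
  ultimately have "(\<lambda>n. complex_of_real ((\<sigma> u)\<^sup>2 * (cmod (y n))\<^sup>2)) sums 0" by simp
  from sums_Re[OF this] have "(\<lambda>n. (\<sigma> u)\<^sup>2 * (cmod (y n))\<^sup>2) sums 0" by simp
  then have "(\<sigma> u)\<^sup>2 * (cmod (y n))\<^sup>2 = 0" for n
    using suminf_eq_zero_iff[of "\<lambda>n. (\<sigma> u)\<^sup>2 * (cmod (y n))\<^sup>2"] by (auto simp: sums_iff)
  then have y0: "y n = 0" for n using \<sigma> by simp
  have "vec_index v i = 0" if "i < p" for i
    using that
  proof (induction i rule: less_induct)
    case (less i)
    have "y i = (\<Sum>j<p. if j = i then vec_index v i else 0)"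
      unfolding y_def
    proof (intro sum.cong refl)
      fix j assume "j \<in> {..<p}"
      then show "vec_index v j * complex_of_real (int_extend ?g (int i - int j)) = (if j = i then vec_index v i else 0)"
        using less.IH[of j] less.prems by (cases i j rule: linorder_cases) (auto simp: int_extend_def)
    qed
    then show ?case using y0[of i] less.prems by simp
  qed
  then show ?thesis using v by (intro eq_vecI) auto
qed

lemma local_prediction:
  assumes "\<sigma> u \<noteq> 0"
  shows "invertible_mat (local_cov_mat p dens u)" "coeff_vec p (\<theta> u) = local_coeffs p dens u"
proof -
  note I = trivial_kernel_imp_invertible[OF local_cov_mat_carrier local_cov_mat_kernel[OF _ _ assms]]
  show "invertible_mat (local_cov_mat p dens u)" by (rule I(1))
  have "the (mat_inverse (local_cov_mat p dens u)) *\<^sub>v (local_cov_mat p dens u *\<^sub>v coeff_vec p (\<theta> u)) = coeff_vec p (\<theta> u)"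
    by (rule I(2)) (simp_all add: coeff_vec_def)
  then show "coeff_vec p (\<theta> u) = local_coeffs p dens u"
    by (simp add: local_coeffs_def local_cov_mat_coeffs)
qed

definition lag_comb :: "int \<Rightarrow> (nat \<Rightarrow> real) \<Rightarrow> 'w \<Rightarrow> real" where
  "lag_comb t c w = (\<Sum>k=1..p. c k * X (t - int k) w)"

lemma lag_comb_L2: "moment_le M 2 (lag_comb t c) (\<Sum>k=1..p. \<bar>c k\<bar> * (K * \<sigma>p / (1 - r)))"
  unfolding lag_comb_def by (intro moment_le_sum moment_le_cmult X_L2) auto

lemma lag_comb_measurable [measurable]: "lag_comb t c \<in> borel_measurable M"
  unfolding lag_comb_def by measurable

lemma lag_comb_noise: "expectation (\<lambda>w. lag_comb t c w * \<xi> s w)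
     = (\<Sum>k=1..p. c k * (if s \<le> t - int k then coef (t - int k) (nat (t - int k - s)) else 0))"
proof -
  have "expectation (\<lambda>w. lag_comb t c w * \<xi> s w) = expectation (\<lambda>w. \<Sum>k=1..p. c k * (X (t - int k) w * \<xi> s w))"
    by (simp add: lag_comb_def sum_distrib_right mult.assoc)
  also have "\<dots> = (\<Sum>k=1..p. c k * expectation (\<lambda>w. X (t - int k) w * \<xi> s w))"
    using L2_product(1)[OF X_L2 noise_L2] by (subst Bochner_Integration.integral_sum) auto
  finally show ?thesis by (simp only: X_noise)
qed

text \<open>
  The recursion turns the prediction error into an innovation plus a combination of past values,
  which are uncorrelated.
\<close>

lemma prediction_error:
  "expectation (\<lambda>w. (X t w - lag_comb t \<phi> w)\<^sup>2)
     = (\<sigma> (real_of_int t / real T))\<^sup>2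
       + expectation (\<lambda>w. (lag_comb t (\<lambda>k. \<theta> (real_of_int t / real T) k - \<phi> k) w)\<^sup>2)"
proof -
  let ?s = "\<sigma> (real_of_int t / real T)"
  let ?Z = "lag_comb t (\<lambda>k. \<theta> (real_of_int t / real T) k - \<phi> k)"
  have "expectation (\<lambda>w. (X t w - lag_comb t \<phi> w)\<^sup>2)
      = expectation (\<lambda>w. ?s\<^sup>2 * (\<xi> t w)\<^sup>2 + (2 * ?s * (?Z w * \<xi> t w) + (?Z w)\<^sup>2))"
  proof (rule integral_cong_AE)
    show "AE w in M. (X t w - lag_comb t \<phi> w)\<^sup>2 = ?s\<^sup>2 * (\<xi> t w)\<^sup>2 + (2 * ?s * (?Z w * \<xi> t w) + (?Z w)\<^sup>2)"
      using X_recursion[of t]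
    proof eventually_elim
      case (elim w)
      have "X t w - lag_comb t \<phi> w = ?s * \<xi> t w + ?Z w"
        unfolding elim by (simp add: lag_comb_def left_diff_distrib sum_subtractf)
      then show ?case by (simp add: power2_eq_square algebra_simps)
    qed
  qed measurable
  also have "\<dots> = ?s\<^sup>2 * expectation (\<lambda>w. (\<xi> t w)\<^sup>2) + (2 * ?s * expectation (\<lambda>w. ?Z w * \<xi> t w) + expectation (\<lambda>w. (?Z w)\<^sup>2))"
  proof -
    have "integrable M (\<lambda>w. (\<xi> t w)\<^sup>2)" "integrable M (\<lambda>w. ?Z w * \<xi> t w)" "integrable M (\<lambda>w. (?Z w)\<^sup>2)"
      using noise_L2[of t] lag_comb_L2[of t "\<lambda>k. \<theta> (real_of_int t / real T) k - \<phi> k"] L2_product(1)[OF lag_comb_L2 noise_L2]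
      by (auto simp: moment_le_def)
    then show ?thesis by simp
  qed
  also have "expectation (\<lambda>w. ?Z w * \<xi> t w) = 0" by (auto simp: lag_comb_noise intro!: sum.neutral)
  finally show ?thesis by (simp add: noise_variance)
qed

text \<open>
  Testing against the innovations at times \<open>t - 1, t - 2, \<dots>\<close> in turn isolates the coefficients,
  since the values before time \<open>t - k\<close> do not involve the innovation at time \<open>t - k\<close>, and the
  coefficients of the values after it are already known to vanish.
\<close>

lemma lag_comb_degenerate:
  assumes z: "expectation (\<lambda>w. (lag_comb t c w)\<^sup>2) = 0"
    and \<sigma>: "\<And>k. k \<in> {1..p} \<Longrightarrow> \<sigma> (real_of_int (t - int k) / real T) \<noteq> 0"
    and k: "k \<in> {1..p}"
  shows "c k = 0"
proof -
  have "integrable M (\<lambda>w. (lag_comb t c w)\<^sup>2)" using lag_comb_L2[of t c] by (simp add: moment_le_def)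
  then have "AE w in M. (lag_comb t c w)\<^sup>2 = 0" using z by (subst (asm) integral_nonneg_eq_0_iff_AE) auto
  then have "AE w in M. lag_comb t c w * \<xi> s w = 0" for s by eventually_elim simp
  then have z': "expectation (\<lambda>w. lag_comb t c w * \<xi> s w) = 0" for s by (rule integral_eq_zero_AE)
  show ?thesis
    using k
  proof (induction k rule: less_induct)
    case (less k)
    have "0 = (\<Sum>j=1..p. c j * (if t - int k \<le> t - int j then coef (t - int j) (nat (t - int j - (t - int k))) else 0))"
      using z'[of "t - int k"] by (simp only: lag_comb_noise)
    also have "\<dots> = (\<Sum>j=1..p. if j = k then c k * \<sigma> (real_of_int (t - int k) / real T) else 0)"
    proof (intro sum.cong refl)
      fix j assume "j \<in> {1..p}"
      then show "c j * (if t - int k \<le> t - int j then coef (t - int j) (nat (t - int j - (t - int k))) else 0)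
          = (if j = k then c k * \<sigma> (real_of_int (t - int k) / real T) else 0)"
        using less.IH[of j] by (cases j k rule: linorder_cases) (auto simp: coef_0)
    qed
    also have "\<dots> = c k * \<sigma> (real_of_int (t - int k) / real T)" using less.prems by simp
    finally show ?case using \<sigma>[OF less.prems] by simp
  qed
qed

end

section \<open>Tapers and the empirical covariance\<close>

lemma taper_bounds:
  assumes "taper N h h'"
  shows "x \<in> {0..1} \<Longrightarrow> \<bar>h x\<bar> \<le> sup_norm_on {0..1} h" "x \<in> {0<..1} \<Longrightarrow> \<bar>h' x\<bar> \<le> sup_norm_on {0<..1} h'"
    "0 \<le> sup_norm_on {0..1} h" "0 \<le> sup_norm_on {0<..1} h'"
proof -
  have 1: "\<bar>h x\<bar> \<le> sup_norm_on {0..1} h" if "x \<in> {0..1}" for x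
    using assms that unfolding taper_def sup_norm_on_def by (intro cSUP_upper) auto
  have 2: "\<bar>h' x\<bar> \<le> sup_norm_on {0<..1} h'" if "x \<in> {0<..1}" for x
    using assms that unfolding taper_def sup_norm_on_def by (intro cSUP_upper) auto
  show "x \<in> {0..1} \<Longrightarrow> \<bar>h x\<bar> \<le> sup_norm_on {0..1} h" "x \<in> {0<..1} \<Longrightarrow> \<bar>h' x\<bar> \<le> sup_norm_on {0<..1} h'"
    using 1 2 by auto
  show "0 \<le> sup_norm_on {0..1} h" "0 \<le> sup_norm_on {0<..1} h'"
    using 1[of 1] 2[of 1] by (auto intro: order_trans[OF abs_ge_zero])
qed

lemma partition_cell:
  fixes us :: "nat \<Rightarrow> real"
  shows "us 0 \<le> x \<Longrightarrow> x < us N \<Longrightarrow> \<exists>i<N. us i \<le> x \<and> x < us (Suc i)"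
proof (induction N)
  case (Suc N)
  then show ?case
  proof (cases "x < us N")
    case True
    then show ?thesis using Suc by (meson less_Suc_eq)
  next
    case False
    then show ?thesis using Suc.prems by (intro exI[of _ N]) auto
  qed
qed simp

text \<open>
  The estimate may fail at the left end point, since a taper may jump there.
\<close>

lemma square_integral_cell:
  fixes h :: "real \<Rightarrow> real"
  assumes lh: "lo < hi" and i: "(\<lambda>x. (h x)\<^sup>2) integrable_on {lo..hi}"
    and b: "\<And>x. x \<in> {lo<..hi} \<Longrightarrow> (h x)\<^sup>2 \<le> c"
  shows "integral {lo..hi} (\<lambda>x. (h x)\<^sup>2) \<le> c * (hi - lo)"
proof -
  let ?g = "\<lambda>x. if x = lo then (h lo)\<^sup>2 else c"
  have "((\<lambda>_. c) has_integral (c * (hi - lo))) {lo..hi}"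
    using has_integral_const_real[of c lo hi] lh by (simp add: mult.commute)
  then have g: "(?g has_integral (c * (hi - lo))) {lo..hi}"
    by (rule has_integral_spike_finite[of "{lo}", rotated 2]) auto
  show ?thesis
    by (rule has_integral_le[OF integrable_integral[OF i] g]) (use b in auto)
qed

text \<open>
  The taper weight is a right-endpoint Riemann sum of \<open>h\<^sup>2\<close>, scaled by \<open>n\<close>. A grid cell without
  a break point in its interior contributes an error of at most \<open>2 a b / n\<^sup>2\<close>, by the mean value
  theorem; any other cell at most \<open>a\<^sup>2 / n\<close>. A break point lies in the interior of at most one
  cell.
\<close>

lemma taper_weight_lower:
  assumes tp: "taper N h h'" and n: "0 < n"
    and a: "a = sup_norm_on {0..1} h" and b: "b = sup_norm_on {0<..1} h'"
  shows "real n - taper_weight h n \<le> 2 * a * b + real N * a\<^sup>2"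
proof -
  obtain us where us: "us 0 = 0" "us N = 1"
    "\<And>i. i < N \<Longrightarrow> us i < us (Suc i)"
    "\<And>i x. i < N \<Longrightarrow> x \<in> {us i<..us (Suc i)} \<Longrightarrow> (h has_real_derivative h' x) (at x within {us i<..us (Suc i)})"
    and hi1: "((\<lambda>x. (h x)\<^sup>2) has_integral 1) {0..1}"
    using tp unfolding taper_def by blast
  note bd = taper_bounds[OF tp, folded a b]
  have us01: "us i \<le> us j" if "i \<le> j" "j \<le> N" for i j
    using that
  proof (induction j)
    case (Suc j)
    then show ?case using us(3)[of j] by (cases "i = Suc j") auto
  qed simp
  have int: "(\<lambda>x. (h x)\<^sup>2) integrable_on {x..y}" if "0 \<le> x" "y \<le> 1" for x y
    by (rule integrable_subinterval_real[of _ 0 1]) (use hi1 that in auto)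
  have sqb: "(h x)\<^sup>2 \<le> a\<^sup>2" if "x \<in> {0..1}" for x
    using bd(1)[OF that] bd(3) by (simp add: abs_le_square_iff[symmetric])
  let ?x = "\<lambda>k. real k / real n"
  let ?J = "\<lambda>k i. if ?x k < us i \<and> us i < ?x (Suc k) then 1 else (0::real)"
  let ?err = "\<lambda>k. 2 * a * b / (real n)\<^sup>2 + a\<^sup>2 / real n * (\<Sum>i<N. ?J k i)"
  have cell: "integral {?x k..?x (Suc k)} (\<lambda>x. (h x)\<^sup>2) \<le> (h (?x (Suc k)))\<^sup>2 / real n + ?err k" if k: "k < n" for k
  proof -
    let ?lo = "?x k" and ?hi = "?x (Suc k)"
    have lh: "?lo < ?hi" "0 \<le> ?lo" "?hi \<le> 1" "?lo < 1" using k n by (auto simp: field_simps)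
    have w: "?hi - ?lo = 1 / real n" using n by (simp add: field_simps)
    have J0: "0 \<le> (\<Sum>i<N. ?J k i)" by (rule sum_nonneg) auto
    have ab0: "0 \<le> 2 * a * b / (real n)\<^sup>2" using bd(3,4) by simp
    obtain i where i: "i < N" "us i \<le> ?lo" "?lo < us (Suc i)"
      using partition_cell[of us ?lo N] us(1,2) lh by auto
    show ?thesis
    proof (cases "?hi \<le> us (Suc i)")
      case True
      have sub: "{?lo<..?hi} \<subseteq> {us i<..us (Suc i)}" using i True by auto
      have "(h x)\<^sup>2 \<le> (h ?hi)\<^sup>2 + 2 * a * b / real n" if x: "x \<in> {?lo<..?hi}" for x
      proof -
        have xs: "x \<in> {us i<..us (Suc i)}" and hs: "?hi \<in> {us i<..us (Suc i)}"
        proof -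
          show "x \<in> {us i<..us (Suc i)}" by (rule subsetD[OF sub x])
          show "?hi \<in> {us i<..us (Suc i)}" by (rule subsetD[OF sub]) (use lh in simp)
        qed
        have "norm (h x - h ?hi) \<le> b * norm (x - ?hi)"
        proof (rule field_differentiable_bound[where S = "{us i<..us (Suc i)}" and f' = h', OF _ _ _ xs hs])
          fix y assume y: "y \<in> {us i<..us (Suc i)}"
          show "(h has_real_derivative h' y) (at y within {us i<..us (Suc i)})" by (rule us(4)[OF i(1) y])
          have "y \<in> {0<..1}" using y us01[of 0 i] us01[of "Suc i" N] i(1) us(1,2) by auto
          then show "norm (h' y) \<le> b" using bd(2) by simp
        qed simp
        also have "\<dots> \<le> b * (1 / real n)" using x w bd(4) by (intro mult_left_mono) auto
        finally have d: "\<bar>h x - h ?hi\<bar> \<le> b * (1 / real n)" by simp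
        have s: "\<bar>h x + h ?hi\<bar> \<le> 2 * a" 
        proof -
          have "0 \<le> x" "x \<le> 1" "0 \<le> ?hi" using x lh unfolding greaterThanAtMost_iff by linarith+
          then have "\<bar>h x\<bar> \<le> a" "\<bar>h ?hi\<bar> \<le> a" using bd(1)[of x] bd(1)[of ?hi] lh(3) by auto
          then show ?thesis by linarith
        qed
        have "(h x)\<^sup>2 - (h ?hi)\<^sup>2 = (h x - h ?hi) * (h x + h ?hi)" by (simp add: power2_eq_square algebra_simps)
        also have "\<dots> \<le> \<bar>h x - h ?hi\<bar> * \<bar>h x + h ?hi\<bar>" by (simp add: abs_mult[symmetric])
        also have "\<dots> \<le> (b * (1 / real n)) * (2 * a)" using d s by (intro mult_mono) auto
        finally show ?thesis by (simp add: mult_ac)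
      qed
      then have "integral {?lo..?hi} (\<lambda>x. (h x)\<^sup>2) \<le> ((h ?hi)\<^sup>2 + 2 * a * b / real n) * (?hi - ?lo)"
        by (intro square_integral_cell int lh) auto
      also have "\<dots> = (h ?hi)\<^sup>2 / real n + 2 * a * b / (real n)\<^sup>2"
        unfolding w by (simp add: power2_eq_square add_divide_distrib)
      also have "\<dots> \<le> (h ?hi)\<^sup>2 / real n + ?err k" using J0 by simp
      finally show ?thesis .
    next
      case False
      then have "Suc i < N" using us(2) lh i(1) by (metis Suc_lessI)
      have "(1::real) = ?J k (Suc i)" using False i by simp
      also have "\<dots> \<le> (\<Sum>i<N. ?J k i)"
        by (rule member_le_sum[of "Suc i" _ "?J k"]) (use \<open>Suc i < N\<close> in auto)
      finally have J1: "1 \<le> (\<Sum>i<N. ?J k i)" .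
      have "integral {?lo..?hi} (\<lambda>x. (h x)\<^sup>2) \<le> a\<^sup>2 * (?hi - ?lo)"
      proof (intro square_integral_cell int lh sqb)
        fix x assume "x \<in> {?lo<..?hi}"
        then show "x \<in> {0..1}" using lh unfolding greaterThanAtMost_iff atLeastAtMost_iff by linarith
      qed
      also have "\<dots> = a\<^sup>2 / real n * 1" unfolding w by simp
      also have "\<dots> \<le> a\<^sup>2 / real n * (\<Sum>i<N. ?J k i)" by (intro mult_left_mono J1) simp
      finally show ?thesis using ab0 by (simp add: add_increasing)
    qed
  qed
  have upto: "integral {0..?x m} (\<lambda>x. (h x)\<^sup>2) \<le> (\<Sum>k<m. (h (?x (Suc k)))\<^sup>2 / real n + ?err k)" if "m \<le> n" for m
    using that
  proof (induction m)
    case (Suc m)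
    have le: "0 \<le> ?x m" "?x m \<le> ?x (Suc m)" "?x (Suc m) \<le> 1" using Suc.prems n by (auto simp: field_simps)
    have "integral {0..?x (Suc m)} (\<lambda>x. (h x)\<^sup>2)
        = integral {0..?x m} (\<lambda>x. (h x)\<^sup>2) + integral {?x m..?x (Suc m)} (\<lambda>x. (h x)\<^sup>2)"
      by (rule Henstock_Kurzweil_Integration.integral_combine[symmetric]) (use le int in auto)
    then show ?case using Suc cell[of m] by simp
  qed simp
  have "1 = integral {0..?x n} (\<lambda>x. (h x)\<^sup>2)" using hi1 n by (simp add: integral_unique)
  also have "\<dots> \<le> (\<Sum>k<n. (h (?x (Suc k)))\<^sup>2 / real n + ?err k)" by (rule upto) simp
  also have "\<dots> = taper_weight h n / real n + 2 * a * b / real n + a\<^sup>2 / real n * (\<Sum>k<n. \<Sum>i<N. ?J k i)"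
  proof -
    have "(\<Sum>k<n. (h (?x (Suc k)))\<^sup>2) = taper_weight h n"
      unfolding taper_weight_def by (rule sum.reindex_bij_witness[where i = "\<lambda>k. k - 1" and j = Suc]) auto
    then show ?thesis
      using n by (simp add: sum.distrib sum_distrib_left[symmetric] sum_divide_distrib[symmetric] power2_eq_square)
  qed
  also have "\<dots> \<le> taper_weight h n / real n + 2 * a * b / real n + a\<^sup>2 / real n * real N"
  proof (intro add_left_mono mult_left_mono)
    have "(\<Sum>k<n. \<Sum>i<N. ?J k i) = (\<Sum>i<N. \<Sum>k<n. ?J k i)" by (rule sum.swap)
    also have "\<dots> \<le> (\<Sum>i<N. 1)"
    proof (rule sum_mono)
      fix i
      have "(\<Sum>k<n. ?J k i) = real (card {k. k < n \<and> ?x k < us i \<and> us i < ?x (Suc k)})"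
        by (subst sum.inter_filter[symmetric]) simp_all
      also have "card {k. k < n \<and> ?x k < us i \<and> us i < ?x (Suc k)} \<le> card {nat \<lfloor>us i * real n\<rfloor>}"
      proof (rule card_mono)
        show "{k. k < n \<and> ?x k < us i \<and> us i < ?x (Suc k)} \<subseteq> {nat \<lfloor>us i * real n\<rfloor>}"
        proof
          fix k assume "k \<in> {k. k < n \<and> ?x k < us i \<and> us i < ?x (Suc k)}"
          then have "real k < us i * real n" "us i * real n < real k + 1" using n by (auto simp: field_simps)
          then have "\<lfloor>us i * real n\<rfloor> = int k" by (intro floor_unique) auto
          then show "k \<in> {nat \<lfloor>us i * real n\<rfloor>}" by simp
        qed
      qed simp
      finally show "(\<Sum>k<n. ?J k i) \<le> 1" by simp
    qed
    finally show "(\<Sum>k<n. \<Sum>i<N. ?J k i) \<le> real N" by simp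
  qed simp
  finally have "1 * real n \<le> (taper_weight h n / real n + 2 * a * b / real n + a\<^sup>2 / real n * real N) * real n"
    using n by (intro mult_right_mono) auto
  also have "\<dots> = taper_weight h n + 2 * a * b + real N * a\<^sup>2"
    using n by (simp add: distrib_right)
  finally show ?thesis by linarith
qed

text \<open>
  Covers both cases of \<open>taper_pair_weights\<close>.
\<close>

definition taper_constant :: "nat \<Rightarrow> real \<Rightarrow> real \<Rightarrow> real" where
  "taper_constant N a b = a * sqrt 2 + sqrt (4 * a * b + 2 * real N * a\<^sup>2)"

definition lag_pairs :: "nat \<Rightarrow> int \<Rightarrow> (nat \<times> nat) set" where
  "lag_pairs n l = {(t1, t2). t1 \<in> {1..n} \<and> t2 \<in> {1..n} \<and> int t1 - int t2 = l}"

lemma finite_lag_pairs: "finite (lag_pairs n l)"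
  by (rule finite_subset[of _ "{1..n} \<times> {1..n}"]) (auto simp: lag_pairs_def)

text \<open>
  Two bounds on the sum of squares are combined. It is at most \<open>a\<^sup>2 / H\<close>, where \<open>H \<ge> n / 2\<close> as soon
  as \<open>n\<close> exceeds a threshold depending on \<open>N\<close>, \<open>a\<close> and \<open>b\<close>. Below the threshold \<open>H\<close> can be
  arbitrarily small, but the sum is always at most 1.
\<close>

lemma taper_pair_weights:
  assumes tp: "taper N h h'" and n: "0 < n" and H: "taper_weight h n \<noteq> 0"
    and a: "a = sup_norm_on {0..1} h" and b: "b = sup_norm_on {0<..1} h'"
  shows "sqrt (\<Sum>(t1, t2)\<in>lag_pairs n l. (h (real t1 / real n) * h (real t2 / real n) / taper_weight h n)\<^sup>2)
           \<le> taper_constant N a b * real n powr (- 1 / 2)"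
proof -
  let ?H = "taper_weight h n" and ?h = "\<lambda>t. h (real t / real n)"
  let ?V = "\<Sum>(t1, t2)\<in>lag_pairs n l. (?h t1 * ?h t2 / ?H)\<^sup>2"
  note bd = taper_bounds[OF tp, folded a b]
  have H0: "0 < ?H" using H sum_nonneg[of "{1..n}" "\<lambda>k. (?h k)\<^sup>2"] by (simp add: taper_weight_def order_less_le)
  have second: "(\<Sum>(t1, t2)\<in>lag_pairs n l. (?h t2)\<^sup>2) \<le> ?H"
  proof -
    have "(\<Sum>(t1, t2)\<in>lag_pairs n l. (?h t2)\<^sup>2) = (\<Sum>t\<in>snd ` lag_pairs n l. (?h t)\<^sup>2)"
      by (subst sum.reindex) (auto simp: inj_on_def lag_pairs_def case_prod_beta)
    also have "\<dots> \<le> ?H"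
      unfolding taper_weight_def by (rule sum_mono2) (auto simp: lag_pairs_def)
    finally show ?thesis .
  qed
  have gen: "?V \<le> c / ?H" if c: "\<And>t. t \<in> {1..n} \<Longrightarrow> (?h t)\<^sup>2 \<le> c" and c0: "0 \<le> c" for c
  proof -
    have "?V \<le> (\<Sum>(t1, t2)\<in>lag_pairs n l. c * (?h t2)\<^sup>2 / ?H\<^sup>2)"
      by (intro sum_mono) (auto simp: lag_pairs_def power_divide power_mult_distrib intro!: divide_right_mono mult_right_mono c)
    also have "\<dots> = c / ?H\<^sup>2 * (\<Sum>(t1, t2)\<in>lag_pairs n l. (?h t2)\<^sup>2)"
      by (simp add: sum_distrib_left case_prod_beta)
    also have "\<dots> \<le> c / ?H\<^sup>2 * ?H" using c0 by (intro mult_left_mono second) simp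
    also have "\<dots> = c / ?H" using H0 by (simp add: power2_eq_square)
    finally show ?thesis .
  qed
  have Va: "?V \<le> a\<^sup>2 / ?H"
  proof (rule gen)
    fix t assume "t \<in> {1..n}"
    then have "real t / real n \<in> {0..1}" using n by auto
    then show "(?h t)\<^sup>2 \<le> a\<^sup>2" using bd(1)[of "real t / real n"] bd(3) by (simp add: abs_le_square_iff[symmetric])
  qed simp
  have V1: "?V \<le> 1"
  proof -
    have "?V \<le> ?H / ?H"
    proof (rule gen)
      show "(?h t)\<^sup>2 \<le> ?H" if "t \<in> {1..n}" for t
        unfolding taper_weight_def by (rule member_le_sum[OF that]) auto
    qed (use H0 in simp)
    then show ?thesis using H0 by simp
  qed
  have low: "real n - ?H \<le> 2 * a * b + real N * a\<^sup>2" by (rule taper_weight_lower[OF tp n a b])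
  let ?E = "4 * a * b + 2 * real N * a\<^sup>2"
  have E0: "0 \<le> ?E" using bd(3,4) by simp
  have np: "real n powr (- 1 / 2) = 1 / sqrt (real n)"
  proof -
    have "real n powr (- (1 / 2)) = inverse (sqrt (real n))"
      using n by (simp only: powr_minus powr_half_sqrt of_nat_0_le_iff)
    then show ?thesis by (simp only: minus_divide_left inverse_eq_divide)
  qed
  have sn: "0 < sqrt (real n)" using n by simp
  have "sqrt ?V * sqrt (real n) \<le> a * sqrt 2 + sqrt ?E"
  proof (cases "?E \<le> real n")
    case True
    then have "real n / 2 \<le> ?H" using low by simp
    then have "a\<^sup>2 / ?H \<le> a\<^sup>2 / (real n / 2)" using n by (intro divide_left_mono) auto
    then have "?V * real n \<le> a\<^sup>2 / (real n / 2) * real n" using Va by (intro mult_right_mono) auto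
    also have "\<dots> = a\<^sup>2 * 2" using n by simp
    finally have "sqrt (?V * real n) \<le> sqrt (a\<^sup>2 * 2)" by (rule real_sqrt_le_mono)
    then have "sqrt ?V * sqrt (real n) \<le> a * sqrt 2" using bd(3) by (simp add: real_sqrt_mult)
    then show ?thesis using real_sqrt_ge_zero[OF E0] by linarith
  next
    case False
    have "?V * real n \<le> 1 * ?E" using V1 False by (intro mult_mono) auto
    then have "sqrt (?V * real n) \<le> sqrt ?E" by (intro real_sqrt_le_mono) simp
    then have "sqrt ?V * sqrt (real n) \<le> sqrt ?E" by (simp add: real_sqrt_mult)
    moreover have "0 \<le> a * sqrt 2" using bd(3) by simp
    ultimately show ?thesis by linarith
  qed
  then show ?thesis unfolding np taper_constant_def using sn by (simp add: pos_le_divide_eq)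
qed

text \<open>
  Depends on \<open>q\<close> through \<open>\<lceil>q\<rceil>\<close> only, hence not continuously. It enters the final bound through the
  moment argument, in which the bound is linear.
\<close>

definition moment_constant :: "real \<Rightarrow> (real \<Rightarrow> real) \<Rightarrow> real" where
  "moment_constant q \<mu> = 2 * sqrt (4 ^ nat \<lceil>q\<rceil> * (2 + 2 * \<mu> (real (4 * nat \<lceil>q\<rceil>))) ^ (2 * nat \<lceil>q\<rceil>))"

context tvar
begin

text \<open>
  The process-dependent factor is \<open>(K * \<sigma>p / (1 - r))\<^sup>2\<close> for every \<open>q\<close>, so that a single constant
  \<open>C'\<close> serves all exponents.
\<close>

lemma emp_cov_moment:
  assumes tp: "taper N h h'" and n: "0 < n" and q: "1 \<le> q"
    and fin: "\<And>q. 0 < q \<Longrightarrow> integrable M (\<lambda>w. \<bar>\<xi> 0 w\<bar> powr q)"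
    and XX: "\<And>s w. XX s T w = X s w"
    and C': "(K * \<sigma>p / (1 - r))\<^sup>2 \<le> C'"
  shows "integrable M (emp_cov h n XX T u l)"
    and "Lp_bound M q (\<lambda>w. emp_cov h n XX T u l w - expectation (emp_cov h n XX T u l))
      (moment_constant q (abs_moments (distr M borel (\<xi> 0))) * C'
         * taper_constant N (sup_norm_on {0..1} h) (sup_norm_on {0<..1} h') * real n powr (- 1 / 2))"
proof -
  let ?a = "sup_norm_on {0..1} h" and ?b = "sup_norm_on {0<..1} h'" and ?H = "taper_weight h n"
  define k where "k = nat \<lceil>q\<rceil>"
  have k: "0 < k" "q \<le> real (2 * k)" using q unfolding k_def by linarith+
  let ?B = "2 + 2 * expectation (\<lambda>w. \<bar>\<xi> 0 w\<bar> ^ (4 * k))"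
  have pw: "\<bar>\<xi> 0 w\<bar> powr real (4 * k) = \<bar>\<xi> 0 w\<bar> ^ (4 * k)" for w
    using k by (intro powr_realpow') auto
  have i4: "integrable M (\<lambda>w. \<bar>\<xi> 0 w\<bar> ^ (4 * k))"
    using fin[of "real (4 * k)"] k(1) by (simp only: pw)
  have am: "abs_moments (distr M borel (\<xi> 0)) (real (4 * k)) = expectation (\<lambda>w. \<bar>\<xi> 0 w\<bar> ^ (4 * k))"
  proof -
    have "abs_moments (distr M borel (\<xi> 0)) (real (4 * k)) = (\<integral>x. \<bar>x\<bar> powr real (4 * k) \<partial>distr M borel (\<xi> 0))"
      using k(1) by (simp add: abs_moments_def)
    also have "\<dots> = expectation (\<lambda>w. \<bar>\<xi> 0 w\<bar> powr real (4 * k))" by (rule integral_distr) auto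
    finally show ?thesis by (simp only: pw)
  qed
  have mc: "moment_constant q (abs_moments (distr M borel (\<xi> 0))) = 2 * sqrt (4 ^ k * ?B ^ (2 * k))"
    unfolding moment_constant_def k_def[symmetric] am by (rule refl)
  have mc0: "0 \<le> 2 * sqrt (4 ^ k * ?B ^ (2 * k))"
    by (intro mult_nonneg_nonneg real_sqrt_ge_zero zero_le_power add_nonneg_nonneg integral_nonneg_AE) auto
  have tc0: "0 \<le> taper_constant N ?a ?b"
    using taper_bounds(3,4)[OF tp] by (simp add: taper_constant_def)
  have C'0: "0 \<le> C'" using C' by (rule order_trans[OF zero_le_power2])
  let ?D = "moment_constant q (abs_moments (distr M borel (\<xi> 0))) * C' * taper_constant N ?a ?b * real n powr (- 1 / 2)"
  have D0: "0 \<le> ?D" unfolding mc using mc0 tc0 C'0 by simp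
  have "integrable M (emp_cov h n XX T u l)
      \<and> moment_le M (2 * k) (\<lambda>w. emp_cov h n XX T u l w - expectation (emp_cov h n XX T u l)) ?D"
  proof (cases "?H = 0")
    case True
    then have "emp_cov h n XX T u l = (\<lambda>_. 0)" by (simp add: emp_cov_def fun_eq_iff)
    then show ?thesis using k(1) moment_le_mono[OF moment_le_zero D0, of "2 * k" M] by simp
  next
    case False
    define base where "base = \<lfloor>u * real T\<rfloor> - int (n div 2)"
    define S where "S = (\<lambda>(t1, t2). base + int t1) ` lag_pairs n l"
    define v where "v s = h (real_of_int (s - base) / real n) * h (real_of_int (s - base - l) / real n) / ?H" for s
    have inj: "inj_on (\<lambda>(t1, t2). base + int t1) (lag_pairs n l)" by (auto simp: inj_on_def lag_pairs_def)
    have S: "finite S" unfolding S_def using finite_lag_pairs by simp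
    have vS: "v (base + int t1) = h (real t1 / real n) * h (real t2 / real n) / ?H" if "(t1, t2) \<in> lag_pairs n l" for t1 t2
    proof -
      have e: "int t1 - l = int t2" using that by (auto simp: lag_pairs_def)
      show ?thesis by (simp add: v_def e)
    qed
    have emp: "emp_cov h n XX T u l w = (\<Sum>s\<in>S. v s * (X s w * X (s - l) w))" for w
    proof -
      have "(\<Sum>s\<in>S. v s * (X s w * X (s - l) w)) = (\<Sum>(t1, t2)\<in>lag_pairs n l. v (base + int t1) * (X (base + int t1) w * X (base + int t1 - l) w))"
        unfolding S_def by (subst sum.reindex[OF inj]) (simp add: case_prod_beta)
      also have "\<dots> = (\<Sum>(t1, t2)\<in>lag_pairs n l. 1 / ?H * (h (real t1 / real n) * h (real t2 / real n)
           * X (\<lfloor>u * real T\<rfloor> + int t1 - int (n div 2)) w * X (\<lfloor>u * real T\<rfloor> + int t2 - int (n div 2)) w))"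
      proof (rule sum.cong[OF refl], clarify)
        fix t1 t2 assume P: "(t1, t2) \<in> lag_pairs n l"
        have e: "base + int t1 = \<lfloor>u * real T\<rfloor> + int t1 - int (n div 2)" "base + int t1 - l = \<lfloor>u * real T\<rfloor> + int t2 - int (n div 2)"
          using P by (auto simp: base_def lag_pairs_def)
        show "v (base + int t1) * (X (base + int t1) w * X (base + int t1 - l) w)
            = 1 / ?H * (h (real t1 / real n) * h (real t2 / real n)
           * X (\<lfloor>u * real T\<rfloor> + int t1 - int (n div 2)) w * X (\<lfloor>u * real T\<rfloor> + int t2 - int (n div 2)) w)"
          unfolding vS[OF P] unfolding e(2) unfolding e(1) by simp
      qed
      also have "\<dots> = emp_cov h n XX T u l w"
        using False unfolding emp_cov_def XX lag_pairs_def sum_distrib_left by (simp add: case_prod_beta)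
      finally show ?thesis by simp
    qed
    have iX: "integrable M (\<lambda>w. X s w * X t w)" for s t by (rule L2_product(1)[OF X_L2 X_L2])
    have int: "integrable M (emp_cov h n XX T u l)" unfolding emp[abs_def] using iX by auto
    have Eemp: "expectation (emp_cov h n XX T u l) = (\<Sum>s\<in>S. v s * expectation (\<lambda>w. X s w * X (s - l) w))"
      unfolding emp[abs_def] using iX by (subst Bochner_Integration.integral_sum) auto
    let ?L = "\<lambda>s. linear_filter (coef s) s"
    have mom: "moment_le M (2 * k) (\<lambda>w. \<Sum>s\<in>S. v s * (?L s w * ?L (s - l) w - expectation (\<lambda>w. ?L s w * ?L (s - l) w)))
        (2 * sqrt (4 ^ k * ?B ^ (2 * k)) * (K * \<sigma>p / (1 - r))\<^sup>2 * sqrt (\<Sum>s\<in>S. (v s)\<^sup>2))"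
      by (rule quadratic_form_moment[OF k(1) i4 S refl coef_filter])
    have "AE w in M. \<forall>s. X s w = ?L s w" unfolding AE_all_countable using X_eq_filter by blast
    then have eq: "AE w in M. (\<Sum>s\<in>S. v s * (?L s w * ?L (s - l) w - expectation (\<lambda>w. ?L s w * ?L (s - l) w)))
        = emp_cov h n XX T u l w - expectation (emp_cov h n XX T u l)"
    proof eventually_elim
      case (elim w)
      have "(\<Sum>s\<in>S. v s * (?L s w * ?L (s - l) w - expectation (\<lambda>w. ?L s w * ?L (s - l) w)))
          = (\<Sum>s\<in>S. v s * (X s w * X (s - l) w) - v s * expectation (\<lambda>w. X s w * X (s - l) w))"
        using elim by (simp add: X_product right_diff_distrib)
      then show ?case unfolding Eemp emp by (simp only: sum_subtractf)
    qed
    have meas: "(\<lambda>w. emp_cov h n XX T u l w - expectation (emp_cov h n XX T u l)) \<in> borel_measurable M"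
      using int by simp
    have V: "sqrt (\<Sum>s\<in>S. (v s)\<^sup>2) \<le> taper_constant N ?a ?b * real n powr (- 1 / 2)"
    proof -
      have "(\<Sum>s\<in>S. (v s)\<^sup>2) = (\<Sum>(t1, t2)\<in>lag_pairs n l. (h (real t1 / real n) * h (real t2 / real n) / ?H)\<^sup>2)"
        unfolding S_def by (subst sum.reindex[OF inj]) (auto simp: vS intro!: sum.cong)
      then show ?thesis using taper_pair_weights[OF tp n False refl refl, of l] by simp
    qed
    have "2 * sqrt (4 ^ k * ?B ^ (2 * k)) * (K * \<sigma>p / (1 - r))\<^sup>2 * sqrt (\<Sum>s\<in>S. (v s)\<^sup>2)
        \<le> 2 * sqrt (4 ^ k * ?B ^ (2 * k)) * C' * (taper_constant N ?a ?b * real n powr (- 1 / 2))"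
      using mc0 C' C'0 by (intro mult_mono V mult_nonneg_nonneg) (auto intro: sum_nonneg)
    also have "\<dots> = ?D" unfolding mc by (simp only: mult.assoc)
    finally have "moment_le M (2 * k) (\<lambda>w. emp_cov h n XX T u l w - expectation (emp_cov h n XX T u l)) ?D"
      by (rule moment_le_mono[OF moment_le_cong_AE[OF mom eq meas]])
    then show ?thesis using int by simp
  qed
  then show "integrable M (emp_cov h n XX T u l)"
    "Lp_bound M q (\<lambda>w. emp_cov h n XX T u l w - expectation (emp_cov h n XX T u l)) ?D"
    using moment_le_imp_Lp_bound q k(2) by auto
qed

end

section \<open>Uniformity over processes and resolutions\<close>

context tvar
begin

lemma risk_eq: 
  assumes "\<And>t w. XX t T w = X t w"
  shows "prediction_risk M p XX t T \<phi> = expectation (\<lambda>w. (X t w - lag_comb t \<phi> w)\<^sup>2)"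
  by (simp add: prediction_risk_def lag_comb_def assms)

text \<open>
  The excess risk of \<open>\<phi>\<close> is the mean square of the predictor with coefficients \<open>\<theta> - \<phi>\<close>.
\<close>

lemma optimal_prediction:
  assumes XX: "\<And>t w. XX t T w = X t w"
  shows "restrict (\<theta> (real_of_int t / real T)) {1..p} \<in> optimal_coeffs M p XX t T"
    and "(\<And>k. k \<in> {1..p} \<Longrightarrow> \<sigma> (real_of_int (t - int k) / real T) \<noteq> 0) \<Longrightarrow>
      optimal_coeffs M p XX t T = {restrict (\<theta> (real_of_int t / real T)) {1..p}}"
proof -
  let ?u = "real_of_int t / real T"
  let ?\<theta> = "restrict (\<theta> ?u) {1..p}"
  let ?D = "\<lambda>\<phi>. expectation (\<lambda>w. (lag_comb t (\<lambda>k. \<theta> ?u k - \<phi> k) w)\<^sup>2)"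
  have risk: "prediction_risk M p XX t T \<phi> = (\<sigma> ?u)\<^sup>2 + ?D \<phi>" for \<phi>
    unfolding risk_eq[where XX = XX, OF XX] by (rule prediction_error)
  have D0: "0 \<le> ?D \<phi>" for \<phi> by (intro integral_nonneg_AE) auto
  have "lag_comb t (\<lambda>k. \<theta> ?u k - ?\<theta> k) w = 0" for w by (simp add: lag_comb_def)
  then have D\<theta>: "?D ?\<theta> = 0" by simp
  show opt: "?\<theta> \<in> optimal_coeffs M p XX t T"
    unfolding optimal_coeffs_def is_arg_min_def mem_Collect_eq risk
    using D0 D\<theta> by (auto simp: not_less)
  show "optimal_coeffs M p XX t T = {?\<theta>}"
    if \<sigma>0: "\<And>k. k \<in> {1..p} \<Longrightarrow> \<sigma> (real_of_int (t - int k) / real T) \<noteq> 0"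
  proof -
    have "\<phi> = ?\<theta>" if "\<phi> \<in> optimal_coeffs M p XX t T" for \<phi>
    proof -
      have \<phi>: "\<phi> \<in> {1..p} \<rightarrow>\<^sub>E UNIV" and "\<not> prediction_risk M p XX t T ?\<theta> < prediction_risk M p XX t T \<phi>"
        using that by (auto simp: optimal_coeffs_def is_arg_min_def)
      then have "?D \<phi> \<le> 0" unfolding risk using D\<theta> by simp
      then have "?D \<phi> = 0" using D0[of \<phi>] by simp
      then have "\<theta> ?u k - \<phi> k = 0" if "k \<in> {1..p}" for k
        using lag_comb_degenerate[of t "\<lambda>k. \<theta> ?u k - \<phi> k" k] \<sigma>0 that by blast
      then show ?thesis using \<phi> by (intro ext) (auto simp: PiE_def extensional_def restrict_def)
    qed
    with opt show ?thesis by blast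
  qed
qed

text \<open>
  If \<open>\<rho> > 0\<close> the present innovation has a positive coefficient. In general a filter with all
  coefficients 0 vanishes almost surely.
\<close>

lemma X_atomless:
  assumes "\<And>x. prob {w \<in> space M. \<xi> 0 w = x} = 0" and nz: "0 < \<rho> \<or> \<not> (AE w in M. X t w = 0)"
  shows "prob {w \<in> space M. X t w = 0} = 0"
proof -
  have "\<exists>n. coef t n \<noteq> 0"
  proof (rule ccontr)
    assume "\<not> ?thesis"
    then have c0: "coef t n = 0" for n by blast
    then have "AE w in M. X t w = 0" using X_eq_filter[of t] by (simp add: linear_filter_def c0)
    with nz have "0 < \<rho>" by blast
    then have "0 < \<sigma> (real_of_int t / real T)" using \<sigma>_range(1) \<sigma>p by (metis less_le_trans mult_pos_pos)
    with c0[of 0] show False by (simp add: coef_0)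
  qed
  then obtain n where "coef t n \<noteq> 0" ..
  from linear_filter_atomless[OF coef_filter this assms(1)] X_eq_filter[of t]
  have "AE w in M. X t w \<noteq> 0" by eventually_elim simp
  then have "AE w in M. \<not> X t w = 0" .
  then show ?thesis by (subst prob_eq_0) auto
qed

lemma spectral_lower_bound:
  "(\<rho> * \<sigma>p)\<^sup>2 / (2 * pi) * (1 / ((1 + \<delta>) ^ p)\<^sup>2) \<le> tvar_spectral_density p \<theta> \<sigma> u x"
proof -
  let ?A = "ar_poly p \<theta> (exp (- \<i> * complex_of_real x)) u"
  have "0 < cmod ?A" using ar_poly_nonzero_circle[OF \<theta>_stable \<delta>, of "exp (- \<i> * complex_of_real x)" u] by simp
  moreover have "cmod ?A \<le> (1 + \<delta>) ^ p" by (rule ar_poly_bounds(2)[OF \<delta> \<theta>_stable]) simp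
  ultimately have "1 / ((1 + \<delta>) ^ p)\<^sup>2 \<le> 1 / (cmod ?A)\<^sup>2"
    by (intro frac_le power_mono) auto
  moreover have "(\<rho> * \<sigma>p)\<^sup>2 / (2 * pi) \<le> (\<sigma> u)\<^sup>2 / (2 * pi)"
    using \<sigma>_range(1)[of u] \<rho> \<sigma>p by (intro divide_right_mono power_mono) auto
  ultimately have "(\<rho> * \<sigma>p)\<^sup>2 / (2 * pi) * (1 / ((1 + \<delta>) ^ p)\<^sup>2) \<le> (\<sigma> u)\<^sup>2 / (2 * pi) * (1 / (cmod ?A)\<^sup>2)"
    by (intro mult_mono) auto
  also have "\<dots> = tvar_spectral_density p \<theta> \<sigma> u x"
    unfolding tvar_spectral_density_def power_int_minus power_int_numeral inverse_eq_divide by (rule refl)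
  finally show ?thesis .
qed

end

lemma ball_prodI: "(\<And>x y. (x, y) \<in> A \<Longrightarrow> P x y) \<Longrightarrow> \<forall>(x, y)\<in>A. P x y"
  by auto

text \<open>
  The type argument fixes the type of the sample points, over which the quantifier over
  probability spaces ranges.
\<close>

definition uniform_constants ::
    "'w itself \<Rightarrow> nat \<Rightarrow> real \<Rightarrow> real \<Rightarrow> real \<Rightarrow> real \<Rightarrow> real \<Rightarrow> real \<Rightarrow> real \<Rightarrow> nat \<Rightarrow> bool" where
  "uniform_constants (w :: 'w itself) p \<delta> \<beta> R0 \<sigma>p r K C T0 \<longleftrightarrow>
     (\<forall>\<rho>\<in>{0..1}. \<forall>(\<theta>, \<sigma>)\<in>tvar_class p \<beta> R0 \<delta> \<rho> \<sigma>p. \<forall>(M :: 'w measure) \<xi> X.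
        innovations M \<xi> \<longrightarrow> tvar_process M p \<theta> \<sigma> \<xi> T0 X \<longrightarrow>
        (\<forall>T\<ge>T0. tvar M \<xi> p \<delta> \<beta> R0 \<rho> \<sigma>p \<theta> \<sigma> r K C T (\<lambda>t. X t T)))"

lemma uniform_constantsD:
  assumes "uniform_constants TYPE('w) p \<delta> \<beta> R0 \<sigma>p r K C T0" "\<rho> \<in> {0..1}" "(\<theta>, \<sigma>) \<in> tvar_class p \<beta> R0 \<delta> \<rho> \<sigma>p"
    "innovations (M :: 'w measure) \<xi>" "tvar_process M p \<theta> \<sigma> \<xi> T0 X" "T0 \<le> T"
  shows "tvar M \<xi> p \<delta> \<beta> R0 \<rho> \<sigma>p \<theta> \<sigma> r K C T (\<lambda>t. X t T)"
  using assms unfolding uniform_constants_def by blast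

lemma uniform_constants_exist:
  fixes p :: nat and \<delta> \<beta> R0 \<sigma>p :: real
  assumes par: "\<delta> \<in> {0<..<1}" "0 < \<beta>" "0 < R0" "0 < \<sigma>p"
  obtains r K C T0 where "1 \<le> T0" "uniform_constants TYPE('w) p \<delta> \<beta> R0 \<sigma>p r K C T0"
proof -
  obtain r K C T0 where rK: "0 < r" "r < 1" "0 \<le> K" "0 \<le> C" "(1::nat) \<le> T0"
    and U: "\<And>\<theta> T. \<theta> \<in> holder_ball p \<beta> R0 \<inter> stable_set p \<delta> \<Longrightarrow> T0 \<le> T \<Longrightarrow>
        (\<forall>u n. \<bar>frozen_green p (\<theta> u) n\<bar> \<le> K * r ^ n)
        \<and> (\<forall>t n. \<bar>tvar_green p \<theta> T t n\<bar> \<le> K * r ^ n)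
        \<and> (\<forall>t t0 n. \<bar>tvar_green p \<theta> T t n - frozen_green p (\<theta> (real_of_int t0 / real T)) n\<bar>
             \<le> C * real T powr (- min 1 \<beta>) * (1 + \<bar>real_of_int (t - t0)\<bar>) * r ^ n)"
    using tvar_green_uniform[of \<delta> \<beta> R0 p] par by auto
  have "uniform_constants TYPE('w) p \<delta> \<beta> R0 \<sigma>p r K C T0"
    unfolding uniform_constants_def
  proof (intro ball_prodI ballI allI impI)
    fix \<rho> \<theta> \<sigma> and M :: "'w measure" and \<xi> X T
    assume \<rho>: "\<rho> \<in> {0..1}" and tc: "(\<theta>, \<sigma>) \<in> tvar_class p \<beta> R0 \<delta> \<rho> \<sigma>p"
      and inn: "innovations M \<xi>" and proc: "tvar_process M p \<theta> \<sigma> \<xi> T0 X" and T: "T0 \<le> T"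
    have \<theta>: "\<theta> \<in> holder_ball p \<beta> R0 \<inter> stable_set p \<delta>" using tc by (simp add: tvar_class_def)
    interpret prob_space M using inn by (simp add: innovations_def)
    show "tvar M \<xi> p \<delta> \<beta> R0 \<rho> \<sigma>p \<theta> \<sigma> r K C T (\<lambda>t. X t T)"
    proof unfold_locales
      show "innovations M \<xi>" "(\<theta>, \<sigma>) \<in> tvar_class p \<beta> R0 \<delta> \<rho> \<sigma>p" by fact+
    qed (use U[OF \<theta> T] rK par \<rho> T proc in \<open>auto simp: tvar_process_def\<close>)
  qed
  with rK(5) show ?thesis by (rule that)
qed

text \<open>
  The constants \<open>r\<close>, \<open>K\<close> and \<open>C\<close> are given, so \<open>R\<close> may depend on them.
\<close>

lemma uniform_weak_local_stationarity:
  fixes p :: nat and \<delta> \<beta> R0 \<sigma>p r K C :: real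
  assumes par: "\<delta> \<in> {0<..<1}" "0 < \<beta>"
  obtains R where "0 < R"
    "\<And>\<rho> \<theta> \<sigma> T0 (M :: 'w measure) \<xi> X. (\<And>T. T0 \<le> T \<Longrightarrow> tvar M \<xi> p \<delta> \<beta> R0 \<rho> \<sigma>p \<theta> \<sigma> r K C T (\<lambda>t. X t T)) \<Longrightarrow>
       weakly_locally_stationary M \<beta> R T0 X (tvar_spectral_density p \<theta> \<sigma>)"
proof -
  obtain R1 where R1: "\<And>\<rho> \<theta> \<sigma> x. (\<theta>, \<sigma>) \<in> tvar_class p \<beta> R0 \<delta> \<rho> \<sigma>p
           \<Longrightarrow> (\<lambda>u _. tvar_spectral_density p \<theta> \<sigma> u x) \<in> holder_ball 1 \<beta> R1"
    using spectral_density_holder[of \<delta> \<beta> p R0 \<sigma>p] par unfolding greaterThanLessThan_iff by blast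
  define R2 where "R2 = (2 * C * K * \<sigma>p\<^sup>2 + 4 * K\<^sup>2 * \<sigma>p * R0) / (1 - r)\<^sup>2 / (1 - r)"
  define R where "R = max 1 (max R1 R2)"
  have "R1 \<le> R" by (simp add: R_def)
  then have le: "ereal R1 \<le> ereal R" by (simp only: ereal_less_eq)
  have hb: "g \<in> holder_ball 1 \<beta> R" if "g \<in> holder_ball 1 \<beta> R1" for g :: "real \<Rightarrow> nat \<Rightarrow> real"
    using that unfolding holder_ball_def mem_Collect_eq by (rule order_trans[OF _ le])
  show ?thesis
  proof (rule that)
    show "0 < R" by (simp add: R_def)
    fix \<rho> \<theta> \<sigma> and T0 :: nat and M :: "'w measure" and \<xi> X
    assume tv: "\<And>T. T0 \<le> T \<Longrightarrow> tvar M \<xi> p \<delta> \<beta> R0 \<rho> \<sigma>p \<theta> \<sigma> r K C T (\<lambda>t. X t T)"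
    interpret t0: tvar M \<xi> p \<delta> \<beta> R0 \<rho> \<sigma>p \<theta> \<sigma> r K C T0 "\<lambda>t. X t T0" by (rule tv) simp
    show "weakly_locally_stationary M \<beta> R T0 X (tvar_spectral_density p \<theta> \<sigma>)"
      unfolding weakly_locally_stationary_def
    proof (intro conjI allI impI)
      show "local_spectral_density (tvar_spectral_density p \<theta> \<sigma>)"
        by (rule local_spectral_density_tvar[OF t0.\<theta>_stable t0.\<delta>])
      show "(\<lambda>u _. tvar_spectral_density p \<theta> \<sigma> u x) \<in> holder_ball 1 \<beta> R" for x
        by (rule hb[OF R1[OF t0.in_class]])
    next
      fix t T assume "T0 \<le> T"
      then interpret t: tvar M \<xi> p \<delta> \<beta> R0 \<rho> \<sigma>p \<theta> \<sigma> r K C T "\<lambda>t. X t T" by (rule tv)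
      show "X t T \<in> borel_measurable M" by (rule t.X_measurable)
      show "integrable M (\<lambda>w. (X t T w)\<^sup>2)" using t.X_L2[of t] by (simp add: moment_le_def)
    next
      fix t l T assume "T0 \<le> T"
      then interpret t: tvar M \<xi> p \<delta> \<beta> R0 \<rho> \<sigma>p \<theta> \<sigma> r K C T "\<lambda>t. X t T" by (rule tv)
      have "t.cov_const * real T powr (- min 1 \<beta>) \<le> R * real T powr (- min 1 \<beta>)"
        unfolding t.cov_const_def R_def R2_def by (intro mult_right_mono) auto
      then show "cmod (complex_of_real (cov M (X t T) (X (t - l) T)) - local_cov (tvar_spectral_density p \<theta> \<sigma>) (real_of_int t / real T) l)
          \<le> R * real T powr (- min 1 \<beta>)"
        using t.weak_local_stationarity[of t l] by linarith
    qed
  qed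
qed

theorem theorem4p1:
  shows
    "(\<forall>p \<delta> \<beta> R0 \<sigma>p. 1 \<le> p \<longrightarrow> \<delta> \<in> {0<..<1} \<longrightarrow> 0 < \<beta> \<longrightarrow> 0 < R0 \<longrightarrow> 0 < \<sigma>p \<longrightarrow>
        (\<exists>R>0. \<exists>T0\<ge>1. \<forall>\<rho>\<in>{0..1}. \<forall>(\<theta>, \<sigma>)\<in>tvar_class p \<beta> R0 \<delta> \<rho> \<sigma>p.
           \<forall>(M :: 'w measure) \<xi> X. innovations M \<xi> \<longrightarrow> tvar_process M p \<theta> \<sigma> \<xi> T0 X \<longrightarrow>
             (let f = tvar_spectral_density p \<theta> \<sigma> in
              weakly_locally_stationary M \<beta> R T0 X f \<and>
              (\<forall>t. \<forall>T\<ge>T0. let u = real_of_int t / real T in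
                 restrict (\<theta> u) {1..p} \<in> optimal_coeffs M p X t T \<and>
                 ((\<forall>k\<in>{1..p}. \<sigma> (real_of_int (t - int k) / real T) \<noteq> 0) \<longrightarrow>
                    optimal_coeffs M p X t T = {restrict (\<theta> u) {1..p}}) \<and>
                 local_cov_mat p f u *\<^sub>v coeff_vec p (\<theta> u) = local_cov_vec p f u \<and>
                 (\<sigma> u \<noteq> 0 \<longrightarrow>
                    invertible_mat (local_cov_mat p f u) \<and>
                    coeff_vec p (\<theta> u) = local_coeffs p f u)))))
   \<and>
     (\<forall>p \<delta> \<rho> \<beta> R0 \<sigma>p. 1 \<le> p \<longrightarrow> \<delta> \<in> {0<..<1} \<longrightarrow> \<rho> \<in> {0<..1} \<longrightarrow>
        0 < \<beta> \<longrightarrow> 0 < R0 \<longrightarrow> 0 < \<sigma>p \<longrightarrow>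
        (\<exists>R>0. \<exists>T0\<ge>1. \<exists>fmin>0. \<forall>(\<theta>, \<sigma>)\<in>tvar_class p \<beta> R0 \<delta> \<rho> \<sigma>p.
           \<forall>(M :: 'w measure) \<xi> X. innovations M \<xi> \<longrightarrow> tvar_process M p \<theta> \<sigma> \<xi> T0 X \<longrightarrow>
             weakly_locally_stationary M \<beta> R T0 X (tvar_spectral_density p \<theta> \<sigma>) \<and>
             (\<forall>u x. fmin \<le> tvar_spectral_density p \<theta> \<sigma> u x)))
   \<and>
     (\<forall>p \<delta> \<beta> R0 \<sigma>p. 1 \<le> p \<longrightarrow> \<delta> \<in> {0<..<1} \<longrightarrow> 0 < \<beta> \<longrightarrow> 0 < R0 \<longrightarrow> 0 < \<sigma>p \<longrightarrow>
        (\<exists>T0\<ge>1. \<forall>\<rho>\<in>{0..1}. \<forall>(\<theta>, \<sigma>)\<in>tvar_class p \<beta> R0 \<delta> \<rho> \<sigma>p.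
           \<forall>(M :: 'w measure) \<xi> X. innovations M \<xi> \<longrightarrow> tvar_process M p \<theta> \<sigma> \<xi> T0 X \<longrightarrow>
             (\<forall>x. prob_space.prob M {w \<in> space M. \<xi> 0 w = x} = 0) \<longrightarrow>
             (\<forall>t. \<forall>T\<ge>T0. 0 < \<rho> \<or> \<not> (AE w in M. X t T w = 0) \<longrightarrow>
                prob_space.prob M {w \<in> space M. X t T w = 0} = 0)))
   \<and>
     (\<exists>K \<kappa>. continuous_constant K \<and>
        (\<forall>p \<delta> \<beta> R0 \<sigma>p. 1 \<le> p \<longrightarrow> \<delta> \<in> {0<..<1} \<longrightarrow> 0 < \<beta> \<longrightarrow> 0 < R0 \<longrightarrow> 0 < \<sigma>p \<longrightarrow>
          (\<exists>C>0. \<exists>T0\<ge>1. \<forall>\<rho>\<in>{0..1}. \<forall>(\<theta>, \<sigma>)\<in>tvar_class p \<beta> R0 \<delta> \<rho> \<sigma>p.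
             \<forall>(M :: 'w measure) \<xi> X. innovations M \<xi> \<longrightarrow> tvar_process M p \<theta> \<sigma> \<xi> T0 X \<longrightarrow>
               (\<forall>q>0. integrable M (\<lambda>w. \<bar>\<xi> 0 w\<bar> powr q)) \<longrightarrow>
               assumption_C K \<kappa> M T0 X C (distr M borel (\<xi> 0)))))"
proof (intro conjI, goal_cases)
  case 1
  show ?case
  proof (intro allI impI, goal_cases)
    case (1 p \<delta> \<beta> R0 \<sigma>p)
    then have par: "\<delta> \<in> {0<..<1}" "0 < \<beta>" "0 < R0" "0 < \<sigma>p" by auto
    obtain r K C T0 where T0: "1 \<le> T0" and uc: "uniform_constants TYPE('w) p \<delta> \<beta> R0 \<sigma>p r K C T0"
      by (rule uniform_constants_exist[OF par])
    obtain R where R: "0 < R" and wls: "\<And>\<rho> \<theta> \<sigma> T0 (M :: 'w measure) \<xi> X.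
        (\<And>T. T0 \<le> T \<Longrightarrow> tvar M \<xi> p \<delta> \<beta> R0 \<rho> \<sigma>p \<theta> \<sigma> r K C T (\<lambda>t. X t T)) \<Longrightarrow>
        weakly_locally_stationary M \<beta> R T0 X (tvar_spectral_density p \<theta> \<sigma>)"
      by (rule uniform_weak_local_stationarity[OF par(1,2), where p = p and ?R0.0 = R0 and \<sigma>p = \<sigma>p and r = r and K = K and C = C and 'w = 'w]) blast
    show ?case
      unfolding Let_def
    proof (rule exI[of _ R], rule conjI, rule R, rule exI[of _ T0], rule conjI, rule T0,
        intro ball_prodI ballI allI impI, goal_cases)
      case (1 \<rho> \<theta> \<sigma> M \<xi> X)
      note TV = uniform_constantsD[OF uc 1]
      show ?case
      proof (intro conjI allI impI, goal_cases)
        case 1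
        show ?case by (rule wls) (rule TV)
      next
        case (2 t T)
        then interpret tvar M \<xi> p \<delta> \<beta> R0 \<rho> \<sigma>p \<theta> \<sigma> r K C T "\<lambda>t. X t T" by (intro TV)
        show ?case by (rule optimal_prediction(1)) (rule refl)
      next
        case (3 t T)
        then interpret tvar M \<xi> p \<delta> \<beta> R0 \<rho> \<sigma>p \<theta> \<sigma> r K C T "\<lambda>t. X t T" by (intro TV)
        show ?case by (rule optimal_prediction(2)) (use 3 in auto)
      next
        case (4 t T)
        then interpret tvar M \<xi> p \<delta> \<beta> R0 \<rho> \<sigma>p \<theta> \<sigma> r K C T "\<lambda>t. X t T" by (intro TV)
        show ?case by (rule local_cov_mat_coeffs)
      next
        case (5 t T)
        then interpret tvar M \<xi> p \<delta> \<beta> R0 \<rho> \<sigma>p \<theta> \<sigma> r K C T "\<lambda>t. X t T" by (intro TV)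
        show ?case by (rule local_prediction(1)) (rule 5)
      next
        case (6 t T)
        then interpret tvar M \<xi> p \<delta> \<beta> R0 \<rho> \<sigma>p \<theta> \<sigma> r K C T "\<lambda>t. X t T" by (intro TV)
        show ?case by (rule local_prediction(2)) (rule 6)
      qed
    qed
  qed
next
  case 2
  show ?case
  proof (intro allI impI, goal_cases)
    case (1 p \<delta> \<rho> \<beta> R0 \<sigma>p)
    then have \<rho>: "\<rho> \<in> {0..1}" "0 < \<rho>" by auto
    from 1 have par: "\<delta> \<in> {0<..<1}" "0 < \<beta>" "0 < R0" "0 < \<sigma>p" by auto
    obtain r K C T0 where T0: "1 \<le> T0" and uc: "uniform_constants TYPE('w) p \<delta> \<beta> R0 \<sigma>p r K C T0"
      by (rule uniform_constants_exist[OF par])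
    obtain R where R: "0 < R" and wls: "\<And>\<rho> \<theta> \<sigma> T0 (M :: 'w measure) \<xi> X.
        (\<And>T. T0 \<le> T \<Longrightarrow> tvar M \<xi> p \<delta> \<beta> R0 \<rho> \<sigma>p \<theta> \<sigma> r K C T (\<lambda>t. X t T)) \<Longrightarrow>
        weakly_locally_stationary M \<beta> R T0 X (tvar_spectral_density p \<theta> \<sigma>)"
      by (rule uniform_weak_local_stationarity[OF par(1,2), where p = p and ?R0.0 = R0 and \<sigma>p = \<sigma>p and r = r and K = K and C = C and 'w = 'w]) blast
    define fmin where "fmin = (\<rho> * \<sigma>p)\<^sup>2 / (2 * pi) * (1 / ((1 + \<delta>) ^ p)\<^sup>2)"
    have fmin: "0 < fmin" unfolding fmin_def using \<rho> par by simp
    show ?case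
    proof (rule exI[of _ R], rule conjI, rule R, rule exI[of _ T0], rule conjI, rule T0,
        rule exI[of _ fmin], rule conjI, rule fmin, intro ball_prodI allI impI, goal_cases)
      case (1 \<theta> \<sigma> M \<xi> X)
      note TV = uniform_constantsD[OF uc \<rho>(1) 1]
      interpret tvar M \<xi> p \<delta> \<beta> R0 \<rho> \<sigma>p \<theta> \<sigma> r K C T0 "\<lambda>t. X t T0" by (rule TV) simp
      have "weakly_locally_stationary M \<beta> R T0 X (tvar_spectral_density p \<theta> \<sigma>)" by (rule wls) (rule TV)
      then show ?case using spectral_lower_bound by (simp add: fmin_def)
    qed
  qed
next
  case 3
  show ?case
  proof (intro allI impI, goal_cases)
    case (1 p \<delta> \<beta> R0 \<sigma>p)
    then have par: "\<delta> \<in> {0<..<1}" "0 < \<beta>" "0 < R0" "0 < \<sigma>p" by auto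
    obtain r K C T0 where T0: "1 \<le> T0" and uc: "uniform_constants TYPE('w) p \<delta> \<beta> R0 \<sigma>p r K C T0"
      by (rule uniform_constants_exist[OF par])
    show ?case
    proof (rule exI[of _ T0], rule conjI, rule T0, intro ball_prodI ballI allI impI, goal_cases)
      case (1 \<rho> \<theta> \<sigma> M \<xi> X t T)
      then interpret tvar M \<xi> p \<delta> \<beta> R0 \<rho> \<sigma>p \<theta> \<sigma> r K C T "\<lambda>t. X t T" by (intro uniform_constantsD[OF uc])
      show ?case by (rule X_atomless) (use 1 in auto)
    qed
  qed
next
  case 4
  show ?case
  proof (rule exI[of _ "\<lambda>N l q m a b C. m * C * taper_constant N a b"], rule exI[of _ moment_constant],
      intro conjI allI impI, goal_cases)
    case 1
    show ?case
      unfolding continuous_constant_def taper_constant_def case_prod_beta by (intro allI continuous_intros)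
  next
    case (2 p \<delta> \<beta> R0 \<sigma>p)
    then have par: "\<delta> \<in> {0<..<1}" "0 < \<beta>" "0 < R0" "0 < \<sigma>p" by auto
    obtain r K C T0 where T0: "1 \<le> T0" and uc: "uniform_constants TYPE('w) p \<delta> \<beta> R0 \<sigma>p r K C T0"
      by (rule uniform_constants_exist[OF par])
    \<comment> \<open>The summand 1 makes the constant positive if \<open>K = 0\<close>.\<close>
    define C' where "C' = (K * \<sigma>p / (1 - r))\<^sup>2 + 1"
    have C': "0 < C'" "(K * \<sigma>p / (1 - r))\<^sup>2 \<le> C'" by (simp_all add: C'_def add_nonneg_pos)
    show ?case
    proof (rule exI[of _ C'], rule conjI, rule C'(1), rule exI[of _ T0], rule conjI, rule T0,
        intro ball_prodI ballI allI impI, unfold assumption_C_def, intro allI impI, goal_cases)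
      case (1 \<rho> \<theta> \<sigma> M \<xi> X l N h h' u T n q)
      then interpret tvar M \<xi> p \<delta> \<beta> R0 \<rho> \<sigma>p \<theta> \<sigma> r K C T "\<lambda>t. X t T" by (intro uniform_constantsD[OF uc])
      have "taper N h h'" "0 < n" "1 \<le> q" and fin: "\<And>q. 0 < q \<Longrightarrow> integrable M (\<lambda>w. \<bar>\<xi> 0 w\<bar> powr q)"
        using 1 by blast+
      note E = emp_cov_moment[where XX = X and C' = C', OF this(1-3) fin refl C'(2), of u l]
      show ?case by (intro conjI E)
    qed
  qed
qed

end
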